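(* Let $M$ be a strictly pseudoconvex CR manifold and $\theta$ a contact form on $M$ with $G_\theta$ positive definite. If $(M,\theta)$ has vanishing pseudohermitian torsion ($\tau=0$), then any lengthy geodesic of the Tanaka-Webster connection $\nabla$ of $(M,\theta)$ is a sub-Riemannian geodesic of $(M,H(M),G_\theta)$. Conversely, if every lengthy geodesic $\gamma(t)$ of $\nabla$ is a sub-Riemannian geodesic of $(M,H(M),G_\theta)$, then $\tau=0$.
   Context: Setting. $M$ is an orientable $C^\infty$ manifold of dimension $2n+1$ with a CR structure $T_{1,0}(M)\subset T(M)\otimes\mathbb C$ (a complex subbundle of complex rank $n$, with $T_{1,0}(M)\cap\overline{T_{1,0}(M)}=(0)$, closed under Lie brackets). $H(M)=\mathrm{Re}\{T_{1,0}(M)\oplus\overline{T_{1,0}(M)}\}$ is the Levi distribution, with complex structure $J(Z+\overline Z)=i(Z-\overline Z)$, $Z\in T_{1,0}(M)$. $\theta$ is a nowhere zero real $1$-form with $\mathrm{Ker}(\theta)=H(M)$; convention: $d\theta(X,Y)=\frac12\{X(\theta(Y))-Y(\theta(X))-\theta([X,Y])\}$. $G_\theta(X,Y)=(d\theta)(X,JY)$ on $H(M)$, assumed positive definite (strict pseudoconvexity). $T$ is the vector field with $\theta(T)=1$, $T\rfloor d\theta=0$; set $JT=0$. The Webster metric is the Riemannian metric $g_\theta$ with $g_\theta=G_\theta$ on $H(M)$, $g_\theta(X,T)=0$ for $X\in H(M)$, $g_\theta(T,T)=1$. The Tanaka-Webster connection $\nabla$ is the unique linear connection such that $H(M)$ is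 parallel, $\nabla g_\theta=0$, $\nabla J=0$, and its torsion $T_\nabla$ satisfies $T_\nabla(Z,W)=0$, $T_\nabla(Z,\overline W)=2(d\theta)(Z,\overline W)T$ for $Z,W\in T_{1,0}(M)$, and $\tau\circ J+J\circ\tau=0$, where $\tau(X)=T_\nabla(T,X)$ is the pseudohermitian torsion. A curve is lengthy if $\dot\gamma(t)\in H(M)_{\gamma(t)}$ for all $t$. Define $g(x):T_x^*(M)\to H(M)_x$ by $G_{\theta,x}(v,g(x)\xi)=\xi(v)$ for $v\in H(M)_x$, $\xi\in T^*_x(M)$; in local coordinates $g\,dx^i=g^{ij}\partial_j$. A cotangent lift of $\gamma$ is a curve $\xi(t)\in T^*_{\gamma(t)}(M)$ with $g(\gamma(t))\xi(t)=\dot\gamma(t)$. A sub-Riemannian geodesic of $(M,H(M),G_\theta)$ is a $C^2$ curve $\gamma(t)=(x^i(t))$ such that for some cotangent lift $\xi(t)$ of $\gamma$ the Hamilton-Jacobi equations of $\frac12g^{ij}(x)\xi_i\xi_j$ hold: $\frac{dx^i}{dt}=g^{ij}(\gamma(t))\xi_j(t)$, $\frac{d\xi_k}{dt}=-\frac12\frac{\partial g^{ij}}{\partial x^k}(\gamma(t))\xi_i(t)\xi_j(t)$. *)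

theory Defs
  imports "HOL-Analysis.Analysis"
begin

section \<open>Differentiability classes on open subsets of normed spaces\<close>

primrec Ck_on :: "nat \<Rightarrow> 'a::real_normed_vector set \<Rightarrow> ('a \<Rightarrow> 'b::real_normed_vector) \<Rightarrow> bool" where
  "Ck_on 0 S f \<longleftrightarrow> continuous_on S f"
| "Ck_on (Suc k) S f \<longleftrightarrow>
     (\<forall>x\<in>S. f differentiable (at x)) \<and> (\<forall>v. Ck_on k S (\<lambda>x. frechet_derivative f (at x) v))"

definition smooth_on :: "'a::real_normed_vector set \<Rightarrow> ('a \<Rightarrow> 'b::real_normed_vector) \<Rightarrow> bool" where
  "smooth_on S f \<longleftrightarrow> (\<forall>k. Ck_on k S f)"


section \<open>Smooth manifolds\<close>

text \<open>A chart is its domain together with its coordinate map (whose values off the domain are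
  irrelevant). The points of the manifold are all elements of the type \<open>'m\<close>, whose topology is
  Hausdorff and second countable by its type classes; the dimension is \<open>CARD('d)\<close>.\<close>

type_synonym ('m, 'd) chart = "'m set \<times> ('m \<Rightarrow> real ^ 'd)"

definition is_chart :: "('m::topological_space, 'd::finite) chart \<Rightarrow> bool" where
  "is_chart c \<longleftrightarrow> open (fst c) \<and> open (snd c ` fst c) \<and>
     homeomorphism (fst c) (snd c ` fst c) (snd c) (inv_into (fst c) (snd c))"

definition transition :: "('m, 'd::finite) chart \<Rightarrow> ('m, 'd) chart \<Rightarrow> real ^ 'd \<Rightarrow> real ^ 'd" where
  "transition c c' = snd c' \<circ> inv_into (fst c) (snd c)"

definition smooth_atlas :: "('m::{t2_space, second_countable_topology}, 'd::finite) chart set \<Rightarrow> bool" where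
  "smooth_atlas A \<longleftrightarrow> (\<forall>c\<in>A. is_chart c) \<and> (\<Union>c\<in>A. fst c) = UNIV \<and>
     (\<forall>c\<in>A. \<forall>c'\<in>A. smooth_on (snd c ` (fst c \<inter> fst c')) (transition c c'))"

definition orientable :: "('m::{t2_space, second_countable_topology}, 'd::finite) chart set \<Rightarrow> bool" where
  "orientable A \<longleftrightarrow> (\<exists>B. smooth_atlas B \<and> smooth_atlas (A \<union> B) \<and>
     (\<forall>c\<in>B. \<forall>c'\<in>B. \<forall>x\<in>snd c ` (fst c \<inter> fst c').
        det (matrix (frechet_derivative (transition c c') (at x))) > 0))"


section \<open>Tangent vectors, functions and vector fields\<close>

text \<open>The tangent space at a point \<open>p\<close> is modelled on \<open>real ^ 'd\<close> through one preferred chart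
  around \<open>p\<close>: a tangent vector at \<open>p\<close> is the vector of its components in \<open>chart_at A p\<close>. Its
  components in any other chart are obtained with the Jacobian of the transition map. A vector
  field is therefore a function \<open>'m \<Rightarrow> real ^ 'd\<close>, a one-form a function \<open>'m \<Rightarrow> real ^ 'd \<Rightarrow> real\<close>;
  as the preferred chart jumps from point to point, smoothness is always expressed through the
  components with respect to a fixed chart.\<close>

definition chart_at :: "('m, 'd::finite) chart set \<Rightarrow> 'm \<Rightarrow> ('m, 'd) chart" where
  "chart_at A p = (SOME c. c \<in> A \<and> p \<in> fst c)"

definition change :: "('m, 'd::finite) chart \<Rightarrow> ('m, 'd) chart \<Rightarrow> 'm \<Rightarrow> real ^ 'd \<Rightarrow> real ^ 'd" where
  "change c c' p = frechet_derivative (transition c c') (at (snd c p))"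

text \<open>\<open>comps A c p v\<close>: the components in the chart \<open>c\<close> of the tangent vector \<open>v\<close> at \<open>p\<close>.\<close>

definition comps :: "('m, 'd::finite) chart set \<Rightarrow> ('m, 'd) chart \<Rightarrow> 'm \<Rightarrow> real ^ 'd \<Rightarrow> real ^ 'd" where
  "comps A c p v = change (chart_at A p) c p v"

text \<open>\<open>const_vf A c a\<close>: the vector field on the domain of \<open>c\<close> with constant components \<open>a\<close> in \<open>c\<close>.\<close>

definition const_vf :: "('m, 'd::finite) chart set \<Rightarrow> ('m, 'd) chart \<Rightarrow> real ^ 'd \<Rightarrow> 'm \<Rightarrow> real ^ 'd" where
  "const_vf A c a p = change c (chart_at A p) p a"

definition coord_vf :: "('m, 'd::finite) chart set \<Rightarrow> ('m, 'd) chart \<Rightarrow> 'd \<Rightarrow> 'm \<Rightarrow> real ^ 'd" where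
  "coord_vf A c k = const_vf A c (axis k 1)"

definition vf_rep :: "('m, 'd::finite) chart set \<Rightarrow> ('m, 'd) chart \<Rightarrow> ('m \<Rightarrow> real ^ 'd) \<Rightarrow> real ^ 'd \<Rightarrow> real ^ 'd" where
  "vf_rep A c X x = (let p = inv_into (fst c) (snd c) x in comps A c p (X p))"

definition smooth_fun :: "('m, 'd::finite) chart set \<Rightarrow> 'm set \<Rightarrow> ('m \<Rightarrow> real) \<Rightarrow> bool" where
  "smooth_fun A U f \<longleftrightarrow> (\<forall>c\<in>A. smooth_on (snd c ` (U \<inter> fst c)) (f \<circ> inv_into (fst c) (snd c)))"

definition smooth_vf :: "('m, 'd::finite) chart set \<Rightarrow> 'm set \<Rightarrow> ('m \<Rightarrow> real ^ 'd) \<Rightarrow> bool" where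
  "smooth_vf A U X \<longleftrightarrow> (\<forall>c\<in>A. smooth_on (snd c ` (U \<inter> fst c)) (vf_rep A c X))"

definition smooth_one_form :: "('m, 'd::finite) chart set \<Rightarrow> ('m \<Rightarrow> real ^ 'd \<Rightarrow> real) \<Rightarrow> bool" where
  "smooth_one_form A \<theta> \<longleftrightarrow> (\<forall>p. linear (\<theta> p)) \<and>
     (\<forall>c\<in>A. \<forall>k. smooth_on (snd c ` fst c) ((\<lambda>p. \<theta> p (coord_vf A c k p)) \<circ> inv_into (fst c) (snd c)))"

definition dir_deriv :: "('m, 'd::finite) chart set \<Rightarrow> 'm \<Rightarrow> real ^ 'd \<Rightarrow> ('m \<Rightarrow> real) \<Rightarrow> real" where
  "dir_deriv A p v f =
     (let c = chart_at A p in frechet_derivative (f \<circ> inv_into (fst c) (snd c)) (at (snd c p)) v)"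

text \<open>\<open>[X,Y]\<^sup>i = X\<^sup>j \<partial>\<^sub>j Y\<^sup>i - Y\<^sup>j \<partial>\<^sub>j X\<^sup>i\<close>, evaluated at \<open>p\<close> in the preferred chart of \<open>p\<close>.\<close>

definition bracket :: "('m, 'd::finite) chart set \<Rightarrow> ('m \<Rightarrow> real ^ 'd) \<Rightarrow> ('m \<Rightarrow> real ^ 'd) \<Rightarrow> 'm \<Rightarrow> real ^ 'd" where
  "bracket A X Y p = (let c = chart_at A p; x = snd c p in
     frechet_derivative (vf_rep A c Y) (at x) (X p) - frechet_derivative (vf_rep A c X) (at x) (Y p))"

text \<open>Tensors such as \<open>d\<theta>\<close> and the torsion are defined by formulas on vector fields; their value
  on tangent vectors is obtained by inserting the following local extension (by tensoriality,
  every other one gives the same value).\<close>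

definition extend :: "('m, 'd::finite) chart set \<Rightarrow> 'm \<Rightarrow> real ^ 'd \<Rightarrow> 'm \<Rightarrow> real ^ 'd" where
  "extend A p v = const_vf A (chart_at A p) v"

text \<open>Note the factor \<open>1/2\<close> in the convention for \<open>d\<theta>\<close>.\<close>

definition ext_deriv ::
  "('m, 'd::finite) chart set \<Rightarrow> ('m \<Rightarrow> real ^ 'd \<Rightarrow> real) \<Rightarrow> 'm \<Rightarrow> real ^ 'd \<Rightarrow> real ^ 'd \<Rightarrow> real" where
  "ext_deriv A \<theta> p v w = (let X = extend A p v; Y = extend A p w in
     1/2 * (dir_deriv A p v (\<lambda>q. \<theta> q (Y q)) - dir_deriv A p w (\<lambda>q. \<theta> q (X q))
              - \<theta> p (bracket A X Y p)))"


section \<open>Complexified tangent vectors\<close>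

definition Re_vec :: "complex ^ 'd \<Rightarrow> real ^ 'd" where "Re_vec Z = (\<chi> i. Re (Z $ i))"
definition Im_vec :: "complex ^ 'd \<Rightarrow> real ^ 'd" where "Im_vec Z = (\<chi> i. Im (Z $ i))"
definition cnj_vec :: "complex ^ 'd \<Rightarrow> complex ^ 'd" where "cnj_vec Z = (\<chi> i. cnj (Z $ i))"
definition of_real_vec :: "real ^ 'd \<Rightarrow> complex ^ 'd" where "of_real_vec v = (\<chi> i. complex_of_real (v $ i))"

text \<open>Complex bilinear extension: the value of the extension of \<open>B\<close> at \<open>(X + i Y, X' + i Y')\<close>.\<close>

definition cbilin :: "('v \<Rightarrow> 'v \<Rightarrow> real) \<Rightarrow> 'v \<Rightarrow> 'v \<Rightarrow> 'v \<Rightarrow> 'v \<Rightarrow> complex" where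
  "cbilin B X Y X' Y' = Complex (B X X' - B Y Y') (B X Y' + B Y X')"

definition smooth_cvf :: "('m, 'd::finite) chart set \<Rightarrow> 'm set \<Rightarrow> ('m \<Rightarrow> complex ^ 'd) \<Rightarrow> bool" where
  "smooth_cvf A U Z \<longleftrightarrow> smooth_vf A U (\<lambda>p. Re_vec (Z p)) \<and> smooth_vf A U (\<lambda>p. Im_vec (Z p))"

definition cbracket ::
  "('m, 'd::finite) chart set \<Rightarrow> ('m \<Rightarrow> complex ^ 'd) \<Rightarrow> ('m \<Rightarrow> complex ^ 'd) \<Rightarrow> 'm \<Rightarrow> complex ^ 'd" where
  "cbracket A Z W p = (\<chi> i. cbilin (\<lambda>X Y. bracket A X Y p $ i)
     (\<lambda>q. Re_vec (Z q)) (\<lambda>q. Im_vec (Z q)) (\<lambda>q. Re_vec (W q)) (\<lambda>q. Im_vec (W q)))"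

definition cext_deriv ::
  "('m, 'd::finite) chart set \<Rightarrow> ('m \<Rightarrow> real ^ 'd \<Rightarrow> real) \<Rightarrow> 'm \<Rightarrow> complex ^ 'd \<Rightarrow> complex ^ 'd \<Rightarrow> complex" where
  "cext_deriv A \<theta> p Z W = cbilin (ext_deriv A \<theta> p) (Re_vec Z) (Im_vec Z) (Re_vec W) (Im_vec W)"


section \<open>CR structures and pseudohermitian geometry\<close>

definition CR_structure ::
  "('m::topological_space, 'd::finite) chart set \<Rightarrow> nat \<Rightarrow> ('m \<Rightarrow> (complex ^ 'd) set) \<Rightarrow> bool" where
  "CR_structure A n T10 \<longleftrightarrow>
     (\<forall>p. vec.subspace (T10 p) \<and> vec.dim (T10 p) = n) \<and>
     (\<forall>p. \<exists>U Z. open U \<and> p \<in> U \<and> (\<forall>j<n. smooth_cvf A U (Z j)) \<and>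
        (\<forall>q\<in>U. T10 q = vec.span ((\<lambda>j. Z j q) ` {..<n}))) \<and>
     (\<forall>p. T10 p \<inter> cnj_vec ` T10 p = {0}) \<and>
     (\<forall>U Z W. open U \<and> smooth_cvf A U Z \<and> smooth_cvf A U W \<and> (\<forall>q\<in>U. Z q \<in> T10 q \<and> W q \<in> T10 q)
        \<longrightarrow> (\<forall>q\<in>U. cbracket A Z W q \<in> T10 q))"

definition Levi_distr :: "('m \<Rightarrow> (complex ^ 'd) set) \<Rightarrow> 'm \<Rightarrow> (real ^ 'd) set" where
  "Levi_distr T10 p = Re_vec ` {Z + cnj_vec W | Z W. Z \<in> T10 p \<and> W \<in> T10 p}"

text \<open>The complex structure \<open>J(Z + cnj Z) = i (Z - cnj Z)\<close> of the Levi distribution.\<close>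

definition Levi_J :: "('m \<Rightarrow> (complex ^ 'd) set) \<Rightarrow> 'm \<Rightarrow> real ^ 'd \<Rightarrow> real ^ 'd" where
  "Levi_J T10 p v = (THE w. \<exists>Z\<in>T10 p. of_real_vec v = Z + cnj_vec Z \<and>
                                       of_real_vec w = \<i> *s (Z - cnj_vec Z))"

definition pseudohermitian_form ::
  "('m::topological_space, 'd::finite) chart set \<Rightarrow> ('m \<Rightarrow> (complex ^ 'd) set) \<Rightarrow> ('m \<Rightarrow> real ^ 'd \<Rightarrow> real) \<Rightarrow> bool" where
  "pseudohermitian_form A T10 \<theta> \<longleftrightarrow> smooth_one_form A \<theta> \<and>
     (\<forall>p. \<theta> p \<noteq> (\<lambda>v. 0)) \<and> (\<forall>p. {v. \<theta> p v = 0} = Levi_distr T10 p)"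

definition G_form ::
  "('m, 'd::finite) chart set \<Rightarrow> ('m \<Rightarrow> (complex ^ 'd) set) \<Rightarrow> ('m \<Rightarrow> real ^ 'd \<Rightarrow> real) \<Rightarrow>
   'm \<Rightarrow> real ^ 'd \<Rightarrow> real ^ 'd \<Rightarrow> real" where
  "G_form A T10 \<theta> p v w = ext_deriv A \<theta> p v (Levi_J T10 p w)"

definition positive_definite_on ::
  "('m \<Rightarrow> (real ^ 'd) set) \<Rightarrow> ('m \<Rightarrow> real ^ 'd \<Rightarrow> real ^ 'd \<Rightarrow> real) \<Rightarrow> bool" where
  "positive_definite_on H G \<longleftrightarrow> (\<forall>p. \<forall>v\<in>H p. v \<noteq> 0 \<longrightarrow> G p v v > 0)"

definition characteristic_direction ::
  "('m, 'd::finite) chart set \<Rightarrow> ('m \<Rightarrow> real ^ 'd \<Rightarrow> real) \<Rightarrow> ('m \<Rightarrow> real ^ 'd) \<Rightarrow> bool" where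
  "characteristic_direction A \<theta> T \<longleftrightarrow> smooth_vf A UNIV T \<and>
     (\<forall>p. \<theta> p (T p) = 1 \<and> (\<forall>w. ext_deriv A \<theta> p (T p) w = 0))"

text \<open>The projection of a tangent space onto the Levi distribution along \<open>T\<close>, used to extend \<open>J\<close>
  by \<open>J T = 0\<close> and \<open>G\<^sub>\<theta>\<close> to the Webster metric.\<close>

definition Levi_proj ::
  "('m \<Rightarrow> real ^ 'd \<Rightarrow> real) \<Rightarrow> ('m \<Rightarrow> real ^ 'd) \<Rightarrow> 'm \<Rightarrow> real ^ 'd \<Rightarrow> real ^ 'd" where
  "Levi_proj \<theta> T p v = v - \<theta> p v *\<^sub>R T p"

definition J_ext ::
  "('m \<Rightarrow> (complex ^ 'd) set) \<Rightarrow> ('m \<Rightarrow> real ^ 'd \<Rightarrow> real) \<Rightarrow> ('m \<Rightarrow> real ^ 'd) \<Rightarrow>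
   'm \<Rightarrow> real ^ 'd \<Rightarrow> real ^ 'd" where
  "J_ext T10 \<theta> T p v = Levi_J T10 p (Levi_proj \<theta> T p v)"

definition Webster_metric ::
  "('m, 'd::finite) chart set \<Rightarrow> ('m \<Rightarrow> (complex ^ 'd) set) \<Rightarrow> ('m \<Rightarrow> real ^ 'd \<Rightarrow> real) \<Rightarrow>
   ('m \<Rightarrow> real ^ 'd) \<Rightarrow> 'm \<Rightarrow> real ^ 'd \<Rightarrow> real ^ 'd \<Rightarrow> real" where
  "Webster_metric A T10 \<theta> T p v w =
     G_form A T10 \<theta> p (Levi_proj \<theta> T p v) (Levi_proj \<theta> T p w) + \<theta> p v * \<theta> p w"


section \<open>Linear connections and the Tanaka-Webster connection\<close>

text \<open>\<open>D p v Y\<close> is the covariant derivative at \<open>p\<close>, in the direction of the tangent vector \<open>v\<close> at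
  \<open>p\<close>, of a vector field \<open>Y\<close> which is smooth near \<open>p\<close>. Values of \<open>Y\<close> away from \<open>p\<close> do not matter:
  locality follows from the product rule applied to functions locally constant near \<open>p\<close>.\<close>

type_synonym ('m, 'd) connection = "'m \<Rightarrow> real ^ 'd \<Rightarrow> ('m \<Rightarrow> real ^ 'd) \<Rightarrow> real ^ 'd"

definition linear_connection ::
  "('m::topological_space, 'd::finite) chart set \<Rightarrow> ('m, 'd) connection \<Rightarrow> bool" where
  "linear_connection A D \<longleftrightarrow>
     (\<forall>U p Y. open U \<and> p \<in> U \<and> smooth_vf A U Y \<longrightarrow> linear (\<lambda>v. D p v Y)) \<and>
     (\<forall>U p v Y Z. open U \<and> p \<in> U \<and> smooth_vf A U Y \<and> smooth_vf A U Z \<longrightarrow>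
        D p v (\<lambda>q. Y q + Z q) = D p v Y + D p v Z) \<and>
     (\<forall>U p v f Y. open U \<and> p \<in> U \<and> smooth_fun A U f \<and> smooth_vf A U Y \<longrightarrow>
        D p v (\<lambda>q. f q *\<^sub>R Y q) = dir_deriv A p v f *\<^sub>R Y p + f p *\<^sub>R D p v Y) \<and>
     (\<forall>U X Y. open U \<and> smooth_vf A U X \<and> smooth_vf A U Y \<longrightarrow> smooth_vf A U (\<lambda>p. D p (X p) Y))"

definition torsion ::
  "('m, 'd::finite) chart set \<Rightarrow> ('m, 'd) connection \<Rightarrow> 'm \<Rightarrow> real ^ 'd \<Rightarrow> real ^ 'd \<Rightarrow> real ^ 'd" where
  "torsion A D p v w = (let X = extend A p v; Y = extend A p w in
     D p v Y - D p w X - bracket A X Y p)"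

definition ctorsion ::
  "('m, 'd::finite) chart set \<Rightarrow> ('m, 'd) connection \<Rightarrow> 'm \<Rightarrow> complex ^ 'd \<Rightarrow> complex ^ 'd \<Rightarrow> complex ^ 'd" where
  "ctorsion A D p Z W = (\<chi> i. cbilin (\<lambda>v w. torsion A D p v w $ i)
     (Re_vec Z) (Im_vec Z) (Re_vec W) (Im_vec W))"

definition pseudohermitian_torsion ::
  "('m, 'd::finite) chart set \<Rightarrow> ('m \<Rightarrow> real ^ 'd) \<Rightarrow> ('m, 'd) connection \<Rightarrow> 'm \<Rightarrow> real ^ 'd \<Rightarrow> real ^ 'd" where
  "pseudohermitian_torsion A T D p v = torsion A D p (T p) v"

definition Tanaka_Webster ::
  "('m::topological_space, 'd::finite) chart set \<Rightarrow> ('m \<Rightarrow> (complex ^ 'd) set) \<Rightarrow>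
   ('m \<Rightarrow> real ^ 'd \<Rightarrow> real) \<Rightarrow> ('m \<Rightarrow> real ^ 'd) \<Rightarrow> ('m, 'd) connection \<Rightarrow> bool" where
  "Tanaka_Webster A T10 \<theta> T D \<longleftrightarrow>
     (let H = Levi_distr T10; J = J_ext T10 \<theta> T; g = Webster_metric A T10 \<theta> T;
          \<tau> = pseudohermitian_torsion A T D in
     linear_connection A D \<and>
     (\<forall>U p v Y. open U \<and> p \<in> U \<and> smooth_vf A U Y \<and> (\<forall>q\<in>U. Y q \<in> H q) \<longrightarrow> D p v Y \<in> H p) \<and>
     (\<forall>U p v Y Z. open U \<and> p \<in> U \<and> smooth_vf A U Y \<and> smooth_vf A U Z \<longrightarrow>
        dir_deriv A p v (\<lambda>q. g q (Y q) (Z q)) = g p (D p v Y) (Z p) + g p (Y p) (D p v Z)) \<and>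
     (\<forall>U p v Y. open U \<and> p \<in> U \<and> smooth_vf A U Y \<longrightarrow> D p v (\<lambda>q. J q (Y q)) = J p (D p v Y)) \<and>
     (\<forall>p. \<forall>Z\<in>T10 p. \<forall>W\<in>T10 p. ctorsion A D p Z W = 0 \<and>
        ctorsion A D p Z (cnj_vec W) = (2 * cext_deriv A \<theta> p Z (cnj_vec W)) *s of_real_vec (T p)) \<and>
     (\<forall>p v. \<tau> p (J p v) + J p (\<tau> p v) = 0))"


section \<open>Curves and geodesics\<close>

definition Ck_curve ::
  "('m::topological_space, 'd::finite) chart set \<Rightarrow> nat \<Rightarrow> real set \<Rightarrow> (real \<Rightarrow> 'm) \<Rightarrow> bool" where
  "Ck_curve A k I \<gamma> \<longleftrightarrow> open I \<and> is_interval I \<and> I \<noteq> {} \<and> continuous_on I \<gamma> \<and>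
     (\<forall>c\<in>A. Ck_on k {t\<in>I. \<gamma> t \<in> fst c} (snd c \<circ> \<gamma>))"

definition velocity :: "('m, 'd::finite) chart set \<Rightarrow> (real \<Rightarrow> 'm) \<Rightarrow> real \<Rightarrow> real ^ 'd" where
  "velocity A \<gamma> t = vector_derivative (snd (chart_at A (\<gamma> t)) \<circ> \<gamma>) (at t)"

definition lengthy ::
  "('m, 'd::finite) chart set \<Rightarrow> ('m \<Rightarrow> (real ^ 'd) set) \<Rightarrow> real set \<Rightarrow> (real \<Rightarrow> 'm) \<Rightarrow> bool" where
  "lengthy A H I \<gamma> \<longleftrightarrow> (\<forall>t\<in>I. velocity A \<gamma> t \<in> H (\<gamma> t))"

text \<open>\<open>Christoffel A D c p i j k\<close> is the \<open>i\<close>-th component in \<open>c\<close> of the covariant derivative of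
  \<open>\<partial>\<^sub>k\<close> in the direction \<open>\<partial>\<^sub>j\<close> at the point \<open>p\<close>.\<close>

definition Christoffel ::
  "('m, 'd::finite) chart set \<Rightarrow> ('m, 'd) connection \<Rightarrow> ('m, 'd) chart \<Rightarrow> 'm \<Rightarrow> 'd \<Rightarrow> 'd \<Rightarrow> 'd \<Rightarrow> real" where
  "Christoffel A D c p i j k = comps A c p (D p (coord_vf A c j p) (coord_vf A c k)) $ i"

definition geodesic ::
  "('m::topological_space, 'd::finite) chart set \<Rightarrow> ('m, 'd) connection \<Rightarrow> real set \<Rightarrow> (real \<Rightarrow> 'm) \<Rightarrow> bool" where
  "geodesic A D I \<gamma> \<longleftrightarrow> Ck_curve A 2 I \<gamma> \<and>
     (\<forall>c\<in>A. \<forall>t\<in>I. \<gamma> t \<in> fst c \<longrightarrow>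
        (let dx = (\<lambda>s. vector_derivative (snd c \<circ> \<gamma>) (at s)) in
         \<forall>i. vector_derivative dx (at t) $ i
               + (\<Sum>j\<in>UNIV. \<Sum>k\<in>UNIV. Christoffel A D c (\<gamma> t) i j k * dx t $ j * dx t $ k) = 0))"

text \<open>\<open>sharp H G p \<xi>\<close> is the vector \<open>g(p) \<xi>\<close> in \<open>H p\<close> with \<open>G p v (g(p) \<xi>) = \<xi> v\<close> for \<open>v\<close> in \<open>H p\<close>, and
  \<open>cometric A H G c i j\<close> is \<open>g\<^sup>i\<^sup>j\<close> as a function of the coordinates of the chart \<open>c\<close>, that is, the
  \<open>j\<close>-th component of \<open>g dx\<^sup>i\<close>.\<close>

definition sharp ::
  "('m \<Rightarrow> (real ^ 'd) set) \<Rightarrow> ('m \<Rightarrow> real ^ 'd \<Rightarrow> real ^ 'd \<Rightarrow> real) \<Rightarrow>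
   'm \<Rightarrow> (real ^ 'd \<Rightarrow> real) \<Rightarrow> real ^ 'd" where
  "sharp H G p \<xi> = (THE w. w \<in> H p \<and> (\<forall>v\<in>H p. G p v w = \<xi> v))"

definition cometric ::
  "('m, 'd::finite) chart set \<Rightarrow> ('m \<Rightarrow> (real ^ 'd) set) \<Rightarrow> ('m \<Rightarrow> real ^ 'd \<Rightarrow> real ^ 'd \<Rightarrow> real) \<Rightarrow>
   ('m, 'd) chart \<Rightarrow> 'd \<Rightarrow> 'd \<Rightarrow> real ^ 'd \<Rightarrow> real" where
  "cometric A H G c i j x = (let p = inv_into (fst c) (snd c) x in
     comps A c p (sharp H G p (\<lambda>v. comps A c p v $ i)) $ j)"

definition cotangent_lift ::
  "('m, 'd::finite) chart set \<Rightarrow> ('m \<Rightarrow> (real ^ 'd) set) \<Rightarrow> ('m \<Rightarrow> real ^ 'd \<Rightarrow> real ^ 'd \<Rightarrow> real) \<Rightarrow>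
   real set \<Rightarrow> (real \<Rightarrow> 'm) \<Rightarrow> (real \<Rightarrow> real ^ 'd \<Rightarrow> real) \<Rightarrow> bool" where
  "cotangent_lift A H G I \<gamma> \<xi> \<longleftrightarrow>
     (\<forall>t\<in>I. linear (\<xi> t) \<and> sharp H G (\<gamma> t) (\<xi> t) = velocity A \<gamma> t)"

definition sub_Riemannian_geodesic ::
  "('m::topological_space, 'd::finite) chart set \<Rightarrow> ('m \<Rightarrow> (real ^ 'd) set) \<Rightarrow>
   ('m \<Rightarrow> real ^ 'd \<Rightarrow> real ^ 'd \<Rightarrow> real) \<Rightarrow> real set \<Rightarrow> (real \<Rightarrow> 'm) \<Rightarrow> bool" where
  "sub_Riemannian_geodesic A H G I \<gamma> \<longleftrightarrow> Ck_curve A 2 I \<gamma> \<and>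
     (\<exists>\<xi>. cotangent_lift A H G I \<gamma> \<xi> \<and>
       (\<forall>c\<in>A. \<forall>t\<in>I. \<gamma> t \<in> fst c \<longrightarrow>
         (let x = snd c \<circ> \<gamma>; \<xi>c = (\<lambda>i s. \<xi> s (coord_vf A c i (\<gamma> s))); g = cometric A H G c in
          (\<forall>i. ((\<lambda>s. x s $ i) has_real_derivative (\<Sum>j\<in>UNIV. g i j (x t) * \<xi>c j t)) (at t)) \<and>
          (\<forall>k. (\<xi>c k has_real_derivative
                 - 1/2 * (\<Sum>i\<in>UNIV. \<Sum>j\<in>UNIV.
                     frechet_derivative (g i j) (at (x t)) (axis k 1) * \<xi>c i t * \<xi>c j t)) (at t)))))"

end

theory Submission
  imports Defs
begin

text \<open>
  Everything is computed in a chart, with \<open>\<Gamma>(a, b)\<close> the components of the covariant derivative of the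
  constant field \<open>b\<close> along \<open>a\<close>. Because \<open>\<theta>\<close>, \<open>T\<close> and the Webster metric are parallel, so is the
  cometric, and Hamilton's equations for a curve \<open>x\<close> with lift \<open>\<xi>\<close> become
  \<open>x' = sharp \<xi>\<close>, \<open>\<xi>'(a) = \<xi>(\<Gamma>(a, x'))\<close>. Along a lengthy geodesic the covector \<open>g(\<cdot>, x')\<close> satisfies instead
  \<open>\<xi>'(a) = \<xi>(\<Gamma>(x', a))\<close>; the two differ by \<open>g(torsion(x', a), x') = - \<theta>(a) g(\<tau> x', x')\<close>, which vanishes
  if \<open>\<tau> = 0\<close>.

  Conversely, every lift of a lengthy curve has the form \<open>g(\<cdot>, x') + b \<theta>\<close>. For a geodesic, Hamilton's
  equations evaluated on \<open>J x'\<close> force \<open>b g(x', x') = 0\<close>, and evaluated on \<open>T\<close> they give \<open>b' = g(\<tau> x', x')\<close>.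
  Hence \<open>g(\<tau> v, v) = 0\<close> for every initial velocity \<open>v\<close> of a lengthy geodesic, that is, for every
  \<open>v\<close> in the Levi distribution, and \<open>\<tau>\<close> is symmetric because \<open>d\<theta>\<close> is closed and parallel.
\<close>

section \<open>Differentiability classes\<close>

text \<open>No regularity of \<open>J\<close>, \<open>d\<theta>\<close> or the Webster metric is
  assumed: \<open>Levi_J\<close> is a definite description at each point, and
  \<open>ext_deriv\<close> is evaluated in a preferred chart that jumps from point to point.
  Parallelism becomes a formula for ordinary derivatives only once smoothness is known, and this
  shapes the middle of the proof. \<open>J\<close> is smooth because it maps a local real frame,
  made of a complex frame of \<open>T10\<close> and of \<open>T\<close>, to explicit smooth fields;
  \<open>d\<theta>\<close> is half of \<open>\<theta>\<close> applied to the torsion, hence an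
  expression in \<open>\<theta>\<close> and \<open>\<Gamma>\<close>; the metric is assembled from
  these, and the cometric solves a linear system with smooth coefficients.

  Parallelism of \<open>\<theta>\<close>, \<open>T\<close> and \<open>d\<theta>\<close> is not
  assumed either. It is deduced from that of \<open>H\<close>, \<open>J\<close> and the metric.

  In the converse a lift is not known to be differentiable except through Hamilton's equations,
  which is why its multiplier \<open>b\<close> is first written in chart components. Lengthy
  geodesics with a prescribed initial velocity are produced by Picard iteration; they stay lengthy
  because \<open>\<theta>\<close> is parallel.\<close>

lemmas frechet_derivative_worksI = frechet_derivative_works[THEN iffD1]

lemma Ck_on_cong:
  assumes "open S" "\<And>x. x \<in> S \<Longrightarrow> f x = g x" "Ck_on k S f"
  shows "Ck_on k S g"
  using assms
proof (induction k arbitrary: f g)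
  case 0
  then show ?case using continuous_on_cong[of S S f g] by simp
next
  case (Suc k)
  have diff: "g differentiable (at x)" and eq: "frechet_derivative f (at x) = frechet_derivative g (at x)"
    if "x \<in> S" for x
  proof -
    have "(f has_derivative frechet_derivative f (at x)) (at x)"
      using Suc.prems(3) that by (simp add: frechet_derivative_worksI)
    then have "(g has_derivative frechet_derivative f (at x)) (at x)"
      using has_derivative_transform_within_open[OF _ Suc.prems(1) that] Suc.prems(2) by blast
    then show "g differentiable (at x)" "frechet_derivative f (at x) = frechet_derivative g (at x)"
      by (auto simp: differentiable_def dest: frechet_derivative_at)
  qed
  have "Ck_on k S (\<lambda>x. frechet_derivative g (at x) v)" for v
    by (rule Suc.IH[OF Suc.prems(1), of "\<lambda>x. frechet_derivative f (at x) v"])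
      (use Suc.prems(3) eq in simp_all)
  with diff show ?case by simp
qed

lemma Ck_on_subset: "Ck_on k S f \<Longrightarrow> T \<subseteq> S \<Longrightarrow> Ck_on k T f"
  by (induction k arbitrary: f) (auto intro: continuous_on_subset)

lemma Ck_on_locally:
  assumes "\<And>x. x \<in> S \<Longrightarrow> \<exists>U. open U \<and> x \<in> U \<and> Ck_on k U f"
  shows "Ck_on k S f"
  using assms
proof (induction k arbitrary: f)
  case 0
  have "isCont f x" if "x \<in> S" for x
    using 0[OF that] continuous_on_eq_continuous_at by auto
  then show ?case by (simp add: continuous_at_imp_continuous_on)
next
  case (Suc k)
  show ?case
    unfolding Ck_on.simps
  proof (intro conjI ballI allI)
    show "f differentiable at x" if "x \<in> S" for x
    proof -
      obtain U where "x \<in> U" "Ck_on (Suc k) U f" using Suc.prems \<open>x \<in> S\<close> by blast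
      then show ?thesis unfolding Ck_on.simps by blast
    qed
    show "Ck_on k S (\<lambda>x. frechet_derivative f (at x) v)" for v
    proof (rule Suc.IH)
      fix x assume "x \<in> S"
      then obtain U where "open U" "x \<in> U" "Ck_on (Suc k) U f" using Suc.prems by blast
      then show "\<exists>U. open U \<and> x \<in> U \<and> Ck_on k U (\<lambda>x. frechet_derivative f (at x) v)"
        unfolding Ck_on.simps by blast
    qed
  qed
qed

text \<open>Lets inductions supply the derivative by an explicit formula in place of the chosen
  \<open>frechet_derivative\<close>.\<close>

lemma Ck_on_SucI:
  assumes "open S" "\<And>x. x \<in> S \<Longrightarrow> (f has_derivative f' x) (at x)" "\<And>v. Ck_on k S (\<lambda>x. f' x v)"
  shows "Ck_on (Suc k) S f"
proof -
  have "Ck_on k S (\<lambda>x. frechet_derivative f (at x) v)" for v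
    by (rule Ck_on_cong[OF assms(1) _ assms(3)]) (simp add: frechet_derivative_at[OF assms(2), symmetric])
  then show ?thesis using assms(2) by (auto simp: differentiable_def)
qed

lemma Ck_on_has_derivative:
  "Ck_on (Suc k) S f \<Longrightarrow> x \<in> S \<Longrightarrow> (f has_derivative frechet_derivative f (at x)) (at x)"
  by (simp add: frechet_derivative_worksI)

lemma Ck_on_SucD: "Ck_on (Suc k) S f \<Longrightarrow> Ck_on k S f"
proof (induction k arbitrary: f)
  case 0
  then show ?case
    by (auto intro!: continuous_at_imp_continuous_on differentiable_imp_continuous_within)
next
  case (Suc k)
  then show ?case by (metis Ck_on.simps(2))
qed

lemma Ck_on_mono: "Ck_on m S f \<Longrightarrow> k \<le> m \<Longrightarrow> Ck_on k S f"
  by (induction m) (auto simp: le_Suc_eq dest: Ck_on_SucD simp del: Ck_on.simps(2))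

lemma Ck_on_const: "Ck_on k S (\<lambda>x. c)"
  by (induction k arbitrary: c) auto

lemma Ck_on_linear:
  assumes "bounded_linear f" shows "Ck_on k S f"
proof (cases k)
  case 0
  then show ?thesis using assms by (simp add: linear_continuous_on)
next
  case (Suc j)
  have "(\<lambda>x. frechet_derivative f (at x) v) = (\<lambda>x. f v)" for v
    using frechet_derivative_at[OF bounded_linear_imp_has_derivative[OF assms]] by metis
  then show ?thesis
    using Suc assms bounded_linear_imp_has_derivative by (auto simp: Ck_on_const differentiable_def)
qed

lemma Ck_on_add:
  assumes "open S" "Ck_on k S f" "Ck_on k S g" shows "Ck_on k S (\<lambda>x. f x + g x)"
  using assms(2,3)
proof (induction k arbitrary: f g)
  case 0
  then show ?case by (simp add: continuous_on_add)
next
  case (Suc k)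
  show ?case
    by (rule Ck_on_SucI[OF assms(1), of _ "\<lambda>x v. frechet_derivative f (at x) v + frechet_derivative g (at x) v"])
      (use Suc in \<open>auto intro!: has_derivative_add frechet_derivative_worksI\<close>)
qed

text \<open>One induction serves products, scaling and inner products: the product rule yields two
  terms that are again values of \<open>B\<close>, pairing a derivative in a fixed direction with
  one of the original functions, taken one class lower.\<close>

lemma Ck_on_bilinear:
  assumes B: "bounded_bilinear B" and "open S" "Ck_on k S f" "Ck_on k S g"
  shows "Ck_on k S (\<lambda>x. B (f x) (g x))"
  using assms(3,4)
proof (induction k arbitrary: f g)
  case 0
  then show ?case by (simp add: bounded_bilinear.continuous_on[OF B])
next
  case (Suc k)
  have *: "Ck_on k S f" "Ck_on k S g" using Suc.prems Ck_on_SucD by blast+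
  show ?case
  proof (rule Ck_on_SucI[OF assms(2)])
    show "((\<lambda>x. B (f x) (g x)) has_derivative
        (\<lambda>v. B (f x) (frechet_derivative g (at x) v) + B (frechet_derivative f (at x) v) (g x))) (at x)"
      if "x \<in> S" for x
      by (intro bounded_bilinear.FDERIV[OF B] Ck_on_has_derivative[OF Suc.prems(1) that]
          Ck_on_has_derivative[OF Suc.prems(2) that])
    show "Ck_on k S (\<lambda>x. B (f x) (frechet_derivative g (at x) v) + B (frechet_derivative f (at x) v) (g x))" for v
      using Suc.prems * by (intro Ck_on_add[OF assms(2)] Suc.IH) auto
  qed
qed

lemmas Ck_on_scaleR = Ck_on_bilinear[OF bounded_bilinear_scaleR]
lemmas Ck_on_mult = Ck_on_bilinear[OF bounded_bilinear_mult]
lemmas Ck_on_inner = Ck_on_bilinear[OF bounded_bilinear_inner]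

lemma Ck_on_compose_linear:
  assumes L: "bounded_linear L" and "open S" "Ck_on k S f"
  shows "Ck_on k S (\<lambda>x. L (f x))"
  using assms(3)
proof (induction k arbitrary: f)
  case 0
  then show ?case by (simp add: bounded_linear.continuous_on[OF L])
next
  case (Suc k)
  show ?case
    by (rule Ck_on_SucI[OF assms(2), of _ "\<lambda>x v. L (frechet_derivative f (at x) v)"])
      (use Suc in \<open>auto intro!: bounded_linear.has_derivative[OF L] frechet_derivative_worksI\<close>)
qed

lemma Ck_on_minus: "open S \<Longrightarrow> Ck_on k S f \<Longrightarrow> Ck_on k S (\<lambda>x. - f x)"
  using Ck_on_compose_linear[OF bounded_linear_minus[OF bounded_linear_ident]] by auto

lemma Ck_on_diff:
  assumes "open S" "Ck_on k S f" "Ck_on k S g" shows "Ck_on k S (\<lambda>x. f x - g x)"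
  using Ck_on_add[OF assms(1,2) Ck_on_minus[OF assms(1,3)]] by simp

lemma Ck_on_sum:
  assumes "open S" "\<And>i. i \<in> I \<Longrightarrow> Ck_on k S (f i)" shows "Ck_on k S (\<lambda>x. \<Sum>i\<in>I. f i x)"
  using assms(2)
proof (induction I rule: infinite_finite_induct)
  case (insert i I)
  then show ?case by (auto intro!: Ck_on_add assms(1))
qed (auto simp: Ck_on_const)

lemma Ck_on_prod:
  fixes f :: "'i \<Rightarrow> 'a::real_normed_vector \<Rightarrow> real"
  assumes "open S" "\<And>i. i \<in> I \<Longrightarrow> Ck_on k S (f i)" shows "Ck_on k S (\<lambda>x. \<Prod>i\<in>I. f i x)"
  using assms(2)
proof (induction I rule: infinite_finite_induct)
  case (insert i I)
  then show ?case by (auto intro!: Ck_on_mult assms(1))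
qed (auto simp: Ck_on_const)

lemma Ck_on_inverse:
  fixes f :: "'a::real_normed_vector \<Rightarrow> real"
  assumes "open S" "\<And>x. x \<in> S \<Longrightarrow> f x \<noteq> 0" "Ck_on k S f"
  shows "Ck_on k S (\<lambda>x. inverse (f x))"
  using assms(3)
proof (induction k)
  case 0
  then show ?case using assms(2) by (auto intro: continuous_on_inverse)
next
  case (Suc k)
  show ?case
  proof (rule Ck_on_SucI[OF assms(1)])
    show "((\<lambda>x. inverse (f x)) has_derivative
        (\<lambda>v. - (inverse (f x) * frechet_derivative f (at x) v * inverse (f x)))) (at x)" if "x \<in> S" for x
      by (rule Deriv.has_derivative_inverse[OF assms(2)[OF that] Ck_on_has_derivative[OF Suc.prems that]])
    show "Ck_on k S (\<lambda>x. - (inverse (f x) * frechet_derivative f (at x) v * inverse (f x)))" for v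
      using Suc Ck_on_SucD by (intro Ck_on_minus Ck_on_mult assms(1)) auto
  qed
qed

lemma linear_expand_Basis:
  fixes L :: "'a::euclidean_space \<Rightarrow> 'b::real_vector"
  assumes "linear L" shows "L w = (\<Sum>b\<in>Basis. (w \<bullet> b) *\<^sub>R L b)"
  using linear_sum[OF assms, of "\<lambda>b. (w \<bullet> b) *\<^sub>R b" Basis]
  by (simp add: euclidean_representation linear_cmul[OF assms])

text \<open>In the chain rule the direction fed to the derivative of \<open>f\<close> varies with
  the point, whereas \<open>Ck_on\<close> controls derivatives in fixed directions only. Expanding
  it along a basis restores fixed directions; hence the Euclidean codomain of
  \<open>g\<close>.\<close>

lemma Ck_on_compose:
  fixes g :: "'a::real_normed_vector \<Rightarrow> 'b::euclidean_space"
  assumes "open S" "open T" "g ` S \<subseteq> T" "Ck_on k T f" "Ck_on k S g"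
  shows "Ck_on k S (\<lambda>x. f (g x))"
  using assms(4,5)
proof (induction k arbitrary: f)
  case 0
  then show ?case using assms(3) by (simp add: continuous_on_compose2)
next
  case (Suc k)
  have gk: "Ck_on k S g" using Suc.prems Ck_on_SucD by blast
  show ?case
  proof (rule Ck_on_SucI[OF assms(1)])
    show "((\<lambda>x. f (g x)) has_derivative
        (\<lambda>v. \<Sum>b\<in>Basis. (frechet_derivative g (at x) v \<bullet> b) *\<^sub>R frechet_derivative f (at (g x)) b)) (at x)"
      if "x \<in> S" for x
    proof -
      have f': "(f has_derivative frechet_derivative f (at (g x))) (at (g x))"
        using Suc.prems(1) assms(3) that by (auto intro!: frechet_derivative_worksI)
      show ?thesis
        using diff_chain_at[OF Ck_on_has_derivative[OF Suc.prems(2) that] f']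
        unfolding o_def by (rule has_derivative_eq_rhs) (rule ext, rule linear_expand_Basis[OF has_derivative_linear[OF f']])
    qed
    show "Ck_on k S (\<lambda>x. \<Sum>b\<in>Basis. (frechet_derivative g (at x) v \<bullet> b) *\<^sub>R frechet_derivative f (at (g x)) b)" for v
    proof (rule Ck_on_sum[OF assms(1)])
      fix b :: 'b
      have "Ck_on k S (\<lambda>x. frechet_derivative f (at (g x)) b)"
        using Suc.IH[OF _ gk, of "\<lambda>y. frechet_derivative f (at y) b"] Suc.prems(1) by simp
      moreover have "Ck_on k S (\<lambda>x. frechet_derivative g (at x) v \<bullet> b)"
        using Suc.prems(2) by (intro Ck_on_inner assms(1) Ck_on_const) simp
      ultimately show "Ck_on k S (\<lambda>x. (frechet_derivative g (at x) v \<bullet> b) *\<^sub>R frechet_derivative f (at (g x)) b)"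
        by (rule Ck_on_scaleR[OF assms(1), rotated])
    qed
  qed
qed

lemma Ck_on_vec:
  fixes f :: "'a::real_normed_vector \<Rightarrow> real ^ 'd::finite"
  assumes "open S"
  shows "Ck_on k S f \<longleftrightarrow> (\<forall>i. Ck_on k S (\<lambda>x. f x $ i))"
proof
  show "Ck_on k S f \<Longrightarrow> \<forall>i. Ck_on k S (\<lambda>x. f x $ i)"
    using Ck_on_compose_linear[OF bounded_linear_vec_nth assms] by blast
  assume "\<forall>i. Ck_on k S (\<lambda>x. f x $ i)"
  then have "Ck_on k S (\<lambda>x. \<Sum>i\<in>UNIV. (f x $ i) *\<^sub>R axis i 1)"
    by (intro Ck_on_sum Ck_on_scaleR Ck_on_const assms) auto
  then show "Ck_on k S f"
    by (rule Ck_on_cong[OF assms, rotated]) (simp add: basis_expansion flip: scalar_mult_eq_scaleR)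
qed

lemma Ck_on_det:
  fixes M :: "'a::real_normed_vector \<Rightarrow> real ^ 'd ^ 'd::finite"
  assumes "open S" "\<And>i j. Ck_on k S (\<lambda>x. M x $ i $ j)"
  shows "Ck_on k S (\<lambda>x. det (M x))"
  unfolding det_def by (intro Ck_on_sum Ck_on_mult Ck_on_prod Ck_on_const assms)

text \<open>Cramer's rule writes each component of the solution as a quotient of determinants of the
  data, so a solution given point by point is automatically as regular as the system.\<close>

lemma Ck_on_linear_solution:
  fixes M :: "'a::real_normed_vector \<Rightarrow> real ^ 'd ^ 'd::finite"
  assumes S: "open S" and M: "\<And>i j. Ck_on k S (\<lambda>x. M x $ i $ j)" and r: "\<And>i. Ck_on k S (\<lambda>x. r x $ i)"
    and d: "\<And>x. x \<in> S \<Longrightarrow> det (M x) \<noteq> 0" and sol: "\<And>x. x \<in> S \<Longrightarrow> M x *v s x = r x"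
  shows "Ck_on k S s"
proof -
  have "Ck_on k S (\<lambda>x. det (\<chi> i j. if j = l then r x $ i else M x $ i $ j) * inverse (det (M x)))" for l
  proof (intro Ck_on_mult Ck_on_inverse Ck_on_det S M d)
    show "Ck_on k S (\<lambda>x. (\<chi> i j. if j = l then r x $ i else M x $ i $ j) $ i $ j)" for i j
      using r M by (cases "j = l") auto
  qed auto
  moreover have "s x $ l = det (\<chi> i j. if j = l then r x $ i else M x $ i $ j) * inverse (det (M x))"
    if "x \<in> S" for x l
    using cramer[OF d[OF that]] sol[OF that] by (simp add: divide_inverse)
  ultimately show ?thesis
    unfolding Ck_on_vec[OF S] using Ck_on_cong[OF S] by (metis (no_types, lifting))
qed

lemma Ck_on_real_SucI:
  fixes f :: "real \<Rightarrow> 'a::real_normed_vector"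
  assumes "open S" "\<And>x. x \<in> S \<Longrightarrow> (f has_vector_derivative f' x) (at x)" "Ck_on k S f'"
  shows "Ck_on (Suc k) S f"
  by (rule Ck_on_SucI[OF assms(1), of f "\<lambda>x v. v *\<^sub>R f' x"])
    (use assms in \<open>auto simp: has_vector_derivative_def intro!: Ck_on_scaleR Ck_on_const\<close>)

lemma Ck_on_real_SucD:
  fixes f :: "real \<Rightarrow> 'a::real_normed_vector"
  assumes "open S" "Ck_on (Suc k) S f"
  shows "x \<in> S \<Longrightarrow> (f has_vector_derivative vector_derivative f (at x)) (at x)"
    and "Ck_on k S (\<lambda>x. vector_derivative f (at x))"
proof -
  show *: "(f has_vector_derivative vector_derivative f (at x)) (at x)" if "x \<in> S" for x
    using assms(2) that by (auto simp: vector_derivative_works)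
  show "Ck_on k S (\<lambda>x. vector_derivative f (at x))"
  proof (rule Ck_on_cong[OF assms(1)])
    show "Ck_on k S (\<lambda>x. frechet_derivative f (at x) 1)" using assms(2) by simp
    show "frechet_derivative f (at x) 1 = vector_derivative f (at x)" if "x \<in> S" for x
      using frechet_derivative_at[OF *[OF that, unfolded has_vector_derivative_def]] by (metis scaleR_one)
  qed
qed

lemma Ck_on_Pair:
  assumes "open S" "Ck_on k S f" "Ck_on k S g" shows "Ck_on k S (\<lambda>x. (f x, g x))"
proof -
  have "bounded_linear (\<lambda>x. (x, 0))" "bounded_linear (\<lambda>x. (0, x))"
    by (auto intro!: bounded_linear_Pair bounded_linear_ident bounded_linear_zero)
  from this(1)[THEN Ck_on_compose_linear, OF assms(1,2)] this(2)[THEN Ck_on_compose_linear, OF assms(1,3)]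
  show ?thesis using Ck_on_add[OF assms(1)] by fastforce
qed

section \<open>Closure rules for smooth functions\<close>

lemma smooth_on_CkD: "smooth_on S f \<Longrightarrow> Ck_on k S f"
  by (simp add: smooth_on_def)

lemma smooth_on_subset: "smooth_on S f \<Longrightarrow> T \<subseteq> S \<Longrightarrow> smooth_on T f"
  by (auto simp: smooth_on_def intro: Ck_on_subset)

lemma smooth_on_cong: "open S \<Longrightarrow> (\<And>x. x \<in> S \<Longrightarrow> f x = g x) \<Longrightarrow> smooth_on S f \<Longrightarrow> smooth_on S g"
  unfolding smooth_on_def using Ck_on_cong by blast

lemma smooth_on_has_derivative:
  "smooth_on S f \<Longrightarrow> x \<in> S \<Longrightarrow> (f has_derivative frechet_derivative f (at x)) (at x)"
  using Ck_on_has_derivative smooth_on_CkD by blast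

lemma smooth_on_frechet_derivative:
  "smooth_on S f \<Longrightarrow> smooth_on S (\<lambda>x. frechet_derivative f (at x) v)"
  unfolding smooth_on_def by (metis Ck_on.simps(2))

lemma smooth_on_add: "open S \<Longrightarrow> smooth_on S f \<Longrightarrow> smooth_on S g \<Longrightarrow> smooth_on S (\<lambda>x. f x + g x)"
  by (simp add: smooth_on_def Ck_on_add)

lemma smooth_on_diff: "open S \<Longrightarrow> smooth_on S f \<Longrightarrow> smooth_on S g \<Longrightarrow> smooth_on S (\<lambda>x. f x - g x)"
  by (simp add: smooth_on_def Ck_on_diff)

lemma smooth_on_scaleR: "open S \<Longrightarrow> smooth_on S f \<Longrightarrow> smooth_on S g \<Longrightarrow> smooth_on S (\<lambda>x. f x *\<^sub>R g x)"
  by (simp add: smooth_on_def Ck_on_scaleR)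

lemma smooth_on_mult:
  fixes f g :: "'a::real_normed_vector \<Rightarrow> real"
  shows "open S \<Longrightarrow> smooth_on S f \<Longrightarrow> smooth_on S g \<Longrightarrow> smooth_on S (\<lambda>x. f x * g x)"
  by (simp add: smooth_on_def Ck_on_mult)

lemma smooth_on_sum: "open S \<Longrightarrow> (\<And>i. i \<in> I \<Longrightarrow> smooth_on S (f i)) \<Longrightarrow> smooth_on S (\<lambda>x. \<Sum>i\<in>I. f i x)"
  by (simp add: smooth_on_def Ck_on_sum)

lemma smooth_on_const: "smooth_on S (\<lambda>x. c)"
  by (simp add: smooth_on_def Ck_on_const)

lemma smooth_on_inner: "open S \<Longrightarrow> smooth_on S f \<Longrightarrow> smooth_on S g \<Longrightarrow> smooth_on S (\<lambda>x. f x \<bullet> g x)"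
  by (simp add: smooth_on_def Ck_on_inner)

lemma smooth_on_compose:
  fixes g :: "'a::real_normed_vector \<Rightarrow> 'b::euclidean_space"
  shows "open S \<Longrightarrow> open T \<Longrightarrow> g ` S \<subseteq> T \<Longrightarrow> smooth_on T f \<Longrightarrow> smooth_on S g \<Longrightarrow> smooth_on S (\<lambda>x. f (g x))"
  by (simp add: smooth_on_def Ck_on_compose)

lemma smooth_on_vec:
  fixes f :: "'a::real_normed_vector \<Rightarrow> real ^ 'd::finite"
  shows "open S \<Longrightarrow> smooth_on S f \<longleftrightarrow> (\<forall>i. smooth_on S (\<lambda>x. f x $ i))"
  by (auto simp: smooth_on_def Ck_on_vec)

lemma smooth_on_linear_solution:
  fixes M :: "'a::real_normed_vector \<Rightarrow> real ^ 'd ^ 'd::finite"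
  assumes "open S" "\<And>i j. smooth_on S (\<lambda>x. M x $ i $ j)" "\<And>i. smooth_on S (\<lambda>x. r x $ i)"
    "\<And>x. x \<in> S \<Longrightarrow> det (M x) \<noteq> 0" "\<And>x. x \<in> S \<Longrightarrow> M x *v s x = r x"
  shows "smooth_on S s"
  using assms unfolding smooth_on_def by (blast intro: Ck_on_linear_solution[of S _ M r s])

section \<open>Smooth families of linear maps\<close>

lemma basis_expansion_scaleR: "(\<Sum>i\<in>UNIV. (x $ i) *\<^sub>R axis i 1) = (x :: real ^ 'd::finite)"
  by (simp add: basis_expansion flip: scalar_mult_eq_scaleR)

lemma linear_expand_axis:
  fixes L :: "real ^ 'd::finite \<Rightarrow> 'b::real_vector"
  assumes "linear L" shows "L w = (\<Sum>i\<in>UNIV. (w $ i) *\<^sub>R L (axis i 1))"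
proof -
  have "L w = L (\<Sum>i\<in>UNIV. (w $ i) *\<^sub>R axis i 1)" by (simp only: basis_expansion_scaleR)
  then show ?thesis by (simp add: linear_sum[OF assms] linear_cmul[OF assms] del: vector_scaleR_component)
qed

text \<open>Expanding \<open>y\<close> along a basis reduces to values of \<open>L\<close> on fixed
  vectors, the only ones whose derivatives are available for \<open>\<theta>\<close>, the metric and
  Jacobians in a chart.\<close>

lemma has_derivative_apply_linear:
  fixes L :: "'a::real_normed_vector \<Rightarrow> 'b::euclidean_space \<Rightarrow> 'c::real_normed_vector"
    and x :: "'e::real_normed_vector \<Rightarrow> 'a"
  assumes S: "open S" "x t \<in> S" and lin: "\<And>z. z \<in> S \<Longrightarrow> linear (L z)"
    and L': "\<And>b. ((\<lambda>z. L z b) has_derivative L' b) (at (x t))"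
    and x: "(x has_derivative x') (at t)" and y: "(y has_derivative y') (at t)"
  shows "((\<lambda>s. L (x s) (y s)) has_derivative (\<lambda>h. L' (y t) (x' h) + L (x t) (y' h))) (at t)"
proof -
  let ?L = "\<lambda>w z. \<Sum>b\<in>Basis. (w \<bullet> b) *\<^sub>R L z b"
  have "isCont x t" using x has_derivative_continuous by blast
  then obtain U where U: "open U" "t \<in> U" "\<And>s. s \<in> U \<Longrightarrow> x s \<in> S"
    using S unfolding continuous_at_open by (metis (no_types, lifting))
  have eq: "?L w z = L z w" if "z \<in> S" for w z
    using linear_expand_Basis[OF lin[OF that], of w, symmetric] .
  \<comment> \<open>\<open>L'\<close> is given for each \<open>b\<close> separately; its linearity
    in \<open>b\<close> comes from uniqueness of derivatives.\<close>
  have L'w: "(\<Sum>b\<in>Basis. (w \<bullet> b) *\<^sub>R L' b h) = L' w h" for w h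
  proof -
    have "(?L w has_derivative (\<lambda>h. \<Sum>b\<in>Basis. (w \<bullet> b) *\<^sub>R L' b h)) (at (x t))"
      by (intro has_derivative_sum has_derivative_scaleR_right L')
    then have "((\<lambda>z. L z w) has_derivative (\<lambda>h. \<Sum>b\<in>Basis. (w \<bullet> b) *\<^sub>R L' b h)) (at (x t))"
      by (rule has_derivative_transform_within_open[OF _ S eq])
    from has_derivative_unique[OF this L'] show ?thesis by metis
  qed
  have "((\<lambda>s. L (x s) b) has_derivative (\<lambda>h. L' b (x' h))) (at t)" for b
    using diff_chain_at[OF x L'] by (simp add: o_def)
  then have "((\<lambda>s. ?L (y s) (x s)) has_derivative
      (\<lambda>h. \<Sum>b\<in>Basis. (y t \<bullet> b) *\<^sub>R L' b (x' h) + (y' h \<bullet> b) *\<^sub>R L (x t) b)) (at t)"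
    by (intro has_derivative_sum has_derivative_scaleR has_derivative_inner_left y)
  moreover have "(\<lambda>h. \<Sum>b\<in>Basis. (y t \<bullet> b) *\<^sub>R L' b (x' h) + (y' h \<bullet> b) *\<^sub>R L (x t) b) =
      (\<lambda>h. L' (y t) (x' h) + L (x t) (y' h))"
    by (simp add: sum.distrib L'w eq[OF S(2)])
  ultimately have "((\<lambda>s. ?L (y s) (x s)) has_derivative (\<lambda>h. L' (y t) (x' h) + L (x t) (y' h))) (at t)"
    by simp
  then show ?thesis
    by (rule has_derivative_transform_within_open[OF _ U(1,2)]) (rule eq[OF U(3)])
qed

lemma has_vector_derivative_apply_linear:
  fixes L :: "'a::real_normed_vector \<Rightarrow> 'b::euclidean_space \<Rightarrow> 'c::real_normed_vector"
  assumes S: "open S" "x t \<in> S" and lin: "\<And>z. z \<in> S \<Longrightarrow> linear (L z)"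
    and L': "\<And>b. ((\<lambda>z. L z b) has_derivative L' b) (at (x t))"
    and x: "(x has_vector_derivative x') (at t)" and y: "(y has_vector_derivative y') (at t)"
  shows "((\<lambda>s. L (x s) (y s)) has_vector_derivative L' (y t) x' + L (x t) y') (at t)"
  using has_derivative_apply_linear[OF S lin L' x[unfolded has_vector_derivative_def] y[unfolded has_vector_derivative_def]]
  by (simp add: has_vector_derivative_def linear_cmul[OF lin[OF S(2)]] linear_cmul[OF has_derivative_linear[OF L']] scaleR_add_right)

lemma smooth_on_locally:
  assumes "\<And>x. x \<in> S \<Longrightarrow> \<exists>U. open U \<and> x \<in> U \<and> smooth_on U f" shows "smooth_on S f"
  unfolding smooth_on_def
proof (intro allI Ck_on_locally)
  fix k x assume "x \<in> S"
  then obtain U where "open U" "x \<in> U" "smooth_on U f" using assms by blast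
  then show "\<exists>U. open U \<and> x \<in> U \<and> Ck_on k U f" using smooth_on_CkD by blast
qed

lemma smooth_on_apply_linear:
  fixes L :: "'a::real_normed_vector \<Rightarrow> real ^ 'd::finite \<Rightarrow> 'c::real_normed_vector"
  assumes S: "open S" and lin: "\<And>x. x \<in> S \<Longrightarrow> linear (L x)" and L: "\<And>b. smooth_on S (\<lambda>x. L x b)"
    and y: "smooth_on S y"
  shows "smooth_on S (\<lambda>x. L x (y x))"
proof (rule smooth_on_cong[OF S])
  have "smooth_on S (\<lambda>x. y x $ i)" for i using y smooth_on_vec[OF S] by blast
  then show "smooth_on S (\<lambda>x. \<Sum>i\<in>UNIV. (y x $ i) *\<^sub>R L x (axis i 1))"
    by (intro smooth_on_sum[OF S] smooth_on_scaleR[OF S _ L])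
  show "(\<Sum>i\<in>UNIV. (y x $ i) *\<^sub>R L x (axis i 1)) = L x (y x)" if "x \<in> S" for x
    using linear_expand_axis[OF lin[OF that], of "y x"] by simp
qed

text \<open>Injectivity makes the determinant nonzero, so Cramer's rule applies. Used for frame
  coefficients and for the cometric, both of which are defined point by point.\<close>

lemma smooth_on_linear_equation:
  fixes L :: "'a::real_normed_vector \<Rightarrow> real ^ 'd::finite \<Rightarrow> real ^ 'd"
  assumes S: "open S" and lin: "\<And>x. x \<in> S \<Longrightarrow> linear (L x)" and L: "\<And>b. smooth_on S (\<lambda>x. L x b)"
    and inj: "\<And>x. x \<in> S \<Longrightarrow> inj (L x)" and r: "smooth_on S r" and s: "\<And>x. x \<in> S \<Longrightarrow> L x (s x) = r x"
  shows "smooth_on S s"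
proof (rule smooth_on_linear_solution[OF S])
  show "smooth_on S (\<lambda>x. matrix (L x) $ i $ j)" for i j
    using L[of "axis j 1", unfolded smooth_on_vec[OF S]] by (simp add: matrix_def)
  show "smooth_on S (\<lambda>x. r x $ i)" for i using r[unfolded smooth_on_vec[OF S]] by blast
  show "det (matrix (L x)) \<noteq> 0" if "x \<in> S" for x using det_nz_iff_inj[OF lin[OF that]] inj[OF that] by blast
  show "matrix (L x) *v s x = r x" if "x \<in> S" for x using matrix_works[OF lin[OF that, folded linear_matrix_vector_mul_eq]] s[OF that] by simp
qed

section \<open>Symmetry of second derivatives\<close>

text \<open>Two nested mean value theorems: first along \<open>u\<close> for the increment of
  \<open>f\<close> by \<open>s *\<^sub>R v\<close>, then along \<open>v\<close> for the derivative
  of \<open>f\<close> in the direction \<open>u\<close>.\<close>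

lemma second_difference_mvt:
  fixes f :: "'a::real_normed_vector \<Rightarrow> real"
  assumes f: "Ck_on 2 S f" and s: "s > 0"
    and box: "\<And>a b. 0 \<le> a \<Longrightarrow> a \<le> s \<Longrightarrow> 0 \<le> b \<Longrightarrow> b \<le> s \<Longrightarrow> x + a *\<^sub>R u + b *\<^sub>R v \<in> S"
  shows "\<exists>a b. 0 \<le> a \<and> a \<le> s \<and> 0 \<le> b \<and> b \<le> s \<and>
    f (x + s *\<^sub>R u + s *\<^sub>R v) - f (x + s *\<^sub>R u) - f (x + s *\<^sub>R v) + f x =
    s * (s * frechet_derivative (\<lambda>y. frechet_derivative f (at y) u) (at (x + a *\<^sub>R u + b *\<^sub>R v)) v)"
proof -
  let ?D = "\<lambda>g y. frechet_derivative g (at y)"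
  have f1: "(f has_derivative ?D f y) (at y)" 
    and f2: "((\<lambda>y. ?D f y u) has_derivative ?D (\<lambda>y. ?D f y u) y) (at y)" if "y \<in> S" for y
    using f that by (auto simp: numeral_2_eq_2 intro!: frechet_derivative_worksI)
  have line: "((\<lambda>r. g (z + r *\<^sub>R w)) has_real_derivative L w) (at r)"
    if "(g has_derivative L) (at (z + r *\<^sub>R w))" for g :: "'a \<Rightarrow> real" and L z w r
  proof -
    have "((\<lambda>r. z + r *\<^sub>R w) has_derivative (\<lambda>h. h *\<^sub>R w)) (at r)"
      by (auto intro!: derivative_eq_intros)
    from diff_chain_at[OF this that] show ?thesis
      by (simp add: o_def has_field_derivative_def linear_cmul[OF has_derivative_linear[OF that]] mult_commute_abs)
  qed
  define \<phi> where "\<phi> r = f (x + s *\<^sub>R v + r *\<^sub>R u) - f (x + r *\<^sub>R u)" for r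
  have "DERIV \<phi> r :> ?D f (x + s *\<^sub>R v + r *\<^sub>R u) u - ?D f (x + r *\<^sub>R u) u" if "0 \<le> r" "r \<le> s" for r
  proof -
    have S: "x + s *\<^sub>R v + r *\<^sub>R u \<in> S" "x + r *\<^sub>R u \<in> S"
      using box[of r s] box[of r 0] that s by (simp_all add: add_ac)
    show ?thesis
      unfolding \<phi>_def by (intro DERIV_diff line f1 S)
  qed
  from MVT2[OF s this] obtain a where a: "0 < a" "a < s"
    "\<phi> s - \<phi> 0 = s * (?D f (x + s *\<^sub>R v + a *\<^sub>R u) u - ?D f (x + a *\<^sub>R u) u)" by auto
  define \<psi> where "\<psi> r = ?D f (x + a *\<^sub>R u + r *\<^sub>R v) u" for r
  have "DERIV \<psi> r :> ?D (\<lambda>y. ?D f y u) (x + a *\<^sub>R u + r *\<^sub>R v) v" if "0 \<le> r" "r \<le> s" for r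
  proof -
    have S: "x + a *\<^sub>R u + r *\<^sub>R v \<in> S" using box[of a r] that a by simp
    show ?thesis
      unfolding \<psi>_def by (intro line f2 S)
  qed
  from MVT2[OF s this] obtain b where b: "0 < b" "b < s"
    "\<psi> s - \<psi> 0 = s * ?D (\<lambda>y. ?D f y u) (x + a *\<^sub>R u + b *\<^sub>R v) v" by auto
  show ?thesis
    using a b by (intro exI[of _ a] exI[of _ b]) (auto simp: \<phi>_def \<psi>_def algebra_simps)
qed

text \<open>The second difference is symmetric in \<open>u\<close> and \<open>v\<close>, so the two
  mixed derivatives agree at two points near \<open>x\<close>; continuity moves both points to
  \<open>x\<close>.\<close>

lemma frechet_derivative_commute_real:
  fixes f :: "'a::real_normed_vector \<Rightarrow> real"
  assumes f: "Ck_on 2 S f" and S: "open S" "x \<in> S"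
  shows "frechet_derivative (\<lambda>y. frechet_derivative f (at y) u) (at x) v =
         frechet_derivative (\<lambda>y. frechet_derivative f (at y) v) (at x) u"
proof -
  let ?D = "\<lambda>u v x. frechet_derivative (\<lambda>y. frechet_derivative f (at y) u) (at x) v"
  have cont: "isCont (?D u v) x" for u v
    using f S continuous_on_eq_continuous_at by (fastforce simp: numeral_2_eq_2)
  have "\<bar>?D u v x - ?D v u x\<bar> \<le> e" if e: "e > 0" for e
  proof -
    obtain d1 where d1: "d1 > 0" "\<And>y. dist y x < d1 \<Longrightarrow> dist (?D u v y) (?D u v x) < e / 2"
      using cont[of u v] e unfolding continuous_at_eps_delta by (meson half_gt_zero)
    obtain d2 where d2: "d2 > 0" "\<And>y. dist y x < d2 \<Longrightarrow> dist (?D v u y) (?D v u x) < e / 2"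
      using cont[of v u] e unfolding continuous_at_eps_delta by (meson half_gt_zero)
    obtain d3 where d3: "d3 > 0" "\<And>y. dist y x < d3 \<Longrightarrow> y \<in> S"
      using S open_dist by meson
    define d where "d = min d1 (min d2 d3)"
    \<comment> \<open>The factor \<open>2\<close> keeps the parallelogram with sides
      \<open>s *\<^sub>R u\<close> and \<open>s *\<^sub>R v\<close> strictly within distance
      \<open>d\<close>; the \<open>+ 1\<close> guards against \<open>u = v = 0\<close>.\<close>
    define s where "s = d / (2 * (norm u + norm v + 1))"
    have d: "d > 0" using d1 d2 d3 by (simp add: d_def)
    have n: "norm u + norm v + 1 > 0" by (smt (verit) norm_ge_zero)
    have s: "s > 0" using d n by (simp add: s_def)
    have near: "dist (x + a *\<^sub>R u + b *\<^sub>R v) x < d" if "0 \<le> a" "a \<le> s" "0 \<le> b" "b \<le> s" for a b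
    proof -
      have "dist (x + a *\<^sub>R u + b *\<^sub>R v) x = norm (a *\<^sub>R u + b *\<^sub>R v)" by (simp add: dist_norm add.assoc)
      also have "\<dots> \<le> a * norm u + b * norm v" using that norm_triangle_ineq[of "a *\<^sub>R u" "b *\<^sub>R v"] by simp
      also have "\<dots> \<le> s * norm u + s * norm v" using that by (intro add_mono mult_right_mono) auto
      also have "\<dots> \<le> s * (norm u + norm v + 1)" using s by (simp add: algebra_simps)
      also have "\<dots> = d / 2" using n by (simp add: s_def field_simps)
      finally show ?thesis using d by simp
    qed
    have box: "x + a *\<^sub>R u + b *\<^sub>R v \<in> S" if "0 \<le> a" "a \<le> s" "0 \<le> b" "b \<le> s" for a b
      using d3(2) near[OF that] by (simp add: d_def)
    have box': "x + a *\<^sub>R v + b *\<^sub>R u \<in> S" if "0 \<le> a" "a \<le> s" "0 \<le> b" "b \<le> s" for a b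
      using box[OF that(3,4,1,2)] by (simp add: add_ac)
    obtain a b where ab: "0 \<le> a" "a \<le> s" "0 \<le> b" "b \<le> s"
      "f (x + s *\<^sub>R u + s *\<^sub>R v) - f (x + s *\<^sub>R u) - f (x + s *\<^sub>R v) + f x = s * (s * ?D u v (x + a *\<^sub>R u + b *\<^sub>R v))"
      using second_difference_mvt[OF f s, of x u v, OF box] by blast
    obtain a' b' where ab': "0 \<le> a'" "a' \<le> s" "0 \<le> b'" "b' \<le> s"
      "f (x + s *\<^sub>R v + s *\<^sub>R u) - f (x + s *\<^sub>R v) - f (x + s *\<^sub>R u) + f x = s * (s * ?D v u (x + a' *\<^sub>R v + b' *\<^sub>R u))"
      using second_difference_mvt[OF f s, of x v u, OF box'] by blast
    have "s * (s * ?D u v (x + a *\<^sub>R u + b *\<^sub>R v)) = s * (s * ?D v u (x + a' *\<^sub>R v + b' *\<^sub>R u))"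
      using ab(5) ab'(5) by (simp add: algebra_simps)
    then have eq: "?D u v (x + a *\<^sub>R u + b *\<^sub>R v) = ?D v u (x + a' *\<^sub>R v + b' *\<^sub>R u)" using s by simp
    have "dist (?D u v (x + a *\<^sub>R u + b *\<^sub>R v)) (?D u v x) < e / 2"
      using d1(2) near[OF ab(1-4)] by (simp add: d_def)
    moreover have "dist (?D v u (x + a' *\<^sub>R v + b' *\<^sub>R u)) (?D v u x) < e / 2"
      using d2(2) near[OF ab'(3,4,1,2)] by (simp add: d_def add_ac)
    ultimately show ?thesis unfolding eq dist_real_def by linarith
  qed
  from this[of "\<bar>?D u v x - ?D v u x\<bar> / 2"] show ?thesis
    by (cases "?D u v x = ?D v u x") auto
qed

lemma frechet_derivative_commute:
  fixes f :: "'a::real_normed_vector \<Rightarrow> real ^ 'd::finite"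
  assumes f: "Ck_on 2 S f" and S: "open S" "x \<in> S"
  shows "frechet_derivative (\<lambda>y. frechet_derivative f (at y) u) (at x) v =
         frechet_derivative (\<lambda>y. frechet_derivative f (at y) v) (at x) u"
proof -
  have nth: "((\<lambda>x. g x $ i) has_derivative (\<lambda>v. g' v $ i)) (at x)"
    if "(g has_derivative g') (at x)" for g g' i and x :: 'a
    using bounded_linear.has_derivative[OF bounded_linear_vec_nth that] .
  have fi: "Ck_on 2 S (\<lambda>x. f x $ i)" for i using f Ck_on_vec[OF S(1)] by blast
  have D1: "frechet_derivative (\<lambda>x. f x $ i) (at y) u = frechet_derivative f (at y) u $ i" if "y \<in> S" for y u i
    using frechet_derivative_at[OF nth[OF Ck_on_has_derivative[OF f[unfolded numeral_2_eq_2] that]], of i, symmetric]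
    by simp
  have D2: "frechet_derivative (\<lambda>y. frechet_derivative f (at y) u) (at x) v $ i =
     frechet_derivative (\<lambda>y. frechet_derivative (\<lambda>x. f x $ i) (at y) u) (at x) v" for u v i
  proof -
    have 1: "((\<lambda>y. frechet_derivative f (at y) u) has_derivative
        frechet_derivative (\<lambda>y. frechet_derivative f (at y) u) (at x)) (at x)"
      using f S by (auto simp: numeral_2_eq_2 intro!: frechet_derivative_worksI)
    have "((\<lambda>y. frechet_derivative (\<lambda>x. f x $ i) (at y) u) has_derivative
       (\<lambda>v. frechet_derivative (\<lambda>y. frechet_derivative f (at y) u) (at x) v $ i)) (at x)"
      by (rule has_derivative_transform_within_open[OF nth[OF 1] S]) (simp add: D1)
    from frechet_derivative_at[OF this, symmetric] show ?thesis by simp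
  qed
  show ?thesis
    unfolding vec_eq_iff D2 using frechet_derivative_commute_real[OF fi S] by blast
qed

section \<open>Local solutions of autonomous differential equations\<close>

text \<open>\<open>Ck_on\<close> gives continuity of partial derivatives, not of the derivative in
  operator norm. The operator norm is therefore bounded by the sum of their norms, which is bounded
  on the compact ball; convexity then allows the mean value inequality.\<close>

lemma C1_on_lipschitz_cball:
  fixes f :: "'a::euclidean_space \<Rightarrow> 'b::real_normed_vector"
  assumes "Ck_on 1 S f" "cball z r \<subseteq> S"
  obtains K where "K \<ge> 0" "\<And>x y. x \<in> cball z r \<Longrightarrow> y \<in> cball z r \<Longrightarrow> dist (f x) (f y) \<le> K * dist x y"
proof -
  let ?D = "\<lambda>x. frechet_derivative f (at x)"
  have der: "(f has_derivative ?D x) (at x)" if "x \<in> cball z r" for x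
    using assms that by (intro Ck_on_has_derivative[of 0 S]) auto
  have "continuous_on (cball z r) (\<lambda>x. \<Sum>b\<in>Basis. norm (?D x b))"
    using assms by (intro continuous_intros) (auto intro: continuous_on_subset)
  then have "bounded ((\<lambda>x. \<Sum>b\<in>Basis. norm (?D x b)) ` cball z r)"
    using compact_continuous_image compact_cball compact_imp_bounded by blast
  then obtain K where K: "\<And>x. x \<in> cball z r \<Longrightarrow> norm (\<Sum>b\<in>Basis. norm (?D x b)) \<le> K"
    unfolding bounded_iff by (metis imageI)
  have "onorm (?D x) \<le> max K 0" if x: "x \<in> cball z r" for x
  proof (rule onorm_le)
    fix v
    note lin = has_derivative_linear[OF der[OF x]]
    have "?D x v = (\<Sum>b\<in>Basis. (v \<bullet> b) *\<^sub>R ?D x b)" by (rule linear_expand_Basis[OF lin])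
    also have "norm \<dots> \<le> (\<Sum>b\<in>Basis. norm v * norm (?D x b))"
      by (rule order_trans[OF norm_sum]) (auto intro!: sum_mono mult_right_mono simp: Basis_le_norm)
    also have "\<dots> = norm v * (\<Sum>b\<in>Basis. norm (?D x b))" by (simp add: sum_distrib_left)
    also have "\<dots> \<le> norm v * max K 0" using K[OF x] by (intro mult_left_mono) auto
    finally show "norm (?D x v) \<le> max K 0 * norm v" by (simp add: mult.commute)
  qed
  note bound = this
  have "norm (f x - f y) \<le> max K 0 * norm (x - y)" if "x \<in> cball z r" "y \<in> cball z r" for x y
    by (rule differentiable_bound[OF convex_cball has_derivative_at_withinI[OF der] bound that])
  then show ?thesis using that[of "max K 0"] by (auto simp: dist_norm)
qed

text \<open>Picard iteration. Composing with the projection onto a closed ball makes the right-hand side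
  globally Lipschitz; by continuity the fixed point stays in the ball for small times.\<close>

lemma ode_local_solution:
  fixes f :: "'a::euclidean_space \<Rightarrow> 'a"
  assumes S: "open S" "z \<in> S" and f: "Ck_on 1 S f"
  obtains e u where "e > 0" "u 0 = z"
    "\<And>t. t \<in> {-e<..<e} \<Longrightarrow> u t \<in> S \<and> (u has_vector_derivative f (u t)) (at t)"
proof -
  obtain r where r: "r > 0" "cball z r \<subseteq> S" using S open_contains_cball by blast
  obtain K where K: "K \<ge> 0" "\<And>x y. x \<in> cball z r \<Longrightarrow> y \<in> cball z r \<Longrightarrow> dist (f x) (f y) \<le> K * dist x y"
    using C1_on_lipschitz_cball[OF f r(2)] by blast
  define F where "F x = f (closest_point (cball z r) x)" for x
  have cp: "closest_point (cball z r) x \<in> cball z r" for x using r by (intro closest_point_in_set) auto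
  have F_lip: "dist (F x) (F y) \<le> K * dist x y" for x y
  proof -
    have "dist (closest_point (cball z r) x) (closest_point (cball z r) y) \<le> dist x y"
      using r by (intro closest_point_lipschitz) auto
    then show ?thesis unfolding F_def using K(2)[OF cp cp] mult_left_mono[OF _ K(1)] order_trans by blast
  qed
  have F_cont: "continuous_on UNIV F"
  proof -
    have "K-lipschitz_on UNIV F" using F_lip K(1) by (auto intro: lipschitz_onI)
    then show ?thesis by (rule lipschitz_on_continuous_on)
  qed
  \<comment> \<open>\<open>P\<close> moves two curves apart by at most \<open>K * dist u w\<close>
    times the length of an interval of length at most \<open>2 * e\<close> and of one of length
    \<open>e\<close>. This choice gives \<open>3 * K * e \<le> 1/2\<close>, and \<open>K + 1\<close>
    covers \<open>K = 0\<close>.\<close>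
  define e where "e = 1 / (6 * (K + 1))"
  have e: "e > 0" using K(1) by (simp add: e_def)
  \<comment> \<open>The integral from \<open>0\<close> to \<open>s\<close> is a difference of
    integrals from \<open>-e\<close>, since \<open>integral {0..s}\<close> would be \<open>0\<close>
    for negative \<open>s\<close>.\<close>
  define G where "G u s = z + (integral {-e..s} (\<lambda>t. F (u t)) - integral {-e..0} (\<lambda>t. F (u t)))" for u and s :: real
  have Fu: "continuous_on A (\<lambda>t. F (apply_bcontfun u t))" for A and u :: "real \<Rightarrow>\<^sub>C 'a"
    by (rule continuous_on_compose2[OF F_cont]) auto
  have G_cont: "continuous_on {-e..e} (G (apply_bcontfun u))" for u
    unfolding G_def
    by (intro continuous_intros indefinite_integral_continuous_1 integrable_continuous_real Fu)
  \<comment> \<open>Clamping extends a curve on \<open>{-e..e}\<close> to a bounded continuous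
    function on the whole line, so that the iteration acts on a complete metric space.\<close>
  have "\<forall>u. \<exists>g :: real \<Rightarrow>\<^sub>C 'a. \<forall>t. g t = G (apply_bcontfun u) (clamp (-e) e t)"
    using continuous_on_cbox_bcontfunE[of "-e" e] G_cont by (metis cbox_interval)
  then obtain P :: "(real \<Rightarrow>\<^sub>C 'a) \<Rightarrow> (real \<Rightarrow>\<^sub>C 'a)"
    where P: "\<And>u t. P u t = G (apply_bcontfun u) (clamp (-e) e t)" by metis
  have "dist (P u) (P w) \<le> 1/2 * dist u w" for u w
  proof (rule dist_bound)
    fix t
    define s where "s = clamp (-e) e t"
    have s: "-e \<le> s" "s \<le> e" using e clamp_in_interval[of "-e" e t] by (auto simp: s_def)
    have I: "norm (integral {-e..b} (\<lambda>t. F (u t)) - integral {-e..b} (\<lambda>t. F (w t))) \<le> K * dist u w * (b - (-e))"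
      if "-e \<le> b" for b
    proof -
      have "integral {-e..b} (\<lambda>t. F (u t)) - integral {-e..b} (\<lambda>t. F (w t)) = integral {-e..b} (\<lambda>t. F (u t) - F (w t))"
        by (intro integral_diff[symmetric] integrable_continuous_real Fu)
      also have "norm \<dots> \<le> K * dist u w * (b - (-e))"
      proof (rule integral_bound[OF that])
        show "continuous_on {-e..b} (\<lambda>t. F (u t) - F (w t))" by (intro continuous_intros Fu)
        show "norm (F (u t) - F (w t)) \<le> K * dist u w" for t
          using F_lip[of "u t" "w t"] mult_left_mono[OF dist_bounded[of u t w] K(1)] by (simp add: dist_norm)
      qed
      finally show ?thesis .
    qed
    have "dist (P u t) (P w t) \<le>
      norm (integral {-e..s} (\<lambda>t. F (u t)) - integral {-e..s} (\<lambda>t. F (w t)))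
      + norm (integral {-e..0} (\<lambda>t. F (u t)) - integral {-e..0} (\<lambda>t. F (w t)))"
    proof -
      have "norm ((a - b) - (c - d)) \<le> norm (a - c) + norm (b - d)" for a b c d :: 'a
        using norm_triangle_ineq4[of "a - c" "b - d"] by (simp add: algebra_simps)
      then show ?thesis by (simp add: P G_def dist_norm flip: s_def)
    qed
    also have "\<dots> \<le> K * dist u w * (2 * e) + K * dist u w * e"
    proof (rule add_mono)
      have "K * dist u w * (s - - e) \<le> K * dist u w * (2 * e)"
        using s K(1) by (intro mult_left_mono) auto
      then show "norm (integral {-e..s} (\<lambda>t. F (u t)) - integral {-e..s} (\<lambda>t. F (w t))) \<le> K * dist u w * (2 * e)"
        using I[OF s(1)] by linarith
    qed (use I[of 0] e in simp)
    also have "\<dots> = (3 * K * e) * dist u w" by (simp add: algebra_simps)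
    also have "\<dots> \<le> 1/2 * dist u w"
      using K(1) by (intro mult_right_mono) (auto simp: e_def field_simps)
    finally show "dist (P u t) (P w t) \<le> 1/2 * dist u w" .
  qed
  then obtain u where u: "P u = u" using banach_fix_type[of "1/2" P] by auto
  have u_eq: "u t = G (apply_bcontfun u) t" if "t \<in> {-e..e}" for t
    using P[of u t] u that clamp_cancel_cbox[of t "-e" e] by simp
  have u_der: "((apply_bcontfun u) has_vector_derivative F (u t)) (at t)" if t: "t \<in> {-e<..<e}" for t
  proof -
    have "((\<lambda>s. integral {-e..s} (\<lambda>t. F (u t))) has_vector_derivative F (u t)) (at t within {-e..e})"
      using t by (intro integral_has_vector_derivative Fu) auto
    then have "((\<lambda>s. integral {-e..s} (\<lambda>t. F (u t))) has_vector_derivative F (u t)) (at t)"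
      using t by (simp add: at_within_Icc_at)
    then have "(G (apply_bcontfun u) has_vector_derivative F (u t)) (at t)"
      unfolding G_def by (auto intro!: derivative_eq_intros)
    then show ?thesis
      by (rule has_vector_derivative_transform_within_open[of _ _ _ "{-e<..<e}"]) (use t u_eq in auto)
  qed
  have u0: "u 0 = z" using u_eq[of 0] e by (simp add: G_def)
  have "isCont (apply_bcontfun u) 0" using u_der[of 0] e has_vector_derivative_continuous by force
  then obtain d where d: "d > 0" "\<And>t. dist t 0 < d \<Longrightarrow> dist (u t) z < r"
    unfolding continuous_at_eps_delta using r(1) u0 by metis
  have "u t \<in> S \<and> (apply_bcontfun u has_vector_derivative f (u t)) (at t)" if t: "t \<in> {- min d e<..<min d e}" for t
  proof -
    have "u t \<in> cball z r" using d(2)[of t] t by (simp add: dist_commute dist_real_def abs_less_iff less_imp_le min_def split: if_splits)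
    then have "F (u t) = f (u t)" by (simp add: F_def closest_point_self)
    then show ?thesis using u_der[of t] t r(2) \<open>u t \<in> cball z r\<close> by auto
  qed
  then show ?thesis using that[of "min d e" "apply_bcontfun u"] d e u0 by auto
qed

section \<open>Charts and fields on a smooth manifold\<close>

abbreviation pt :: "('m, 'd::finite) chart \<Rightarrow> real ^ 'd \<Rightarrow> 'm" where
  "pt c \<equiv> inv_into (fst c) (snd c)"

locale smooth_manifold =
  fixes A :: "('m::{t2_space, second_countable_topology}, 'd::finite) chart set"
  assumes atlas: "smooth_atlas A"
begin

lemma chart: "c \<in> A \<Longrightarrow> is_chart c"
  using atlas by (simp add: smooth_atlas_def)

lemma open_dom: "c \<in> A \<Longrightarrow> open (fst c)"
  using chart by (auto simp: is_chart_def)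

lemma open_range: "c \<in> A \<Longrightarrow> open (snd c ` fst c)"
  using chart by (auto simp: is_chart_def)

lemma pt_snd [simp]: "c \<in> A \<Longrightarrow> p \<in> fst c \<Longrightarrow> pt c (snd c p) = p"
  using chart by (auto simp: is_chart_def homeomorphism_def)

lemma pt_in: "x \<in> snd c ` fst c \<Longrightarrow> pt c x \<in> fst c"
  by (simp add: inv_into_into)

lemma snd_pt: "x \<in> snd c ` fst c \<Longrightarrow> snd c (pt c x) = x"
  by (simp add: f_inv_into_f)

lemma continuous_pt: "c \<in> A \<Longrightarrow> continuous_on (snd c ` fst c) (pt c)"
  using chart by (auto simp: is_chart_def homeomorphism_def)

lemma open_image: "c \<in> A \<Longrightarrow> open U \<Longrightarrow> open (snd c ` (U \<inter> fst c))"
proof -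
  assume c: "c \<in> A" and U: "open U"
  have "openin (top_of_set (snd c ` fst c)) (snd c ` (U \<inter> fst c))"
    using chart[OF c] U
    by (intro homeomorphism_imp_open_map[of "fst c" _ "snd c" "pt c"]) (auto simp: is_chart_def openin_open)
  then show ?thesis using open_range[OF c] openin_open_trans by blast
qed

lemma open_image': "c \<in> A \<Longrightarrow> open U \<Longrightarrow> U \<subseteq> fst c \<Longrightarrow> open (snd c ` U)"
  using open_image[of c U] by (simp add: Int_absorb2)

lemma open_overlap: "c \<in> A \<Longrightarrow> c' \<in> A \<Longrightarrow> open (snd c ` (fst c \<inter> fst c'))"
  using open_image[of c "fst c'"] open_dom[of c'] by (simp add: Int_commute)

lemma transition_snd [simp]: "c \<in> A \<Longrightarrow> p \<in> fst c \<Longrightarrow> transition c c' (snd c p) = snd c' p"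
  by (simp add: transition_def)

lemma transition_smooth: "c \<in> A \<Longrightarrow> c' \<in> A \<Longrightarrow> smooth_on (snd c ` (fst c \<inter> fst c')) (transition c c')"
  using atlas by (simp add: smooth_atlas_def)

lemma change_has_derivative:
  assumes "c \<in> A" "c' \<in> A" "p \<in> fst c" "p \<in> fst c'"
  shows "(transition c c' has_derivative change c c' p) (at (snd c p))"
  unfolding change_def using smooth_on_has_derivative[OF transition_smooth[OF assms(1,2)]] assms(3,4) by blast

lemma linear_change: "c \<in> A \<Longrightarrow> c' \<in> A \<Longrightarrow> p \<in> fst c \<Longrightarrow> p \<in> fst c' \<Longrightarrow> linear (change c c' p)"
  using change_has_derivative has_derivative_linear by blast

text \<open>The cocycle rule, from the chain rule for transition maps. All conversions between
  components rest on it.\<close>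

lemma change_change:
  assumes "c \<in> A" "c' \<in> A" "c'' \<in> A" "p \<in> fst c" "p \<in> fst c'" "p \<in> fst c''"
  shows "change c' c'' p (change c c' p v) = change c c'' p v"
proof -
  let ?S = "snd c ` ((fst c' \<inter> fst c'') \<inter> fst c)"
  have S: "open ?S" using assms by (intro open_image open_Int open_dom)
  have "(transition c' c'' \<circ> transition c c' has_derivative change c' c'' p \<circ> change c c' p) (at (snd c p))"
    using assms change_has_derivative[of c' c'' p] by (intro diff_chain_at change_has_derivative) auto
  then have "(transition c c'' has_derivative change c' c'' p \<circ> change c c' p) (at (snd c p))"
    by (rule has_derivative_transform_within_open[OF _ S]) (use assms in auto)
  from has_derivative_unique[OF this change_has_derivative[OF assms(1,3,4,6)]]
  show ?thesis by (metis comp_apply)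
qed

lemma change_id [simp]: "c \<in> A \<Longrightarrow> p \<in> fst c \<Longrightarrow> change c c p v = v"
proof -
  assume c: "c \<in> A" "p \<in> fst c"
  have "(transition c c has_derivative (\<lambda>v. v)) (at (snd c p))"
    by (rule has_derivative_transform_within_open[where s="snd c ` fst c", OF has_derivative_ident])
      (use c open_range in auto)
  from has_derivative_unique[OF this change_has_derivative[OF c(1,1,2,2)]] show ?thesis by metis
qed

lemma chart_at: "chart_at A p \<in> A" "p \<in> fst (chart_at A p)"
proof -
  have "\<exists>c. c \<in> A \<and> p \<in> fst c" using atlas unfolding smooth_atlas_def by blast
  from someI_ex[OF this] show "chart_at A p \<in> A" "p \<in> fst (chart_at A p)" by (auto simp: chart_at_def)
qed

lemma comps_const_vf [simp]: "c \<in> A \<Longrightarrow> p \<in> fst c \<Longrightarrow> comps A c p (const_vf A c a p) = a"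
  using change_change[of c "chart_at A p" c p] chart_at by (simp add: comps_def const_vf_def)

lemma const_vf_comps [simp]: "c \<in> A \<Longrightarrow> p \<in> fst c \<Longrightarrow> const_vf A c (comps A c p v) p = v"
  using change_change[of "chart_at A p" c "chart_at A p" p] chart_at by (simp add: comps_def const_vf_def)

lemma change_comps: "c \<in> A \<Longrightarrow> c' \<in> A \<Longrightarrow> p \<in> fst c \<Longrightarrow> p \<in> fst c' \<Longrightarrow> change c c' p (comps A c p v) = comps A c' p v"
  using change_change[of "chart_at A p" c c' p] chart_at by (simp add: comps_def)

lemma linear_comps: "c \<in> A \<Longrightarrow> p \<in> fst c \<Longrightarrow> linear (comps A c p)"
  using linear_change chart_at by (simp add: comps_def[abs_def])

lemma linear_const_vf: "c \<in> A \<Longrightarrow> p \<in> fst c \<Longrightarrow> linear (\<lambda>a. const_vf A c a p)"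
  using linear_change chart_at by (simp add: const_vf_def)

lemma comps_chart_at [simp]: "comps A (chart_at A p) p v = v"
  using chart_at by (simp add: comps_def)

lemma const_vf_chart_at [simp]: "const_vf A (chart_at A p) v p = v"
  using chart_at by (simp add: const_vf_def)

lemma vf_rep_snd [simp]: "c \<in> A \<Longrightarrow> p \<in> fst c \<Longrightarrow> vf_rep A c X (snd c p) = comps A c p (X p)"
  by (simp add: vf_rep_def)

lemma smooth_vfD: "smooth_vf A U X \<Longrightarrow> c \<in> A \<Longrightarrow> U \<subseteq> fst c \<Longrightarrow> smooth_on (snd c ` U) (vf_rep A c X)"
  by (metis Int_absorb2 smooth_vf_def)

lemma smooth_vf_subset: "smooth_vf A U X \<Longrightarrow> V \<subseteq> U \<Longrightarrow> smooth_vf A V X"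
  unfolding smooth_vf_def by (meson Int_mono image_mono order_refl smooth_on_subset)

lemma smooth_vf_cong:
  assumes "open U" "\<And>p. p \<in> U \<Longrightarrow> X p = Y p" "smooth_vf A U X" shows "smooth_vf A U Y"
  unfolding smooth_vf_def
proof
  fix c assume c: "c \<in> A"
  show "smooth_on (snd c ` (U \<inter> fst c)) (vf_rep A c Y)"
    by (rule smooth_on_cong[OF open_image[OF c assms(1)], of "vf_rep A c X"])
      (use assms(2,3) c in \<open>auto simp: smooth_vf_def\<close>)
qed

text \<open>Components in another chart arise from the smooth Jacobian of the transition map, so one
  chart suffices to test smoothness although the definition quantifies over the atlas.\<close>

lemma smooth_vfI:
  assumes c: "c \<in> A" and U: "open U" "U \<subseteq> fst c" and X: "smooth_on (snd c ` U) (vf_rep A c X)"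
  shows "smooth_vf A U X"
  unfolding smooth_vf_def
proof
  fix c' assume c': "c' \<in> A"
  let ?S = "snd c' ` (U \<inter> fst c')" and ?\<psi> = "transition c' c"
  let ?r = "\<lambda>y. \<Sum>b\<in>Basis. (vf_rep A c X y \<bullet> b) *\<^sub>R frechet_derivative (transition c c') (at y) b"
  have S: "open ?S" and T: "open (snd c ` (U \<inter> fst c'))"
    using open_image[OF c' U(1)] open_image[OF c, of "U \<inter> fst c'"] open_dom[OF c'] U
    by (simp_all add: open_Int Int_absorb2 inf.coboundedI1)
  have r: "smooth_on (snd c ` (U \<inter> fst c')) ?r"
  proof (rule smooth_on_sum[OF T])
    fix b :: "real ^ 'd"
    have "smooth_on (snd c ` (U \<inter> fst c')) (vf_rep A c X)"
      by (rule smooth_on_subset[OF X]) auto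
    moreover have "smooth_on (snd c ` (U \<inter> fst c')) (transition c c')"
      by (rule smooth_on_subset[OF transition_smooth[OF c c']]) (use U in auto)
    ultimately show "smooth_on (snd c ` (U \<inter> fst c'))
        (\<lambda>y. (vf_rep A c X y \<bullet> b) *\<^sub>R frechet_derivative (transition c c') (at y) b)"
      by (rule smooth_on_scaleR[OF T smooth_on_inner[OF T _ smooth_on_const] smooth_on_frechet_derivative])
  qed
  have \<psi>: "smooth_on ?S ?\<psi>"
    by (rule smooth_on_subset[OF transition_smooth[OF c' c]]) (use U in auto)
  have "?\<psi> ` ?S \<subseteq> snd c ` (U \<inter> fst c')" using c' by auto
  from smooth_on_compose[OF S T this r \<psi>] have "smooth_on ?S (\<lambda>x. ?r (?\<psi> x))" .
  then show "smooth_on ?S (vf_rep A c' X)"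
  proof (rule smooth_on_cong[OF S, rotated])
    fix x assume "x \<in> ?S"
    then obtain p where p: "p \<in> U" "p \<in> fst c'" "x = snd c' p" by auto
    have pc: "p \<in> fst c" using U p by auto
    have "?r (?\<psi> x) = change c c' p (vf_rep A c X (?\<psi> x))"
      using linear_expand_Basis[OF linear_change[OF c c' pc p(2)], of "vf_rep A c X (?\<psi> x)", symmetric] c' p
      by (simp add: change_def)
    then show "?r (?\<psi> x) = vf_rep A c' X x" using c c' p pc by (simp add: change_comps)
  qed
qed

lemma smooth_funI:
  assumes c: "c \<in> A" and U: "open U" "U \<subseteq> fst c" and f: "smooth_on (snd c ` U) (f \<circ> pt c)"
  shows "smooth_fun A U f"
  unfolding smooth_fun_def
proof
  fix c' assume c': "c' \<in> A"
  let ?S = "snd c' ` (U \<inter> fst c')" and ?\<psi> = "transition c' c"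
  have S: "open ?S" using open_image[OF c' U(1)] .
  have "smooth_on ?S (\<lambda>x. (f \<circ> pt c) (?\<psi> x))"
  proof (rule smooth_on_compose[OF S open_image'[OF c U] _ f])
    show "smooth_on ?S ?\<psi>" by (rule smooth_on_subset[OF transition_smooth[OF c' c]]) (use U in auto)
  qed (use c' in auto)
  then show "smooth_on ?S (f \<circ> pt c')"
  proof (rule smooth_on_cong[OF S, rotated])
    fix x assume "x \<in> ?S"
    then obtain p where "p \<in> U" "p \<in> fst c'" "x = snd c' p" by auto
    then show "(f \<circ> pt c) (?\<psi> x) = (f \<circ> pt c') x" using U c c' by auto
  qed
qed

lemma smooth_vf_const_vf: "c \<in> A \<Longrightarrow> smooth_vf A (fst c) (const_vf A c a)"
  by (rule smooth_vfI[of c]) (auto simp: open_dom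
      intro!: smooth_on_cong[OF open_range _ smooth_on_const[of _ a]])

lemma smooth_vf_add:
  assumes "open U" "smooth_vf A U X" "smooth_vf A U Y" shows "smooth_vf A U (\<lambda>p. X p + Y p)"
  unfolding smooth_vf_def
proof
  fix c assume c: "c \<in> A"
  show "smooth_on (snd c ` (U \<inter> fst c)) (vf_rep A c (\<lambda>p. X p + Y p))"
    by (rule smooth_on_cong[OF open_image[OF c assms(1)], of "\<lambda>x. vf_rep A c X x + vf_rep A c Y x"])
      (use assms c in \<open>auto simp: smooth_vf_def linear_add[OF linear_comps] intro!: smooth_on_add open_image\<close>)
qed

lemma smooth_vf_scale:
  assumes "open U" "smooth_fun A U f" "smooth_vf A U X" shows "smooth_vf A U (\<lambda>p. f p *\<^sub>R X p)"
  unfolding smooth_vf_def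
proof
  fix c assume c: "c \<in> A"
  show "smooth_on (snd c ` (U \<inter> fst c)) (vf_rep A c (\<lambda>p. f p *\<^sub>R X p))"
    by (rule smooth_on_cong[OF open_image[OF c assms(1)], of "\<lambda>x. (f \<circ> pt c) x *\<^sub>R vf_rep A c X x"])
      (use assms c in \<open>auto simp: smooth_vf_def smooth_fun_def linear_cmul[OF linear_comps] o_def intro!: smooth_on_scaleR open_image\<close>)
qed

lemma smooth_fun_const: "smooth_fun A U (\<lambda>p. k)"
  by (simp add: smooth_fun_def o_def smooth_on_const)

lemma smooth_vf_sum:
  assumes "open U" "\<And>i. i \<in> I \<Longrightarrow> smooth_vf A U (X i)" shows "smooth_vf A U (\<lambda>p. \<Sum>i\<in>I. X i p)"
  unfolding smooth_vf_def
proof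
  fix c assume c: "c \<in> A"
  show "smooth_on (snd c ` (U \<inter> fst c)) (vf_rep A c (\<lambda>p. \<Sum>i\<in>I. X i p))"
    by (rule smooth_on_cong[OF open_image[OF c assms(1)], of "\<lambda>x. \<Sum>i\<in>I. vf_rep A c (X i) x"])
      (use assms c in \<open>auto simp: smooth_vf_def linear_sum[OF linear_comps] intro!: smooth_on_sum open_image\<close>)
qed

section \<open>Directional derivatives and curves in arbitrary charts\<close>

text \<open>The chain rule through the transition map frees \<open>dir_deriv\<close> from the
  preferred chart of \<open>p\<close> in which it is defined.\<close>

lemma dir_deriv_chart:
  assumes c: "c \<in> A" "p \<in> fst c" and f: "(f \<circ> pt c has_derivative F) (at (snd c p))"
  shows "dir_deriv A p v f = F (comps A c p v)"
proof -
  let ?c = "chart_at A p"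
  have "((f \<circ> pt c) \<circ> transition ?c c has_derivative F \<circ> change ?c c p) (at (snd ?c p))"
    using f c chart_at by (intro diff_chain_at change_has_derivative) auto
  then have "(f \<circ> pt ?c has_derivative F \<circ> change ?c c p) (at (snd ?c p))"
    by (rule has_derivative_transform_within_open[where s="snd ?c ` (fst ?c \<inter> fst c)"])
      (use c chart_at open_overlap in auto)
  from frechet_derivative_at[OF this, symmetric] show ?thesis
    by (simp add: dir_deriv_def Let_def comps_def)
qed

lemma open_curve_preimage:
  assumes "Ck_curve A k I \<gamma>" "c \<in> A" shows "open {t \<in> I. \<gamma> t \<in> fst c}"
proof -
  have "open (I \<inter> \<gamma> -` fst c)"
    using assms open_dom by (intro continuous_open_preimage) (auto simp: Ck_curve_def)
  moreover have "I \<inter> \<gamma> -` fst c = {t \<in> I. \<gamma> t \<in> fst c}" by auto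
  ultimately show ?thesis by simp
qed

text \<open>\<open>velocity\<close> uses the chart preferred at \<open>\<gamma> t\<close>, which may
  change with \<open>t\<close>; to differentiate it again, it has to be read in a fixed
  chart.\<close>

lemma curve_has_vector_derivative:
  assumes \<gamma>: "Ck_curve A (Suc k) I \<gamma>" and c: "c \<in> A" and t: "t \<in> I" "\<gamma> t \<in> fst c"
  shows "(snd c \<circ> \<gamma> has_vector_derivative comps A c (\<gamma> t) (velocity A \<gamma> t)) (at t)"
proof -
  let ?c = "chart_at A (\<gamma> t)"
  have Ck: "Ck_on (Suc k) {t \<in> I. \<gamma> t \<in> fst ?c} (snd ?c \<circ> \<gamma>)"
    using \<gamma> chart_at(1) by (simp add: Ck_curve_def del: Ck_on.simps)
  have "(snd ?c \<circ> \<gamma> has_vector_derivative velocity A \<gamma> t) (at t)"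
    unfolding velocity_def
    using Ck_on_real_SucD(1)[OF open_curve_preimage[OF \<gamma> chart_at(1)] Ck] t chart_at(2) by auto
  then have "(transition ?c c \<circ> (snd ?c \<circ> \<gamma>) has_vector_derivative change ?c c (\<gamma> t) (velocity A \<gamma> t)) (at t)"
    using vector_derivative_diff_chain_within[of _ _ _ UNIV, OF _ has_derivative_at_withinI]
      change_has_derivative[OF chart_at(1) c chart_at(2) t(2)] by (metis comp_apply)
  then show ?thesis unfolding comps_def
    by (rule has_vector_derivative_transform_within_open[where S="{s \<in> I. \<gamma> s \<in> fst ?c} \<inter> {s \<in> I. \<gamma> s \<in> fst c}"])
      (use open_Int[OF open_curve_preimage[OF \<gamma> chart_at(1)] open_curve_preimage[OF \<gamma> c]] t chart_at in auto)
qed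

lemma Ck_curve_pt:
  assumes c: "c \<in> A" and I: "open I" "is_interval I" "I \<noteq> {}"
    and x: "Ck_on k I x" "x ` I \<subseteq> snd c ` fst c"
  shows "Ck_curve A k I (pt c \<circ> x)"
  unfolding Ck_curve_def
proof (intro conjI ballI I)
  have cx: "continuous_on I x" using Ck_on_mono[OF x(1), of 0] by simp
  then show cont: "continuous_on I (pt c \<circ> x)"
    using continuous_on_compose continuous_on_subset[OF continuous_pt[OF c] x(2)] by blast
  fix c' assume c': "c' \<in> A"
  let ?I = "{t \<in> I. (pt c \<circ> x) t \<in> fst c'}"
  have "?I = I \<inter> (pt c \<circ> x) -` fst c'" by auto
  then have open_I: "open ?I" using continuous_open_preimage[OF cont I(1) open_dom[OF c']] by simp
  have "Ck_on k ?I (\<lambda>t. transition c c' (x t))"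
  proof (rule Ck_on_compose[OF open_I open_overlap[OF c c'] _ smooth_on_CkD[OF transition_smooth[OF c c']]])
    show "x ` ?I \<subseteq> snd c ` (fst c \<inter> fst c')"
    proof
      fix y assume "y \<in> x ` ?I"
      then obtain t where t: "t \<in> I" "pt c (x t) \<in> fst c'" "y = x t" by auto
      then have "x t \<in> snd c ` fst c" using x(2) by auto
      from snd_pt[OF this] pt_in[OF this] show "y \<in> snd c ` (fst c \<inter> fst c')"
        using t by (intro image_eqI[of _ _ "pt c (x t)"]) simp_all
    qed
    show "Ck_on k ?I x" by (rule Ck_on_subset[OF x(1)]) auto
  qed
  then show "Ck_on k ?I (snd c' \<circ> (pt c \<circ> x))"
    by (rule Ck_on_cong[OF open_I, rotated]) (simp add: transition_def)
qed

end

section \<open>Linear connections in charts\<close>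

text \<open>The Christoffel symbols as a bilinear map: \<open>a\<close> is the direction of
  differentiation, \<open>b\<close> the constant field that is differentiated. Vector arguments keep
  index sums confined to \<open>Christoffel_sum\<close>.\<close>

definition Gamma_rep :: "('m, 'd::finite) chart set \<Rightarrow> ('m, 'd) connection \<Rightarrow> ('m, 'd) chart \<Rightarrow>
   real ^ 'd \<Rightarrow> real ^ 'd \<Rightarrow> real ^ 'd \<Rightarrow> real ^ 'd" where
  "Gamma_rep A D c x a b = comps A c (pt c x) (D (pt c x) (const_vf A c a (pt c x)) (const_vf A c b))"

locale manifold_connection = smooth_manifold A
  for A :: "('m::{t2_space, second_countable_topology}, 'd::finite) chart set" +
  fixes D :: "('m, 'd) connection"
  assumes connection: "linear_connection A D"
begin

lemma D_linear:
  assumes "open U" "p \<in> U" "smooth_vf A U Y" shows "linear (\<lambda>v. D p v Y)"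
  using connection[unfolded linear_connection_def, THEN conjunct1, rule_format, of U p Y] assms by simp

lemma D_add:
  assumes "open U" "p \<in> U" "smooth_vf A U Y" "smooth_vf A U Z"
  shows "D p v (\<lambda>q. Y q + Z q) = D p v Y + D p v Z"
  using connection[unfolded linear_connection_def, THEN conjunct2, THEN conjunct1, rule_format, of U p Y Z v] assms by simp

lemma D_scale:
  assumes "open U" "p \<in> U" "smooth_fun A U f" "smooth_vf A U Y"
  shows "D p v (\<lambda>q. f q *\<^sub>R Y q) = dir_deriv A p v f *\<^sub>R Y p + f p *\<^sub>R D p v Y"
  using connection[unfolded linear_connection_def, THEN conjunct2, THEN conjunct2, THEN conjunct1, rule_format, of U p f Y v] assms by simp

lemma D_smooth:
  assumes "open U" "smooth_vf A U X" "smooth_vf A U Y" shows "smooth_vf A U (\<lambda>p. D p (X p) Y)"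
  using connection[unfolded linear_connection_def, THEN conjunct2, THEN conjunct2, THEN conjunct2, rule_format, of U X Y] assms by simp

lemma dir_deriv_locally_const:
  assumes "open U" "p \<in> U" "\<And>q. q \<in> U \<Longrightarrow> f q = k" shows "dir_deriv A p v f = 0"
proof -
  let ?c = "chart_at A p"
  have "(f \<circ> pt ?c has_derivative (\<lambda>_. 0)) (at (snd ?c p))"
    by (rule has_derivative_transform_within_open[OF has_derivative_const open_image[OF chart_at(1) assms(1)]])
      (use assms chart_at in auto)
  from dir_deriv_chart[OF chart_at this] show ?thesis .
qed

lemma D_zero: "D p v (\<lambda>q. 0) = 0"
proof -
  have "smooth_vf A UNIV (\<lambda>q. 0 *\<^sub>R const_vf A (chart_at A p) 0 q :: real ^ 'd)"
    unfolding smooth_vf_def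
  proof
    fix c assume c: "c \<in> A"
    show "smooth_on (snd c ` (UNIV \<inter> fst c)) (vf_rep A c (\<lambda>q. 0 *\<^sub>R const_vf A (chart_at A p) 0 q))"
      by (rule smooth_on_cong[OF open_image[OF c open_UNIV] _ smooth_on_const[of _ 0]])
        (use c in \<open>auto simp: linear_0[OF linear_comps]\<close>)
  qed
  then have "D p v (\<lambda>q. 0 + 0) = D p v (\<lambda>q. 0) + D p v (\<lambda>q. 0)" by (intro D_add[of UNIV]) simp_all
  then show ?thesis by simp
qed

lemma D_const_scale:
  assumes "open U" "p \<in> U" "smooth_vf A U Y" shows "D p v (\<lambda>q. k *\<^sub>R Y q) = k *\<^sub>R D p v Y"
  using D_scale[OF assms(1,2) smooth_fun_const assms(3), of v k] dir_deriv_locally_const[OF assms(1,2), of "\<lambda>q. k" k]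
  by simp

lemma D_sum:
  assumes "open U" "p \<in> U" "\<And>i. i \<in> I \<Longrightarrow> smooth_vf A U (X i)"
  shows "D p v (\<lambda>q. \<Sum>i\<in>I. X i q) = (\<Sum>i\<in>I. D p v (X i))"
  using assms(3)
proof (induction I rule: infinite_finite_induct)
  case (insert i I)
  have "D p v (\<lambda>q. X i q + (\<Sum>i\<in>I. X i q)) = D p v (X i) + D p v (\<lambda>q. \<Sum>i\<in>I. X i q)"
    using insert.prems by (intro D_add[OF assms(1,2)] smooth_vf_sum assms(1)) auto
  with insert show ?case by simp
qed (auto simp: D_zero)

text \<open>The indicator function of a neighbourhood is smooth on that neighbourhood and locally constant
  at the point, so the product rule for it yields locality.\<close>

lemma D_local:
  assumes W: "open W" "p \<in> W" and Y: "smooth_vf A W Y" and eq: "\<And>q. q \<in> W \<Longrightarrow> Y q = Z q"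
  shows "D p v Y = D p v Z"
proof -
  define f where "f q = (if q \<in> W then 1 else 0 :: real)" for q
  have f: "smooth_fun A W f"
    unfolding smooth_fun_def
  proof
    fix c assume c: "c \<in> A"
    show "smooth_on (snd c ` (W \<inter> fst c)) (f \<circ> pt c)"
      by (rule smooth_on_cong[OF open_image[OF c W(1)] _ smooth_on_const[of _ 1]])
        (use c in \<open>auto simp: f_def\<close>)
  qed
  have "dir_deriv A p v f = 0" by (rule dir_deriv_locally_const[OF W, of _ 1]) (simp add: f_def)
  then have *: "D p v (\<lambda>q. f q *\<^sub>R X q) = D p v X" if "smooth_vf A W X" for X
    using D_scale[OF W f that] W by (simp add: f_def)
  have "(\<lambda>q. f q *\<^sub>R Y q) = (\<lambda>q. f q *\<^sub>R Z q)" using eq by (auto simp: f_def)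
  then show ?thesis using *[OF Y] *[OF smooth_vf_cong[OF W(1) eq Y]] by simp
qed

abbreviation "\<Gamma> \<equiv> Gamma_rep A D"

lemma Gamma_snd: "c \<in> A \<Longrightarrow> p \<in> fst c \<Longrightarrow> \<Gamma> c (snd c p) a b = comps A c p (D p (const_vf A c a p) (const_vf A c b))"
  by (simp add: Gamma_rep_def)

lemma linear_Gamma1:
  assumes c: "c \<in> A" and x: "x \<in> snd c ` fst c" shows "linear (\<lambda>a. \<Gamma> c x a b)"
proof -
  obtain p where p: "p \<in> fst c" "x = snd c p" using x by auto
  show ?thesis
    using linear_compose[OF linear_compose[OF linear_const_vf[OF c p(1)]
        D_linear[OF open_dom[OF c] p(1) smooth_vf_const_vf[OF c]]] linear_comps[OF c p(1)]] 
    by (simp add: p(2) Gamma_snd[OF c p(1)] o_def)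
qed

lemma linear_Gamma2:
  assumes c: "c \<in> A" and x: "x \<in> snd c ` fst c" shows "linear (\<lambda>b. \<Gamma> c x a b)"
proof -
  obtain p where p: "p \<in> fst c" "x = snd c p" using x by auto
  note lin = linear_comps[OF c p(1)]
  have D: "D p v (const_vf A c (b + b')) = D p v (const_vf A c b) + D p v (const_vf A c b')"
    "D p v (const_vf A c (k *\<^sub>R b)) = k *\<^sub>R D p v (const_vf A c b)" for v b b' k
  proof -
    have "D p v (const_vf A c (b + b')) = D p v (\<lambda>q. const_vf A c b q + const_vf A c b' q)"
      by (rule D_local[OF open_dom[OF c] p(1) smooth_vf_const_vf[OF c]]) (simp add: linear_add[OF linear_const_vf[OF c]])
    then show "D p v (const_vf A c (b + b')) = D p v (const_vf A c b) + D p v (const_vf A c b')"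
      using D_add[OF open_dom[OF c] p(1) smooth_vf_const_vf[OF c] smooth_vf_const_vf[OF c]] by simp
    have "D p v (const_vf A c (k *\<^sub>R b)) = D p v (\<lambda>q. k *\<^sub>R const_vf A c b q)"
      by (rule D_local[OF open_dom[OF c] p(1) smooth_vf_const_vf[OF c]]) (simp add: linear_cmul[OF linear_const_vf[OF c]])
    then show "D p v (const_vf A c (k *\<^sub>R b)) = k *\<^sub>R D p v (const_vf A c b)"
      using D_const_scale[OF open_dom[OF c] p(1) smooth_vf_const_vf[OF c]] by simp
  qed
  show ?thesis
    by (rule linearI) (simp_all add: p Gamma_snd[OF c p(1)] D linear_add[OF lin] linear_cmul[OF lin])
qed

lemma smooth_Gamma: "c \<in> A \<Longrightarrow> smooth_on (snd c ` fst c) (\<lambda>x. \<Gamma> c x a b)"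
  using smooth_vfD[OF D_smooth[OF open_dom smooth_vf_const_vf smooth_vf_const_vf], of c c a b]
  unfolding vf_rep_def Gamma_rep_def Let_def by simp

text \<open>Expanding \<open>Y\<close> in the constant fields of the chart reduces the classical
  coordinate formula to the product rule. The expansion holds only on \<open>U\<close>, hence the
  appeal to locality.\<close>

lemma D_chart:
  assumes c: "c \<in> A" and U: "open U" "U \<subseteq> fst c" "p \<in> U" and Y: "smooth_vf A U Y"
  shows "comps A c p (D p v Y) = frechet_derivative (vf_rep A c Y) (at (snd c p)) (comps A c p v)
      + \<Gamma> c (snd c p) (comps A c p v) (comps A c p (Y p))"
proof -
  have p: "p \<in> fst c" using U by auto
  let ?E = "\<lambda>i. const_vf A c (axis i 1)"
  define f where "f i q = comps A c q (Y q) $ i" for i q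
  have Ys: "smooth_on (snd c ` U) (vf_rep A c Y)" by (rule smooth_vfD[OF Y c U(2)])
  have fi: "f i \<circ> pt c = (\<lambda>x. vf_rep A c Y x $ i)" for i
    by (simp add: fun_eq_iff f_def vf_rep_def Let_def)
  have f: "smooth_fun A U (f i)" for i
    using Ys[unfolded smooth_on_vec[OF open_image'[OF c U(1,2)]]] by (intro smooth_funI[OF c U(1,2)]) (simp add: fi)
  have E: "smooth_vf A U (?E i)" for i by (rule smooth_vf_subset[OF smooth_vf_const_vf[OF c] U(2)])
  have fE: "smooth_vf A U (\<lambda>q. f i q *\<^sub>R ?E i q)" for i by (rule smooth_vf_scale[OF U(1) f E])
  have Y_eq: "Y q = (\<Sum>i\<in>UNIV. f i q *\<^sub>R ?E i q)" if "q \<in> U" for q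
    using linear_expand_axis[OF linear_const_vf[OF c, of q], of "comps A c q (Y q)"] that U(2) c
    by (auto simp: f_def)
  have dd: "dir_deriv A p v (f i) = frechet_derivative (vf_rep A c Y) (at (snd c p)) (comps A c p v) $ i" for i
  proof (rule dir_deriv_chart[OF c p])
    show "(f i \<circ> pt c has_derivative (\<lambda>h. frechet_derivative (vf_rep A c Y) (at (snd c p)) h $ i)) (at (snd c p))"
      unfolding fi
      by (rule bounded_linear.has_derivative[OF bounded_linear_vec_nth smooth_on_has_derivative[OF Ys]]) (use U in auto)
  qed
  have "D p v Y = D p v (\<lambda>q. \<Sum>i\<in>UNIV. f i q *\<^sub>R ?E i q)" by (rule D_local[OF U(1,3) Y Y_eq])
  also have "\<dots> = (\<Sum>i\<in>UNIV. dir_deriv A p v (f i) *\<^sub>R ?E i p + f i p *\<^sub>R D p v (?E i))"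
    by (simp add: D_sum[OF U(1,3) fE] D_scale[OF U(1,3) f E])
  finally have D_eq: "comps A c p (D p v Y) =
     (\<Sum>i\<in>UNIV. dir_deriv A p v (f i) *\<^sub>R axis i 1 + f i p *\<^sub>R comps A c p (D p v (?E i)))"
    using c p by (simp add: linear_sum[OF linear_comps[OF c p]] linear_add[OF linear_comps[OF c p]]
        linear_cmul[OF linear_comps[OF c p]])
  have "comps A c p (D p v (?E i)) = \<Gamma> c (snd c p) (comps A c p v) (axis i 1)" for i
    using c p by (simp add: Gamma_snd)
  with D_eq show ?thesis
    using linear_expand_axis[OF linear_Gamma2[OF c, of "snd c p" "comps A c p v"], of "comps A c p (Y p)", symmetric] p
    by (simp add: sum.distrib dd basis_expansion_scaleR f_def)
qed

section \<open>Change of chart: Christoffel symbols, torsion and the geodesic equation\<close>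

text \<open>The inhomogeneous transformation law of Christoffel symbols. It is
  \<open>D_chart\<close> in \<open>c'\<close> for a field constant in \<open>c\<close>: its
  components in \<open>c'\<close> are the Jacobian applied to \<open>b\<close>, and differentiating
  them gives the second derivative of the transition map.\<close>

lemma Gamma_change:
  assumes c: "c \<in> A" "p \<in> fst c" and c': "c' \<in> A" "p \<in> fst c'"
  shows "change c c' p (\<Gamma> c (snd c p) a b) =
     frechet_derivative (\<lambda>z. frechet_derivative (transition c c') (at z) b) (at (snd c p)) a
     + \<Gamma> c' (snd c' p) (change c c' p a) (change c c' p b)"
proof -
  let ?U = "fst c' \<inter> fst c" and ?v = "const_vf A c a p" and ?Y = "const_vf A c b"
  let ?F = "\<lambda>z. frechet_derivative (transition c c') (at z) b"
  have U: "open ?U" "?U \<subseteq> fst c'" "p \<in> ?U" using c c' by (auto intro: open_Int open_dom)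
  have Y: "smooth_vf A ?U ?Y" by (rule smooth_vf_subset[OF smooth_vf_const_vf[OF c(1)]]) auto
  have comps_const: "comps A c' q (const_vf A c w q) = change c c' q w" if "q \<in> ?U" for q w
    using change_comps[OF c(1) c'(1), of q "const_vf A c w q"] that c by simp
  have "(?F has_derivative frechet_derivative ?F (at (snd c p))) (at (snd c p))"
    by (rule smooth_on_has_derivative[OF smooth_on_frechet_derivative[OF transition_smooth[OF c(1) c'(1)]]]) (use c c' in auto)
  then have "(?F \<circ> transition c' c has_derivative frechet_derivative ?F (at (snd c p)) \<circ> change c' c p) (at (snd c' p))"
    using c c' by (intro diff_chain_at change_has_derivative) auto
  then have "(vf_rep A c' ?Y has_derivative frechet_derivative ?F (at (snd c p)) \<circ> change c' c p) (at (snd c' p))"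
  proof (rule has_derivative_transform_within_open[OF _ open_image'[OF c'(1) U(1,2)]])
    show "(?F \<circ> transition c' c) x = vf_rep A c' ?Y x" if "x \<in> snd c' ` ?U" for x
      using that c c' comps_const by (auto simp: change_def)
  qed (use U in auto)
  from frechet_derivative_at[OF this, symmetric]
  have "frechet_derivative (vf_rep A c' ?Y) (at (snd c' p)) (change c c' p a) = frechet_derivative ?F (at (snd c p)) a"
    using change_change[OF c(1) c'(1) c(1) c(2) c'(2) c(2)] c by simp
  then show ?thesis
    using D_chart[OF c'(1) U Y, of ?v] comps_const U(3) change_comps[OF c(1) c'(1) c(2) c'(2)] c by (simp add: Gamma_snd)
qed

lemma torsion_chart_at: "torsion A D p v w = \<Gamma> (chart_at A p) (snd (chart_at A p) p) v w - \<Gamma> (chart_at A p) (snd (chart_at A p) p) w v"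
proof -
  let ?c = "chart_at A p"
  have "frechet_derivative (vf_rep A ?c (const_vf A ?c u)) (at (snd ?c p)) = (\<lambda>_. 0)" for u
  proof -
    have "(vf_rep A ?c (const_vf A ?c u) has_derivative (\<lambda>_. 0)) (at (snd ?c p))"
      by (rule has_derivative_transform_within_open[OF has_derivative_const[of u] open_range[OF chart_at(1)]])
        (use chart_at in auto)
    then show ?thesis by (rule frechet_derivative_at[symmetric])
  qed
  then show ?thesis
    using chart_at by (simp add: torsion_def extend_def bracket_def Let_def Gamma_snd)
qed

text \<open>Tensoriality of the torsion: the inhomogeneous terms of \<open>Gamma_change\<close>
  cancel because second derivatives of the transition map commute.\<close>

lemma torsion_chart:
  assumes c: "c \<in> A" "p \<in> fst c"
  shows "comps A c p (torsion A D p v w) =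
    \<Gamma> c (snd c p) (comps A c p v) (comps A c p w) - \<Gamma> c (snd c p) (comps A c p w) (comps A c p v)"
proof -
  let ?c = "chart_at A p"
  have ch: "comps A c p u = change ?c c p u" for u by (simp add: comps_def)
  have "comps A c p (torsion A D p v w) =
      change ?c c p (\<Gamma> ?c (snd ?c p) v w) - change ?c c p (\<Gamma> ?c (snd ?c p) w v)"
    by (simp add: ch torsion_chart_at linear_diff[OF linear_change[OF chart_at(1) c(1) chart_at(2) c(2)]])
  moreover have "frechet_derivative (\<lambda>z. frechet_derivative (transition ?c c) (at z) w) (at (snd ?c p)) v
    = frechet_derivative (\<lambda>z. frechet_derivative (transition ?c c) (at z) v) (at (snd ?c p)) w"
    by (rule frechet_derivative_commute[OF smooth_on_CkD[OF transition_smooth[OF chart_at(1) c(1)]] open_overlap[OF chart_at(1) c(1)]])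
      (use chart_at c in auto)
  ultimately show ?thesis
    by (simp add: Gamma_change[OF chart_at c] ch)
qed

lemma Christoffel_sum:
  assumes c: "c \<in> A" "p \<in> fst c"
  shows "(\<Sum>j\<in>UNIV. \<Sum>k\<in>UNIV. Christoffel A D c p i j k * a $ j * b $ k) = \<Gamma> c (snd c p) a b $ i"
proof -
  have x: "snd c p \<in> snd c ` fst c" using c by auto
  have "\<Gamma> c (snd c p) a b = (\<Sum>j\<in>UNIV. a $ j *\<^sub>R \<Gamma> c (snd c p) (axis j 1) b)"
    by (rule linear_expand_axis[OF linear_Gamma1[OF c(1) x]])
  also have "\<dots> = (\<Sum>j\<in>UNIV. a $ j *\<^sub>R (\<Sum>k\<in>UNIV. b $ k *\<^sub>R \<Gamma> c (snd c p) (axis j 1) (axis k 1)))"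
    by (subst linear_expand_axis[OF linear_Gamma2[OF c(1) x]]) simp
  finally show ?thesis
    using c by (simp add: Christoffel_def coord_vf_def Gamma_snd sum_distrib_left mult_ac)
qed

lemma geodesic_iff:
  "geodesic A D I \<gamma> \<longleftrightarrow> Ck_curve A 2 I \<gamma> \<and> (\<forall>c\<in>A. \<forall>t\<in>I. \<gamma> t \<in> fst c \<longrightarrow>
     vector_derivative (\<lambda>s. vector_derivative (snd c \<circ> \<gamma>) (at s)) (at t) +
     \<Gamma> c (snd c (\<gamma> t)) (vector_derivative (snd c \<circ> \<gamma>) (at t)) (vector_derivative (snd c \<circ> \<gamma>) (at t)) = 0)"
  unfolding geodesic_def Let_def using Christoffel_sum by (auto simp: vec_eq_iff)

text \<open>The definition demands the geodesic equation in every chart, while an initial value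
  problem supplies it in one. Differentiating the Jacobian along the curve produces exactly the
  inhomogeneous term of \<open>Gamma_change\<close>, so the equation carries over.\<close>

lemma geodesic_chartI:
  assumes c: "c \<in> A" and I: "open I" "is_interval I" "I \<noteq> {}"
    and x: "\<And>t. t \<in> I \<Longrightarrow> x t \<in> snd c ` fst c"
    and x': "\<And>t. t \<in> I \<Longrightarrow> (x has_vector_derivative y t) (at t)"
    and y': "\<And>t. t \<in> I \<Longrightarrow> (y has_vector_derivative - \<Gamma> c (x t) (y t) (y t)) (at t)"
    and Ck: "Ck_on 2 I x"
  shows "geodesic A D I (pt c \<circ> x)"
  unfolding geodesic_iff
proof (intro conjI ballI impI)
  show curve: "Ck_curve A 2 I (pt c \<circ> x)" by (rule Ck_curve_pt[OF c I Ck]) (use x in auto)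
  fix c' t assume c': "c' \<in> A" and t: "t \<in> I" "(pt c \<circ> x) t \<in> fst c'"
  let ?\<gamma> = "pt c \<circ> x" and ?\<psi> = "transition c c'"
  let ?F = "\<lambda>z. frechet_derivative ?\<psi> (at z)"
  let ?S = "snd c ` (fst c \<inter> fst c')" and ?I = "{s \<in> I. ?\<gamma> s \<in> fst c'}"
  have I': "open ?I" by (rule open_curve_preimage[OF curve c'])
  have xS: "x s \<in> ?S" if "s \<in> ?I" for s
    using that x[of s] pt_in[of "x s" c] snd_pt[of "x s" c] by (intro image_eqI[of _ _ "pt c (x s)"]) auto
  have F: "(?\<psi> has_derivative ?F z) (at z)" if "z \<in> ?S" for z
    by (rule smooth_on_has_derivative[OF transition_smooth[OF c c'] that])
  have F': "((\<lambda>z. ?F z b) has_derivative frechet_derivative (\<lambda>z. ?F z b) (at z)) (at z)" if "z \<in> ?S" for z b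
    by (rule smooth_on_has_derivative[OF smooth_on_frechet_derivative[OF transition_smooth[OF c c']] that])
  have v: "vector_derivative (snd c' \<circ> ?\<gamma>) (at s) = ?F (x s) (y s)" if s: "s \<in> ?I" for s
  proof -
    have "(?\<psi> \<circ> x has_vector_derivative ?F (x s) (y s)) (at s)"
      using vector_derivative_diff_chain_within[OF x' has_derivative_at_withinI[OF F[OF xS[OF s]]]] s by auto
    moreover have "?\<psi> \<circ> x = snd c' \<circ> ?\<gamma>" by (simp add: fun_eq_iff transition_def)
    ultimately show ?thesis by (metis vector_derivative_at)
  qed
  have tI: "t \<in> ?I" using t by auto
  have "((\<lambda>s. ?F (x s) (y s)) has_vector_derivative
     frechet_derivative (\<lambda>z. ?F z (y t)) (at (x t)) (y t) + ?F (x t) (- \<Gamma> c (x t) (y t) (y t))) (at t)"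
    by (rule has_vector_derivative_apply_linear[OF open_overlap[OF c c'] xS[OF tI]
          has_derivative_linear[OF F] F'[OF xS[OF tI]] x'[OF t(1)] y'[OF t(1)]])
  then have "((\<lambda>s. vector_derivative (snd c' \<circ> ?\<gamma>) (at s)) has_vector_derivative
     frechet_derivative (\<lambda>z. ?F z (y t)) (at (x t)) (y t) + ?F (x t) (- \<Gamma> c (x t) (y t) (y t))) (at t)"
    by (rule has_vector_derivative_transform_within_open[OF _ I' tI]) (simp add: v)
  then have vd: "vector_derivative (\<lambda>s. vector_derivative (snd c' \<circ> ?\<gamma>) (at s)) (at t) =
     frechet_derivative (\<lambda>z. ?F z (y t)) (at (x t)) (y t) - ?F (x t) (\<Gamma> c (x t) (y t) (y t))"
    by (simp add: vector_derivative_at linear_neg[OF has_derivative_linear[OF F[OF xS[OF tI]]]])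
  have p: "?\<gamma> t \<in> fst c" "snd c (?\<gamma> t) = x t" using pt_in[OF x[OF t(1)]] snd_pt[OF x[OF t(1)]] by simp_all
  have "change c c' (?\<gamma> t) = ?F (x t)" using p by (simp add: change_def)
  with Gamma_change[OF c p(1) c' t(2), of "y t" "y t"] vd v[OF tI] p
  show "vector_derivative (\<lambda>s. vector_derivative (snd c' \<circ> ?\<gamma>) (at s)) (at t) +
     \<Gamma> c' (snd c' (?\<gamma> t)) (vector_derivative (snd c' \<circ> ?\<gamma>) (at t)) (vector_derivative (snd c' \<circ> ?\<gamma>) (at t)) = 0"
    by simp
qed

end

section \<open>Pseudohermitian geometry in charts\<close>

lemma Re_vec_simps:
  "Re_vec (Z + W) = Re_vec Z + Re_vec W" "Im_vec (Z + W) = Im_vec Z + Im_vec W"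
  "Re_vec (a *s Z) = Re a *\<^sub>R Re_vec Z - Im a *\<^sub>R Im_vec Z" "Im_vec (a *s Z) = Im a *\<^sub>R Re_vec Z + Re a *\<^sub>R Im_vec Z"
  "Re_vec 0 = 0" "Im_vec 0 = 0" "Re_vec (cnj_vec Z) = Re_vec Z" "Im_vec (cnj_vec Z) = - Im_vec Z"
  "Re_vec (- Z) = - Re_vec Z" "Im_vec (- Z) = - Im_vec Z"
  "Re_vec (of_real_vec v) = v" "Im_vec (of_real_vec v) = 0"
  by (simp_all add: vec_eq_iff Re_vec_def Im_vec_def cnj_vec_def of_real_vec_def)

lemma Re_vec_diff: "Re_vec (Z - W) = Re_vec Z - Re_vec W" "Im_vec (Z - W) = Im_vec Z - Im_vec W"
  by (simp_all add: vec_eq_iff Re_vec_def Im_vec_def)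

lemma cvec_eq_iff: "Z = W \<longleftrightarrow> Re_vec Z = Re_vec W \<and> Im_vec Z = Im_vec W"
  by (auto simp: vec_eq_iff Re_vec_def Im_vec_def complex_eq_iff)

locale pseudohermitian = smooth_manifold A
  for A :: "('m::{t2_space, second_countable_topology}, 'd::finite) chart set" +
  fixes n :: nat and T10 :: "'m \<Rightarrow> (complex ^ 'd) set" and \<theta> :: "'m \<Rightarrow> real ^ 'd \<Rightarrow> real"
    and T :: "'m \<Rightarrow> real ^ 'd" and D :: "('m, 'd) connection"
  assumes dim: "CARD('d) = 2 * n + 1"
    and CR: "CR_structure A n T10"
    and contact: "pseudohermitian_form A T10 \<theta>"
    and strictly_pseudoconvex: "positive_definite_on (Levi_distr T10) (G_form A T10 \<theta>)"
    and T: "characteristic_direction A \<theta> T"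
    and TW: "Tanaka_Webster A T10 \<theta> T D"
begin

abbreviation "H \<equiv> Levi_distr T10"
abbreviation "J \<equiv> J_ext T10 \<theta> T"
abbreviation "g \<equiv> Webster_metric A T10 \<theta> T"
abbreviation "\<omega> \<equiv> ext_deriv A \<theta>"
abbreviation "\<tau> \<equiv> pseudohermitian_torsion A T D"

lemmas TW_conj = TW[unfolded Tanaka_Webster_def Let_def]

sublocale manifold_connection A D
  by unfold_locales (rule TW_conj[THEN conjunct1])

lemma D_H:
  assumes "open U" "p \<in> U" "smooth_vf A U Y" "\<And>q. q \<in> U \<Longrightarrow> Y q \<in> H q" shows "D p v Y \<in> H p"
  using TW_conj[THEN conjunct2, THEN conjunct1, rule_format, of U p Y v] assms by simp

lemma D_g:
  assumes "open U" "p \<in> U" "smooth_vf A U Y" "smooth_vf A U Z"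
  shows "dir_deriv A p v (\<lambda>q. g q (Y q) (Z q)) = g p (D p v Y) (Z p) + g p (Y p) (D p v Z)"
  using TW_conj[THEN conjunct2, THEN conjunct2, THEN conjunct1, rule_format, of U p Y Z v] assms by simp

lemma D_J:
  assumes "open U" "p \<in> U" "smooth_vf A U Y" shows "D p v (\<lambda>q. J q (Y q)) = J p (D p v Y)"
  using TW_conj[THEN conjunct2, THEN conjunct2, THEN conjunct2, THEN conjunct1, rule_format, of U p Y v] assms by simp

lemma ctorsion_T10:
  assumes "Z \<in> T10 p" "W \<in> T10 p"
  shows "ctorsion A D p Z W = 0"
    "ctorsion A D p Z (cnj_vec W) = (2 * cext_deriv A \<theta> p Z (cnj_vec W)) *s of_real_vec (T p)"
  using TW_conj[THEN conjunct2, THEN conjunct2, THEN conjunct2, THEN conjunct2, THEN conjunct1] assms by blast+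

lemma \<tau>_J: "\<tau> p (J p v) = - J p (\<tau> p v)"
  using TW_conj[THEN conjunct2, THEN conjunct2, THEN conjunct2, THEN conjunct2, THEN conjunct2, rule_format, of p v]
  by (simp add: eq_neg_iff_add_eq_0)

section \<open>The Levi distribution and its complex structure\<close>

lemma linear_\<theta>: "linear (\<theta> p)"
  using contact by (simp add: pseudohermitian_form_def smooth_one_form_def)

lemma H_iff: "v \<in> H p \<longleftrightarrow> \<theta> p v = 0"
  using contact unfolding pseudohermitian_form_def by blast

lemma \<theta>_T [simp]: "\<theta> p (T p) = 1"
  using T by (simp add: characteristic_direction_def)

lemma \<omega>_T1 [simp]: "\<omega> p (T p) w = 0"
  using T by (simp add: characteristic_direction_def)

lemma smooth_T: "smooth_vf A UNIV T"
  using T by (simp add: characteristic_direction_def)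

lemma subspace_T10: "vec.subspace (T10 p)"
  using CR by (simp add: CR_structure_def)

lemma T10_scale: "Z \<in> T10 p \<Longrightarrow> a *s Z \<in> T10 p"
  using subspace_T10 vec.subspace_scale by blast

text \<open>Conjugation does not affect real parts, so \<open>Z + cnj_vec W\<close> may be replaced
  by \<open>Z + W\<close>, a single element of \<open>T10\<close>.\<close>

lemma H_Re: "v \<in> H p \<longleftrightarrow> (\<exists>Z\<in>T10 p. v = Re_vec Z)"
proof
  assume "v \<in> H p"
  then obtain Z W where "v = Re_vec (Z + cnj_vec W)" "Z \<in> T10 p" "W \<in> T10 p" by (auto simp: Levi_distr_def)
  then show "\<exists>Z\<in>T10 p. v = Re_vec Z"
    using vec.subspace_add[OF subspace_T10] by (intro bexI[of _ "Z + W"]) (simp_all add: Re_vec_simps)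
next
  assume "\<exists>Z\<in>T10 p. v = Re_vec Z"
  then obtain Z where Z: "Z \<in> T10 p" "v = Re_vec Z" by blast
  have "0 \<in> T10 p" using vec.subspace_0[OF subspace_T10] .
  moreover have "v = Re_vec (Z + cnj_vec 0)" using Z by (simp add: Re_vec_simps)
  ultimately show "v \<in> H p" unfolding Levi_distr_def using Z by blast
qed

text \<open>\<open>Re_vec Z\<close> is the sum of \<open>Z/2\<close> and its conjugate, and
  \<open>\<i>\<close> times their difference is \<open>- Im_vec Z\<close>. That the description
  determines its value is where the trivial intersection of \<open>T10\<close> with its conjugate
  enters.\<close>

lemma Levi_J_Re: "Z \<in> T10 p \<Longrightarrow> Levi_J T10 p (Re_vec Z) = - Im_vec Z"
  unfolding Levi_J_def
proof (rule the_equality)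
  assume Z: "Z \<in> T10 p"
  then show "\<exists>Z'\<in>T10 p. of_real_vec (Re_vec Z) = Z' + cnj_vec Z' \<and> of_real_vec (- Im_vec Z) = \<i> *s (Z' - cnj_vec Z')"
    by (intro bexI[of _ "(1/2) *s Z"]) (simp_all add: T10_scale cvec_eq_iff Re_vec_simps Re_vec_diff flip: scaleR_add_left)
  fix w assume "\<exists>Z'\<in>T10 p. of_real_vec (Re_vec Z) = Z' + cnj_vec Z' \<and> of_real_vec w = \<i> *s (Z' - cnj_vec Z')"
  then obtain Z' where Z': "Z' \<in> T10 p" "of_real_vec (Re_vec Z) = Z' + cnj_vec Z'" "of_real_vec w = \<i> *s (Z' - cnj_vec Z')"
    by blast
  \<comment> \<open>\<open>Z\<close> and \<open>2 *s Z'\<close> have the same real part, so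
    \<open>U\<close> is purely imaginary, equals minus its own conjugate, and thus lies both in
    \<open>T10\<close> and in its conjugate.\<close>
  define U where "U = Z - 2 *s Z'"
  have U: "U \<in> T10 p" unfolding U_def using Z Z' T10_scale vec.subspace_diff[OF subspace_T10] by blast
  have Re: "Re_vec Z = 2 *\<^sub>R Re_vec Z'" and w: "w = - (2 *\<^sub>R Im_vec Z')"
    using Z'(2,3) by (simp_all add: cvec_eq_iff Re_vec_simps Re_vec_diff scaleR_2)
  have "U = cnj_vec ((-1) *s U)"
    by (simp add: cvec_eq_iff Re_vec_simps Re_vec_diff U_def Re)
  then have "U \<in> T10 p \<inter> cnj_vec ` T10 p" using U T10_scale by blast
  moreover have "T10 p \<inter> cnj_vec ` T10 p = {0}" using CR by (simp add: CR_structure_def)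
  ultimately have "U = 0" by blast
  then show "w = - Im_vec Z" unfolding U_def by (simp add: cvec_eq_iff Re_vec_simps Re_vec_diff w)
qed

lemma Im_in_H: "Z \<in> T10 p \<Longrightarrow> Im_vec Z \<in> H p"
  unfolding H_Re using T10_scale[of Z p "- \<i>"] by (intro bexI[of _ "(-\<i>) *s Z"]) (simp_all add: Re_vec_simps)

lemma Re_in_H: "Z \<in> T10 p \<Longrightarrow> Re_vec Z \<in> H p"
  unfolding H_Re by blast

lemma proj_in_H: "Levi_proj \<theta> T p v \<in> H p"
  by (simp add: H_iff Levi_proj_def linear_diff[OF linear_\<theta>] linear_cmul[OF linear_\<theta>])

lemma proj_H: "v \<in> H p \<Longrightarrow> Levi_proj \<theta> T p v = v"
  by (simp add: H_iff Levi_proj_def)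

lemma linear_proj: "linear (Levi_proj \<theta> T p)"
  by (rule linearI) (simp_all add: Levi_proj_def linear_add[OF linear_\<theta>] linear_cmul[OF linear_\<theta>] algebra_simps)

lemma proj_T [simp]: "Levi_proj \<theta> T p (T p) = 0"
  by (simp add: Levi_proj_def)

lemma J_Re: "Z \<in> T10 p \<Longrightarrow> J p (Re_vec Z) = - Im_vec Z"
  by (simp add: J_ext_def proj_H Re_in_H Levi_J_Re)

lemma J_Im:
  assumes "Z \<in> T10 p" shows "J p (Im_vec Z) = Re_vec Z"
  using J_Re[OF T10_scale[OF assms, of "-\<i>"]] by (simp add: Re_vec_simps)

lemma J_proj: "J p (Levi_proj \<theta> T p v) = J p v"
  by (simp add: J_ext_def proj_H proj_in_H)

lemma linear_J: "linear (J p)"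
proof -
  have add: "J p (v + w) = J p v + J p w" and scale: "J p (k *\<^sub>R v) = k *\<^sub>R J p v" for v w k
  proof -
    obtain Z W where Z: "Z \<in> T10 p" "Levi_proj \<theta> T p v = Re_vec Z" and W: "W \<in> T10 p" "Levi_proj \<theta> T p w = Re_vec W"
      using proj_in_H H_Re by metis
    have "Levi_J T10 p (Re_vec (Z + W)) = Levi_J T10 p (Re_vec Z) + Levi_J T10 p (Re_vec W)"
      using Z W vec.subspace_add[OF subspace_T10] by (simp add: Levi_J_Re Re_vec_simps(2))
    then show "J p (v + w) = J p v + J p w"
      by (simp add: J_ext_def linear_add[OF linear_proj] Z W Re_vec_simps)
    have "Levi_J T10 p (Re_vec (complex_of_real k *s Z)) = k *\<^sub>R Levi_J T10 p (Re_vec Z)"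
      using Z T10_scale[OF Z(1), of "complex_of_real k"] by (simp add: Levi_J_Re Re_vec_simps(4))
    then show "J p (k *\<^sub>R v) = k *\<^sub>R J p v"
      by (simp add: J_ext_def linear_cmul[OF linear_proj] Z Re_vec_simps)
  qed
  show ?thesis by (rule linearI) (fact add, fact scale)
qed

lemma J_T [simp]: "J p (T p) = 0"
  using J_proj[of p "T p"] linear_0[OF linear_J] by simp

lemma J_in_H: "J p v \<in> H p"
proof -
  obtain Z where Z: "Z \<in> T10 p" "Levi_proj \<theta> T p v = Re_vec Z" using proj_in_H H_Re by metis
  have "J p v = - Im_vec Z" using J_proj[of p v] J_Re Z by simp
  also have "\<dots> \<in> H p" using Im_in_H[OF Z(1)] by (simp add: H_iff linear_neg[OF linear_\<theta>])
  finally show ?thesis .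
qed

lemma J_J: "J p (J p v) = - Levi_proj \<theta> T p v"
proof -
  obtain Z where Z: "Z \<in> T10 p" "Levi_proj \<theta> T p v = Re_vec Z" using proj_in_H H_Re by metis
  have "J p v = - Im_vec Z" using J_proj[of p v] J_Re Z by simp
  then show ?thesis using Z by (simp add: linear_neg[OF linear_J] J_Im)
qed

section \<open>Parallelism of \<open>T\<close> and \<open>\<theta>\<close>\<close>

text \<open>From \<open>J T = 0\<close> and \<open>J\<close> parallel, the derivative of
  \<open>T\<close> is a multiple of \<open>T\<close>; constancy of \<open>g(T, T)\<close> kills the
  coefficient.\<close>

lemma D_T: "D p v T = 0"
proof -
  have T': "smooth_vf A UNIV T" "p \<in> UNIV" using smooth_T by auto
  have "J p (D p v T) = 0" using D_J[OF open_UNIV T'(2,1), of v] by (simp add: D_zero)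
  then have "Levi_proj \<theta> T p (D p v T) = 0" using J_J[of p "D p v T"] linear_0[OF linear_J] by simp
  then have DT: "D p v T = \<theta> p (D p v T) *\<^sub>R T p" by (simp add: Levi_proj_def)
  \<comment> \<open>Bilinearity of \<open>\<omega>\<close> is not yet available, as it is deduced
    from this lemma later; the value at zero vectors suffices here.\<close>
  have \<omega>0: "\<omega> q 0 0 = 0" for q
    by (simp add: ext_deriv_def Let_def bracket_def linear_0[OF linear_\<theta>])
  have g: "g q (a *\<^sub>R T q) (b *\<^sub>R T q) = a * b" for q a b
    using linear_0[OF linear_J, of q]
    by (simp add: Webster_metric_def G_form_def linear_cmul[OF linear_proj] linear_cmul[OF linear_\<theta>] \<omega>0 J_ext_def linear_0[OF linear_proj])
  have "dir_deriv A p v (\<lambda>q. g q (T q) (T q)) = 0"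
    by (rule dir_deriv_locally_const[of UNIV _ _ 1]) (use g[of _ 1 1] in auto)
  moreover have "g p (D p v T) (T p) = \<theta> p (D p v T)" "g p (T p) (D p v T) = \<theta> p (D p v T)"
    using g[of p "\<theta> p (D p v T)" 1] g[of p 1 "\<theta> p (D p v T)"] DT by simp_all
  ultimately have "\<theta> p (D p v T) = 0" using D_g[OF open_UNIV T'(2,1,1), of v] by simp
  then show ?thesis using DT by simp
qed

definition \<theta>_rep :: "('m, 'd) chart \<Rightarrow> real ^ 'd \<Rightarrow> real ^ 'd \<Rightarrow> real" where
  "\<theta>_rep c x a = \<theta> (pt c x) (const_vf A c a (pt c x))"

lemma \<theta>_rep_comps: "c \<in> A \<Longrightarrow> p \<in> fst c \<Longrightarrow> \<theta>_rep c (snd c p) (comps A c p v) = \<theta> p v"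
  by (simp add: \<theta>_rep_def)

lemma linear_\<theta>_rep: "c \<in> A \<Longrightarrow> x \<in> snd c ` fst c \<Longrightarrow> linear (\<theta>_rep c x)"
  using linear_compose[OF linear_const_vf[OF _ pt_in] linear_\<theta>, of c x "pt c x"] by (simp add: \<theta>_rep_def[abs_def] o_def)

lemma smooth_\<theta>_rep: "c \<in> A \<Longrightarrow> smooth_on (snd c ` fst c) (\<lambda>x. \<theta>_rep c x b)"
proof (rule smooth_on_apply_linear[OF open_range])
  assume c: "c \<in> A"
  have ax: "smooth_on (snd c ` fst c) (\<lambda>x. \<theta>_rep c x (axis k 1))" for k
    using contact c by (simp add: pseudohermitian_form_def smooth_one_form_def \<theta>_rep_def o_def coord_vf_def)
  have "smooth_on (snd c ` fst c) (\<lambda>x. \<Sum>k\<in>UNIV. (b $ k) *\<^sub>R \<theta>_rep c x (axis k 1))" for b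
    by (intro smooth_on_sum[OF open_range[OF c]] smooth_on_scaleR[OF open_range[OF c]] smooth_on_const ax)
  then show "smooth_on (snd c ` fst c) (\<lambda>x. \<theta>_rep c x b)" for b
    by (rule smooth_on_cong[OF open_range[OF c], rotated])
      (rule linear_expand_axis[OF linear_\<theta>_rep[OF c], symmetric])
qed (auto simp: linear_\<theta>_rep smooth_on_const)

lemma smooth_fun_\<theta>:
  assumes c: "c \<in> A" and U: "open U" "U \<subseteq> fst c" and Y: "smooth_vf A U Y"
  shows "smooth_fun A U (\<lambda>q. \<theta> q (Y q))"
proof (rule smooth_funI[OF c U])
  have sub: "snd c ` U \<subseteq> snd c ` fst c" using U by auto
  have "smooth_on (snd c ` U) (\<lambda>x. \<theta>_rep c x (vf_rep A c Y x))"
    by (rule smooth_on_apply_linear[OF open_image'[OF c U] linear_\<theta>_rep[OF c subsetD[OF sub]]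
          smooth_on_subset[OF smooth_\<theta>_rep[OF c] sub] smooth_vfD[OF Y c U(2)]])
  then show "smooth_on (snd c ` U) ((\<lambda>q. \<theta> q (Y q)) \<circ> pt c)"
    by (rule smooth_on_cong[OF open_image'[OF c U], rotated]) (auto simp: c \<theta>_rep_comps subsetD[OF U(2)])
qed

text \<open>\<open>Y - \<theta>(Y) T\<close> is a section of the parallel distribution
  \<open>H\<close>, so \<open>\<theta>\<close> annihilates its covariant derivative. Expanding that
  derivative with the product rule and \<open>D T = 0\<close> gives the claim.\<close>

lemma dir_deriv_\<theta>:
  assumes U: "open U" "p \<in> U" and Y: "smooth_vf A U Y"
  shows "dir_deriv A p v (\<lambda>q. \<theta> q (Y q)) = \<theta> p (D p v Y)"
proof -
  let ?c = "chart_at A p"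
  let ?U = "U \<inter> fst ?c" and ?f = "\<lambda>q. \<theta> q (Y q)"
  let ?Y = "\<lambda>q. Y q + (- 1) *\<^sub>R (?f q *\<^sub>R T q)"
  have U': "open ?U" "?U \<subseteq> fst ?c" "p \<in> ?U" using U chart_at open_dom[OF chart_at(1)] by auto
  have Y': "smooth_vf A ?U Y" by (rule smooth_vf_subset[OF Y]) auto
  have T': "smooth_vf A ?U T" by (rule smooth_vf_subset[OF smooth_T]) auto
  have f: "smooth_fun A ?U ?f" by (rule smooth_fun_\<theta>[OF chart_at(1) U'(1,2) Y'])
  have fT: "smooth_vf A ?U (\<lambda>q. ?f q *\<^sub>R T q)" by (rule smooth_vf_scale[OF U'(1) f T'])
  have mfT: "smooth_vf A ?U (\<lambda>q. (- 1) *\<^sub>R (?f q *\<^sub>R T q))"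
    by (rule smooth_vf_scale[OF U'(1) smooth_fun_const fT])
  have "D p v ?Y \<in> H p"
    by (rule D_H[OF U'(1,3) smooth_vf_add[OF U'(1) Y' mfT]])
      (simp add: H_iff linear_diff[OF linear_\<theta>] linear_cmul[OF linear_\<theta>])
  moreover have "D p v ?Y = D p v Y - dir_deriv A p v ?f *\<^sub>R T p"
    using D_add[OF U'(1,3) Y' mfT, of v] D_const_scale[OF U'(1,3) fT, of v "- 1"] D_scale[OF U'(1,3) f T', of v]
    by (simp add: D_T)
  ultimately show ?thesis by (simp add: H_iff linear_diff[OF linear_\<theta>] linear_cmul[OF linear_\<theta>])
qed

lemma \<theta>_rep_has_derivative:
  assumes c: "c \<in> A" and x: "x \<in> snd c ` fst c"
  shows "((\<lambda>x. \<theta>_rep c x b) has_derivative (\<lambda>a. \<theta>_rep c x (\<Gamma> c x a b))) (at x)"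
proof -
  obtain p where p: "p \<in> fst c" "x = snd c p" using x by auto
  let ?F = "frechet_derivative (\<lambda>x. \<theta>_rep c x b) (at x)"
  have d: "((\<lambda>x. \<theta>_rep c x b) has_derivative ?F) (at x)" by (rule smooth_on_has_derivative[OF smooth_\<theta>_rep[OF c] x])
  have "?F a = \<theta>_rep c x (\<Gamma> c x a b)" for a
  proof -
    have "(\<lambda>q. \<theta> q (const_vf A c b q)) \<circ> pt c = (\<lambda>x. \<theta>_rep c x b)" by (simp add: fun_eq_iff \<theta>_rep_def)
    then have "dir_deriv A p (const_vf A c a p) (\<lambda>q. \<theta> q (const_vf A c b q)) = ?F a"
      using dir_deriv_chart[OF c p(1), of "\<lambda>q. \<theta> q (const_vf A c b q)" ?F] d c p by simp
    then show ?thesis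
      using dir_deriv_\<theta>[OF open_dom[OF c] p(1) smooth_vf_const_vf[OF c], of "const_vf A c a p" b]
      by (simp add: p(2) Gamma_snd[OF c p(1)] \<theta>_rep_comps[OF c p(1)])
  qed
  then have "?F = (\<lambda>a. \<theta>_rep c x (\<Gamma> c x a b))" by blast
  with d show ?thesis by (simp only:)
qed

lemma T_has_derivative:
  assumes c: "c \<in> A" and x: "x \<in> snd c ` fst c"
  shows "(vf_rep A c T has_derivative (\<lambda>a. - \<Gamma> c x a (vf_rep A c T x))) (at x)"
proof -
  obtain p where p: "p \<in> fst c" "x = snd c p" using x by auto
  have T': "smooth_vf A (fst c) T" by (rule smooth_vf_subset[OF smooth_T]) auto
  have "frechet_derivative (vf_rep A c T) (at x) a + \<Gamma> c x a (vf_rep A c T x) = 0" for a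
    using D_chart[OF c open_dom[OF c] order_refl p(1) T', of "const_vf A c a p"] c p
    by (simp add: D_T linear_0[OF linear_comps])
  then have "frechet_derivative (vf_rep A c T) (at x) = (\<lambda>a. - \<Gamma> c x a (vf_rep A c T x))"
    by (simp add: fun_eq_iff eq_neg_iff_add_eq_0)
  with smooth_on_has_derivative[OF smooth_vfD[OF T' c order_refl] x] show ?thesis by (simp only:)
qed

section \<open>The form \<open>d\<theta>\<close>, the torsion and the Webster metric at a
  point\<close>

text \<open>Since \<open>\<theta>\<close> is parallel, the directional derivatives in
  \<open>ext_deriv\<close> are \<open>\<theta>\<close> of covariant derivatives, and the three terms
  assemble into the torsion. Through this formula \<open>\<omega>\<close> inherits bilinearity, and
  later smoothness, from \<open>\<Gamma>\<close>.\<close>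

lemma \<omega>_torsion: "\<omega> p v w = \<theta> p (torsion A D p v w) / 2"
proof -
  have e: "smooth_vf A (fst (chart_at A p)) (extend A p u)" for u
    unfolding extend_def by (rule smooth_vf_const_vf[OF chart_at(1)])
  show ?thesis
    using dir_deriv_\<theta>[OF open_dom[OF chart_at(1)] chart_at(2) e]
    by (simp add: ext_deriv_def torsion_def Let_def linear_diff[OF linear_\<theta>])
qed

lemma torsion_antisym: "torsion A D p v w = - torsion A D p w v"
  by (simp add: torsion_chart_at)

lemma linear_torsion1: "linear (\<lambda>v. torsion A D p v w)"
  using linear_Gamma1[OF chart_at(1), of "snd (chart_at A p) p" p w] linear_Gamma2[OF chart_at(1), of "snd (chart_at A p) p" p w] chart_at(2)
  by (simp add: torsion_chart_at linear_compose_sub)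

lemma linear_torsion2: "linear (\<lambda>w. torsion A D p v w)"
  using linear_compose_neg[OF linear_torsion1[of p v]] torsion_antisym[of p v] by presburger

lemma linear_\<omega>1: "linear (\<lambda>v. \<omega> p v w)"
  by (rule linearI) (simp_all add: \<omega>_torsion linear_add[OF linear_torsion1] linear_cmul[OF linear_torsion1]
      linear_add[OF linear_\<theta>] linear_cmul[OF linear_\<theta>] add_divide_distrib)

lemma \<omega>_antisym: "\<omega> p v w = - \<omega> p w v"
  using torsion_antisym[of p v w] by (simp add: \<omega>_torsion linear_neg[OF linear_\<theta>])

lemma linear_\<omega>2: "linear (\<lambda>w. \<omega> p v w)"
  by (rule linearI) (simp_all add: \<omega>_torsion linear_add[OF linear_torsion2] linear_cmul[OF linear_torsion2]
      linear_add[OF linear_\<theta>] linear_cmul[OF linear_\<theta>] add_divide_distrib)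

lemma \<omega>_T2 [simp]: "\<omega> p v (T p) = 0"
  using \<omega>_antisym[of p v "T p"] by simp

lemma \<omega>_proj1: "\<omega> p (Levi_proj \<theta> T p v) w = \<omega> p v w"
  by (simp add: Levi_proj_def linear_diff[OF linear_\<omega>1] linear_cmul[OF linear_\<omega>1])

lemma \<omega>_proj2: "\<omega> p v (Levi_proj \<theta> T p w) = \<omega> p v w"
  by (simp add: Levi_proj_def linear_diff[OF linear_\<omega>2] linear_cmul[OF linear_\<omega>2])

text \<open>For \<open>Z = a + \<i>b\<close> and \<open>W = c + \<i>d\<close> in the CR structure, the real parts of the torsion identities for
  \<open>(Z, W)\<close> and \<open>(Z, cnj W)\<close> are solved for the torsion of \<open>a = Re Z\<close> and \<open>c = Re W\<close>.\<close>

lemma torsion_Re: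
  assumes Z: "Z \<in> T10 p" and W: "W \<in> T10 p"
  shows "torsion A D p (Re_vec Z) (Re_vec W) = (2 * \<omega> p (Re_vec Z) (Re_vec W)) *\<^sub>R T p"
    and "\<omega> p (Im_vec Z) (Im_vec W) = \<omega> p (Re_vec Z) (Re_vec W)"
proof -
  let ?t = "torsion A D p"
  let ?a = "Re_vec Z" and ?b = "Im_vec Z" and ?c = "Re_vec W" and ?d = "Im_vec W"
  have Re_ct: "Re_vec (ctorsion A D p X Y) = ?t (Re_vec X) (Re_vec Y) - ?t (Im_vec X) (Im_vec Y)" for X Y
    by (simp add: vec_eq_iff ctorsion_def cbilin_def Re_vec_def)
  have 1: "?t ?a ?c - ?t ?b ?d = 0"
    using Re_ct[of Z W] ctorsion_T10(1)[OF Z W] by (simp add: Re_vec_simps)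
  have "Re_vec (ctorsion A D p Z (cnj_vec W)) = (2 * (\<omega> p ?a ?c + \<omega> p ?b ?d)) *\<^sub>R T p"
    unfolding ctorsion_T10(2)[OF Z W]
    by (simp add: Re_vec_simps cext_deriv_def cbilin_def linear_neg[OF linear_\<omega>2])
  then have 2: "?t ?a ?c + ?t ?b ?d = (2 * (\<omega> p ?a ?c + \<omega> p ?b ?d)) *\<^sub>R T p"
    using Re_ct[of Z "cnj_vec W"] by (simp add: Re_vec_simps linear_neg[OF linear_torsion2])
  have 3: "2 *\<^sub>R ?t ?a ?c = (2 * (\<omega> p ?a ?c + \<omega> p ?b ?d)) *\<^sub>R T p"
    using 1 2 by (simp add: scaleR_2)
  then have t: "?t ?a ?c = (\<omega> p ?a ?c + \<omega> p ?b ?d) *\<^sub>R T p"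
    by (metis scaleR_cancel_left scaleR_scaleR zero_neq_numeral)
  have "2 * \<omega> p ?a ?c = \<theta> p (?t ?a ?c)" by (simp add: \<omega>_torsion)
  also have "\<dots> = \<omega> p ?a ?c + \<omega> p ?b ?d" unfolding t by (simp add: linear_cmul[OF linear_\<theta>])
  finally show eq: "\<omega> p ?b ?d = \<omega> p ?a ?c" by simp
  show "?t ?a ?c = (2 * \<omega> p ?a ?c) *\<^sub>R T p" using t eq by simp
qed

lemma torsion_H: "v \<in> H p \<Longrightarrow> w \<in> H p \<Longrightarrow> torsion A D p v w = (2 * \<omega> p v w) *\<^sub>R T p"
  unfolding H_Re using torsion_Re(1) by blast

text \<open>Says that \<open>d\<theta>\<close> is of type \<open>(1, 1)\<close>; symmetry of the
  Webster metric is a consequence.\<close>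

lemma \<omega>_J_J: "\<omega> p (J p v) (J p w) = \<omega> p v w"
proof -
  obtain Z W where Z: "Z \<in> T10 p" "Levi_proj \<theta> T p v = Re_vec Z" and W: "W \<in> T10 p" "Levi_proj \<theta> T p w = Re_vec W"
    using proj_in_H H_Re by metis
  have "\<omega> p (J p (Levi_proj \<theta> T p v)) (J p (Levi_proj \<theta> T p w)) = \<omega> p (Levi_proj \<theta> T p v) (Levi_proj \<theta> T p w)"
    using torsion_Re(2)[OF Z(1) W(1)] Z W
    by (simp add: J_Re linear_neg[OF linear_\<omega>1] linear_neg[OF linear_\<omega>2])
  then show ?thesis by (simp add: J_proj \<omega>_proj1 \<omega>_proj2)
qed

lemma g_eq: "g p v w = \<omega> p v (J p w) + \<theta> p v * \<theta> p w"
  using \<omega>_proj1 by (simp add: Webster_metric_def G_form_def J_ext_def)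

lemma g_sym: "g p v w = g p w v"
proof -
  have "\<omega> p v (J p w) = \<omega> p (J p v) (J p (J p w))" by (simp add: \<omega>_J_J)
  also have "\<dots> = \<omega> p w (J p v)"
    by (simp add: J_J linear_neg[OF linear_\<omega>2] \<omega>_proj2 \<omega>_antisym[of p "J p v" w])
  finally show ?thesis by (simp add: g_eq)
qed

lemma linear_g1: "linear (\<lambda>v. g p v w)"
  by (rule linearI)
    (simp_all add: g_eq linear_add[OF linear_\<omega>1] linear_cmul[OF linear_\<omega>1] linear_add[OF linear_\<theta>]
      linear_cmul[OF linear_\<theta>] algebra_simps)

lemma linear_g2: "linear (\<lambda>w. g p v w)"
  using linear_g1[of p v] by (simp add: g_sym[of p v])

lemma G_eq_g: "v \<in> H p \<Longrightarrow> w \<in> H p \<Longrightarrow> G_form A T10 \<theta> p v w = g p v w"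
  by (simp add: Webster_metric_def proj_H) (simp add: H_iff)

lemma g_T: "g p v (T p) = \<theta> p v"
  by (simp add: g_eq linear_0[OF linear_\<omega>2])

lemma g_pos: assumes "v \<noteq> 0" shows "g p v v > 0"
proof (cases "Levi_proj \<theta> T p v = 0")
  case True
  then have v: "v = \<theta> p v *\<^sub>R T p" by (simp add: Levi_proj_def)
  then have "\<theta> p v \<noteq> 0" using assms by auto
  moreover have "g p v v = \<theta> p v * \<theta> p v"
    using v by (metis g_T linear_cmul[OF linear_g2] real_scaleR_def)
  ultimately show ?thesis using not_real_square_gt_zero by metis
next
  case False
  have "G_form A T10 \<theta> p (Levi_proj \<theta> T p v) (Levi_proj \<theta> T p v) > 0"
    using strictly_pseudoconvex proj_in_H False by (simp add: positive_definite_on_def)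
  then show ?thesis by (simp add: Webster_metric_def add_pos_nonneg)
qed

lemma \<tau>_in_H: "\<tau> p v \<in> H p"
  using \<omega>_torsion[of p "T p" v] by (simp add: H_iff pseudohermitian_torsion_def)

lemma linear_\<tau>: "linear (\<tau> p)"
  using linear_torsion2[of p "T p"] by (simp add: pseudohermitian_torsion_def[abs_def])

lemma \<tau>_T: "\<tau> p (T p) = 0"
  by (simp add: pseudohermitian_torsion_def torsion_chart_at)

section \<open>Local real frames and smoothness of \<open>J\<close>\<close>

text \<open>The condition that real and imaginary parts lie in a real subspace is stable under
  complex combinations, so it passes from a frame to all of \<open>T10\<close>, hence to
  \<open>H\<close>; \<open>T\<close> supplies the rest. Spanning is thereby obtained without a
  dimension count.\<close>

lemma H_spanned:
  assumes T10: "T10 q = vec.span (Z ` {..<n})" and R: "subspace R"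
    and ReZ: "\<And>j. j < n \<Longrightarrow> Re_vec (Z j) \<in> R" and ImZ: "\<And>j. j < n \<Longrightarrow> Im_vec (Z j) \<in> R" and TR: "T q \<in> R"
  shows "v \<in> R"
proof -
  have "Re_vec W \<in> R \<and> Im_vec W \<in> R" if "W \<in> T10 q" for W
    using that unfolding T10
  proof (induction rule: vec.span_induct)
    case base
    show ?case
      using R by (auto simp: vec.subspace_def Re_vec_simps subspace_0 subspace_add subspace_diff subspace_scale)
  next
    case (step W)
    then show ?case using ReZ ImZ by auto
  qed
  then have "w \<in> R" if "w \<in> H q" for w using that unfolding H_Re by blast
  then have "Levi_proj \<theta> T q v + \<theta> q v *\<^sub>R T q \<in> R"
    using proj_in_H TR R by (intro subspace_add subspace_scale) auto
  then show ?thesis by (simp add: Levi_proj_def)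
qed

text \<open>For a complex frame \<open>Z_j\<close> of \<open>T10\<close>, the fields
  \<open>Re Z_j\<close>, \<open>Im Z_j\<close>, \<open>T\<close> span, and \<open>J\<close> sends
  them to \<open>- Im Z_j\<close>, \<open>Re Z_j\<close>, \<open>0\<close>, which are smooth as
  well. Indexing by \<open>'d\<close> itself makes the system for the coefficients square, so that
  spanning implies uniqueness.\<close>

lemma local_J_frame:
  obtains U F E where "open U" "p \<in> U" "\<And>i::'d. smooth_vf A U (F i)" "\<And>i. smooth_vf A U (E i)"
    "\<And>i q. q \<in> U \<Longrightarrow> J q (F i q) = E i q"
    "\<And>q v. q \<in> U \<Longrightarrow> \<exists>\<beta> :: real ^ 'd. v = (\<Sum>i\<in>UNIV. (\<beta> $ i) *\<^sub>R F i q)"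
proof -
  have "\<exists>U Z. open U \<and> p \<in> U \<and> (\<forall>j<n. smooth_cvf A U (Z j)) \<and> (\<forall>q\<in>U. T10 q = vec.span ((\<lambda>j. Z j q) ` {..<n}))"
    using CR[unfolded CR_structure_def, THEN conjunct2, THEN conjunct1] by simp
  then obtain U Z where U: "open U" "p \<in> U" and Z: "\<And>j. j < n \<Longrightarrow> smooth_cvf A U (Z j)"
    and span: "\<And>q. q \<in> U \<Longrightarrow> T10 q = vec.span ((\<lambda>j. Z j q) ` {..<n})" by blast
  \<comment> \<open>\<open>h\<close> numbers the coordinates: values below \<open>n\<close> stand
    for real parts, the next \<open>n\<close> for imaginary parts, and \<open>2 * n\<close> for
    \<open>T\<close>.\<close>
  obtain h :: "'d \<Rightarrow> nat" where h: "bij_betw h UNIV {0..<2 * n + 1}"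
    using ex_bij_betw_finite_nat[of "UNIV :: 'd set"] dim by auto
  have ZT: "Z j q \<in> T10 q" if "j < n" "q \<in> U" for j q
    using that span by (auto intro!: vec.span_base)
  define F where "F i q = (if h i < n then Re_vec (Z (h i) q) else if h i < 2 * n then Im_vec (Z (h i - n) q) else T q)" for i q
  \<comment> \<open>The sign and the zero field are written as scalings so that
    \<open>smooth_vf_scale\<close> applies.\<close>
  define E where "E i q = (if h i < n then (- 1) *\<^sub>R Im_vec (Z (h i) q) else if h i < 2 * n then Re_vec (Z (h i - n) q) else 0 *\<^sub>R T q)" for i q
  have TU: "smooth_vf A U T" by (rule smooth_vf_subset[OF smooth_T]) auto
  show ?thesis
  proof (rule that[OF U])
    show "smooth_vf A U (F i)" for i
      using Z[of "h i"] Z[of "h i - n"] TU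
      by (cases "h i < n"; cases "h i < 2 * n") (auto simp: F_def[abs_def] smooth_cvf_def)
    show "smooth_vf A U (E i)" for i
    proof -
      have "smooth_vf A U (\<lambda>q. (- 1) *\<^sub>R Im_vec (Z (h i) q))" if "h i < n"
        using Z[OF that] by (intro smooth_vf_scale[OF U(1) smooth_fun_const]) (simp add: smooth_cvf_def)
      moreover have "smooth_vf A U (\<lambda>q. Re_vec (Z (h i - n) q))" if "\<not> h i < n" "h i < 2 * n"
        using Z[of "h i - n"] that by (simp add: smooth_cvf_def)
      moreover have "smooth_vf A U (\<lambda>q. 0 *\<^sub>R T q)" by (rule smooth_vf_scale[OF U(1) smooth_fun_const TU])
      ultimately show ?thesis unfolding E_def[abs_def] by (cases "h i < n"; cases "h i < 2 * n") simp_all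
    qed
    show "J q (F i q) = E i q" if q: "q \<in> U" for i q
      using ZT[of "h i" q] ZT[of "h i - n" q] q by (auto simp: F_def E_def J_Re J_Im)
    fix q v assume q: "q \<in> U"
    let ?S = "\<lambda>\<beta> :: real ^ 'd. \<Sum>i\<in>UNIV. (\<beta> $ i) *\<^sub>R F i q"
    have lin: "linear ?S"
      by (rule linearI) (simp_all add: scaleR_add_left sum.distrib scaleR_sum_right)
    have FR: "F i q \<in> range ?S" for i
    proof -
      have "?S (axis i 1) = (\<Sum>j\<in>UNIV. if j = i then F j q else 0)"
        by (rule sum.cong) (auto simp: axis_def)
      also have "\<dots> = F i q" by simp
      finally have "?S (axis i 1) = F i q" .
      then show ?thesis by (intro image_eqI[where f="?S" and x="axis i 1"] UNIV_I) (rule sym)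
    qed
    have hex: "\<exists>i. h i = k" if "k < 2 * n + 1" for k
      using h that by (metis atLeastLessThan_iff bij_betw_imp_surj_on imageE zero_le)
    have "v \<in> range ?S"
    proof (rule H_spanned[OF span[OF q]])
      show "subspace (range ?S)" by (rule linear_subspace_image[OF lin subspace_UNIV])
      show "Re_vec (Z j q) \<in> range ?S" if j: "j < n" for j
      proof -
        obtain i where i: "h i = j" using hex[of j] j by auto
        show ?thesis using FR[of i] j by (simp only: F_def i if_True)
      qed
      show "Im_vec (Z j q) \<in> range ?S" if j: "j < n" for j
      proof -
        obtain i where i: "h i = n + j" using hex[of "n + j"] j by auto
        have "F i q = Im_vec (Z j q)" using j by (simp add: F_def i)
        then show ?thesis using FR[of i] by (simp only:)
      qed
      show "T q \<in> range ?S"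
      proof -
        obtain i where i: "h i = 2 * n" using hex[of "2 * n"] by auto
        have "F i q = T q" by (simp add: F_def i)
        then show ?thesis using FR[of i] by (simp only:)
      qed
    qed
    then show "\<exists>\<beta>. v = ?S \<beta>" by blast
  qed
qed

definition J_rep :: "('m, 'd) chart \<Rightarrow> real ^ 'd \<Rightarrow> real ^ 'd \<Rightarrow> real ^ 'd" where
  "J_rep c x b = comps A c (pt c x) (J (pt c x) (const_vf A c b (pt c x)))"

lemma J_rep_comps: "c \<in> A \<Longrightarrow> p \<in> fst c \<Longrightarrow> J_rep c (snd c p) (comps A c p v) = comps A c p (J p v)"
  by (simp add: J_rep_def)

text \<open>A constant vector of the chart is expanded in the local frame with smooth coefficients,
  and \<open>J\<close> is applied to the frame members, where its values are explicit.\<close>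

lemma smooth_J_rep: assumes c: "c \<in> A" shows "smooth_on (snd c ` fst c) (\<lambda>x. J_rep c x b)"
proof (rule smooth_on_locally)
  fix x0 assume "x0 \<in> snd c ` fst c"
  then obtain p where p: "p \<in> fst c" "x0 = snd c p" by auto
  obtain U F E where U: "open U" "p \<in> U" and F: "\<And>i::'d. smooth_vf A U (F i)" and E: "\<And>i. smooth_vf A U (E i)"
    and JF: "\<And>i q. q \<in> U \<Longrightarrow> J q (F i q) = E i q"
    and span: "\<And>q v. q \<in> U \<Longrightarrow> \<exists>\<beta> :: real ^ 'd. v = (\<Sum>i\<in>UNIV. (\<beta> $ i) *\<^sub>R F i q)"
    by (rule local_J_frame[of p]) (rule that)
  define W where "W = U \<inter> fst c"
  have W: "open W" "W \<subseteq> fst c" "W \<subseteq> U" "p \<in> W" using U p open_dom[OF c] by (auto simp: W_def)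
  let ?S = "snd c ` W"
  have S: "open ?S" by (rule open_image'[OF c W(1,2)])
  have FW: "smooth_on ?S (vf_rep A c (F i))" and EW: "smooth_on ?S (vf_rep A c (E i))" for i
    using smooth_vfD[OF smooth_vf_subset[OF F W(3)] c W(2)] smooth_vfD[OF smooth_vf_subset[OF E W(3)] c W(2)] by auto
  define L where "L x \<beta> = (\<Sum>i\<in>UNIV. (\<beta> $ i) *\<^sub>R vf_rep A c (F i) x)" for x and \<beta> :: "real ^ 'd"
  have linL: "linear (L x)" for x
    by (rule linearI) (simp_all add: L_def scaleR_add_left sum.distrib scaleR_sum_right)
  have LW: "L (snd c q) \<beta> = comps A c q (\<Sum>i\<in>UNIV. (\<beta> $ i) *\<^sub>R F i q)" if "q \<in> W" for q \<beta>
    using that W(2) c by (auto simp: L_def linear_sum[OF linear_comps[OF c]] linear_cmul[OF linear_comps[OF c]])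
  have surjL: "surj (L x)" if "x \<in> ?S" for x
  proof -
    obtain q where q: "q \<in> W" "x = snd c q" using \<open>x \<in> ?S\<close> by auto
    have "\<exists>\<beta>. v = L x \<beta>" for v
    proof -
      obtain \<beta> :: "real ^ 'd" where "const_vf A c v q = (\<Sum>i\<in>UNIV. (\<beta> $ i) *\<^sub>R F i q)" using span[of q] q W by blast
      then have "comps A c q (const_vf A c v q) = L x \<beta>" using LW[OF q(1)] q by simp
      then show ?thesis using c q W(2) by (auto simp: subset_iff)
    qed
    then show ?thesis unfolding surj_def by blast
  qed
  \<comment> \<open>The coefficients are chosen point by point; they are smooth nevertheless,
    because they solve a square, surjective and hence injective system.\<close>
  define s where "s x = (SOME \<beta>. L x \<beta> = b)" for x
  have s: "L x (s x) = b" if "x \<in> ?S" for x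
    unfolding s_def using surjL[OF that] by (intro someI_ex[of "\<lambda>\<beta>. L x \<beta> = b"]) (metis surj_def)
  have "smooth_on ?S s"
  proof (rule smooth_on_linear_equation[OF S linL _ _ smooth_on_const s])
    show "smooth_on ?S (\<lambda>x. L x \<beta>)" for \<beta>
      unfolding L_def by (intro smooth_on_sum[OF S] smooth_on_scaleR[OF S smooth_on_const FW])
    show "inj (L x)" if "x \<in> ?S" for x by (rule linear_surjective_imp_injective[OF linL surjL[OF that]]) simp
  qed
  then have si: "smooth_on ?S (\<lambda>x. s x $ i)" for i using smooth_on_vec[OF S] by blast
  have "smooth_on ?S (\<lambda>x. \<Sum>i\<in>UNIV. (s x $ i) *\<^sub>R vf_rep A c (E i) x)"
    by (intro smooth_on_sum[OF S] smooth_on_scaleR[OF S si EW])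
  then have "smooth_on ?S (\<lambda>x. J_rep c x b)"
  proof (rule smooth_on_cong[OF S, rotated])
    fix x assume x: "x \<in> ?S"
    then obtain q where q: "q \<in> W" "x = snd c q" by auto
    have qc: "q \<in> fst c" and qU: "q \<in> U" using q W by auto
    let ?v = "\<Sum>i\<in>UNIV. (s x $ i) *\<^sub>R F i q"
    have "comps A c q ?v = b" using LW[OF q(1), of "s x"] s[OF x] q by simp
    then have "J_rep c x b = comps A c q (J q ?v)" using J_rep_comps[OF c qc, of ?v] q by simp
    also have "J q ?v = (\<Sum>i\<in>UNIV. (s x $ i) *\<^sub>R E i q)"
      using JF[OF qU] by (simp add: linear_sum[OF linear_J] linear_cmul[OF linear_J])
    finally show "(\<Sum>i\<in>UNIV. (s x $ i) *\<^sub>R vf_rep A c (E i) x) = J_rep c x b"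
      using c qc q by (simp add: linear_sum[OF linear_comps] linear_cmul[OF linear_comps])
  qed
  then show "\<exists>V. open V \<and> x0 \<in> V \<and> smooth_on V (\<lambda>x. J_rep c x b)" using S W(4) p(2) by blast
qed

text \<open>\<open>D_chart\<close> can be applied to the image of a constant field under
  \<open>J\<close> only now that this image is known to be smooth.\<close>

lemma J_rep_has_derivative:
  assumes c: "c \<in> A" and x: "x \<in> snd c ` fst c"
  shows "((\<lambda>x. J_rep c x b) has_derivative (\<lambda>a. J_rep c x (\<Gamma> c x a b) - \<Gamma> c x a (J_rep c x b))) (at x)"
proof -
  obtain p where p: "p \<in> fst c" "x = snd c p" using x by auto
  let ?Y = "\<lambda>q. J q (const_vf A c b q)"
  have rep: "vf_rep A c ?Y = (\<lambda>x. J_rep c x b)" by (simp add: fun_eq_iff vf_rep_def J_rep_def Let_def)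
  have Y: "smooth_vf A (fst c) ?Y"
    by (rule smooth_vfI[OF c open_dom[OF c] order_refl]) (unfold rep, rule smooth_J_rep[OF c])
  have "frechet_derivative (\<lambda>x. J_rep c x b) (at x) a + \<Gamma> c x a (J_rep c x b) = J_rep c x (\<Gamma> c x a b)" for a
    using D_chart[OF c open_dom[OF c] order_refl p(1) Y, of "const_vf A c a p"]
      D_J[OF open_dom[OF c] p(1) smooth_vf_const_vf[OF c], of "const_vf A c a p" b] c p
    by (simp add: rep Gamma_snd J_rep_comps[symmetric])
  then have "frechet_derivative (\<lambda>x. J_rep c x b) (at x) = (\<lambda>a. J_rep c x (\<Gamma> c x a b) - \<Gamma> c x a (J_rep c x b))"
    by (simp add: fun_eq_iff eq_diff_eq)
  with smooth_on_has_derivative[OF smooth_J_rep[OF c] x, of b] show ?thesis by (simp only:)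
qed

section \<open>The Webster metric and \<open>d\<theta>\<close> in charts\<close>

definition \<omega>_rep :: "('m, 'd) chart \<Rightarrow> real ^ 'd \<Rightarrow> real ^ 'd \<Rightarrow> real ^ 'd \<Rightarrow> real" where
  "\<omega>_rep c x a b = \<omega> (pt c x) (const_vf A c a (pt c x)) (const_vf A c b (pt c x))"

definition g_rep :: "('m, 'd) chart \<Rightarrow> real ^ 'd \<Rightarrow> real ^ 'd \<Rightarrow> real ^ 'd \<Rightarrow> real" where
  "g_rep c x a b = g (pt c x) (const_vf A c a (pt c x)) (const_vf A c b (pt c x))"

lemma \<omega>_rep_comps: "c \<in> A \<Longrightarrow> p \<in> fst c \<Longrightarrow> \<omega>_rep c (snd c p) (comps A c p v) (comps A c p w) = \<omega> p v w"
  by (simp add: \<omega>_rep_def)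

lemma g_rep_comps: "c \<in> A \<Longrightarrow> p \<in> fst c \<Longrightarrow> g_rep c (snd c p) (comps A c p v) (comps A c p w) = g p v w"
  by (simp add: g_rep_def)

lemma g_rep_sym: "g_rep c x a b = g_rep c x b a"
  by (simp add: g_rep_def g_sym)

lemma linear_g_rep1: "c \<in> A \<Longrightarrow> x \<in> snd c ` fst c \<Longrightarrow> linear (\<lambda>a. g_rep c x a b)"
  using linear_compose[OF linear_const_vf[OF _ pt_in] linear_g1, of c x "pt c x" "const_vf A c b (pt c x)"]
  by (simp add: g_rep_def[abs_def] o_def)

lemma linear_g_rep2: "c \<in> A \<Longrightarrow> x \<in> snd c ` fst c \<Longrightarrow> linear (\<lambda>b. g_rep c x a b)"
  using linear_g_rep1[of c x a] by (simp add: g_rep_sym[of c x a])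

lemma g_rep_pos: "c \<in> A \<Longrightarrow> x \<in> snd c ` fst c \<Longrightarrow> a \<noteq> 0 \<Longrightarrow> g_rep c x a a > 0"
  unfolding g_rep_def
proof (rule g_pos)
  assume c: "c \<in> A" and x: "x \<in> snd c ` fst c" and a: "a \<noteq> 0"
  show "const_vf A c a (pt c x) \<noteq> 0"
  proof
    assume "const_vf A c a (pt c x) = 0"
    then have "a = comps A c (pt c x) 0" using comps_const_vf[OF c pt_in[OF x], of a] by simp
    then show False using a linear_0[OF linear_comps[OF c pt_in[OF x]]] by simp
  qed
qed

lemma \<omega>_rep_eq:
  assumes c: "c \<in> A" and x: "x \<in> snd c ` fst c"
  shows "\<omega>_rep c x a b = (\<theta>_rep c x (\<Gamma> c x a b) - \<theta>_rep c x (\<Gamma> c x b a)) / 2"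
proof -
  obtain p where p: "p \<in> fst c" "x = snd c p" using x by auto
  have "\<omega>_rep c x a b = \<theta> p (torsion A D p (const_vf A c a p) (const_vf A c b p)) / 2"
    using c p by (simp add: \<omega>_rep_def \<omega>_torsion)
  then show ?thesis
    using c p linear_diff[OF linear_\<theta>_rep[OF c x]] by (simp add: \<theta>_rep_comps[symmetric] torsion_chart)
qed

lemma g_rep_eq:
  assumes c: "c \<in> A" and x: "x \<in> snd c ` fst c"
  shows "g_rep c x a b = \<omega>_rep c x a (J_rep c x b) + \<theta>_rep c x a * \<theta>_rep c x b"
  using pt_in[OF x] c by (simp add: g_rep_def \<omega>_rep_def J_rep_def \<theta>_rep_def g_eq)

text \<open>Inverts the definition of the metric by means of \<open>J J = - 1\<close> on
  \<open>H\<close>, so that \<open>d\<theta>\<close> is expressed by the two tensors that the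
  connection preserves by definition.\<close>

lemma \<omega>_rep_eq_g_rep:
  assumes c: "c \<in> A" and x: "x \<in> snd c ` fst c"
  shows "\<omega>_rep c x a b = - g_rep c x a (J_rep c x b)"
proof -
  have "\<omega> p v w = - g p v (J p w)" for p v w
    using J_in_H[of p w] by (simp add: g_eq J_J linear_neg[OF linear_\<omega>2] \<omega>_proj2 H_iff)
  then show ?thesis using pt_in[OF x] c by (simp add: g_rep_def \<omega>_rep_def J_rep_def)
qed

text \<open>Replacing \<open>\<omega>\<close> by half of \<open>\<theta>\<close> of the
  antisymmetrised \<open>\<Gamma>\<close> leaves an expression in \<open>\<theta>\<close>,
  \<open>\<Gamma>\<close> and \<open>J\<close>, all of which are known to be smooth.\<close>

lemma smooth_g_rep: assumes c: "c \<in> A" shows "smooth_on (snd c ` fst c) (\<lambda>x. g_rep c x a b)"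
proof -
  let ?S = "snd c ` fst c"
  note S = open_range[OF c]
  have 1: "smooth_on ?S (\<lambda>x. \<Gamma> c x a (J_rep c x b))"
    by (rule smooth_on_apply_linear[OF S linear_Gamma2[OF c] smooth_Gamma[OF c] smooth_J_rep[OF c]])
  have 2: "smooth_on ?S (\<lambda>x. \<Gamma> c x (J_rep c x b) a)"
    by (rule smooth_on_apply_linear[OF S linear_Gamma1[OF c] smooth_Gamma[OF c] smooth_J_rep[OF c]])
  have 3: "smooth_on ?S (\<lambda>x. \<theta>_rep c x (\<Gamma> c x a (J_rep c x b)) - \<theta>_rep c x (\<Gamma> c x (J_rep c x b) a))"
    by (intro smooth_on_diff[OF S]
        smooth_on_apply_linear[OF S linear_\<theta>_rep[OF c] smooth_\<theta>_rep[OF c] 1]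
        smooth_on_apply_linear[OF S linear_\<theta>_rep[OF c] smooth_\<theta>_rep[OF c] 2])
  have "smooth_on ?S (\<lambda>x. (1/2) *\<^sub>R (\<theta>_rep c x (\<Gamma> c x a (J_rep c x b)) - \<theta>_rep c x (\<Gamma> c x (J_rep c x b) a)) + \<theta>_rep c x a * \<theta>_rep c x b)"
    by (rule smooth_on_add[OF S smooth_on_scaleR[OF S smooth_on_const 3] smooth_on_mult[OF S smooth_\<theta>_rep[OF c] smooth_\<theta>_rep[OF c]]])
  then show ?thesis
    by (rule smooth_on_cong[OF S, rotated]) (simp add: g_rep_eq[OF c] \<omega>_rep_eq[OF c])
qed

lemma g_rep_has_derivative:
  assumes c: "c \<in> A" and x: "x \<in> snd c ` fst c"
  shows "((\<lambda>x. g_rep c x b b') has_derivative (\<lambda>a. g_rep c x (\<Gamma> c x a b) b' + g_rep c x b (\<Gamma> c x a b'))) (at x)"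
proof -
  obtain p where p: "p \<in> fst c" "x = snd c p" using x by auto
  let ?F = "frechet_derivative (\<lambda>x. g_rep c x b b') (at x)"
  let ?f = "\<lambda>q. g q (const_vf A c b q) (const_vf A c b' q)"
  have d: "((\<lambda>x. g_rep c x b b') has_derivative ?F) (at x)" by (rule smooth_on_has_derivative[OF smooth_g_rep[OF c] x])
  have "?F a = g_rep c x (\<Gamma> c x a b) b' + g_rep c x b (\<Gamma> c x a b')" for a
  proof -
    have "?f \<circ> pt c = (\<lambda>x. g_rep c x b b')" by (simp add: fun_eq_iff g_rep_def)
    then have "dir_deriv A p (const_vf A c a p) ?f = ?F a"
      using dir_deriv_chart[OF c p(1), of ?f ?F] d c p by simp
    moreover have "g_rep c x (\<Gamma> c x a b) b' = g p (D p (const_vf A c a p) (const_vf A c b)) (const_vf A c b' p)"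
      "g_rep c x b (\<Gamma> c x a b') = g p (const_vf A c b p) (D p (const_vf A c a p) (const_vf A c b'))"
      using c p by (simp_all add: g_rep_comps[symmetric] Gamma_snd)
    ultimately show ?thesis
      using D_g[OF open_dom[OF c] p(1) smooth_vf_const_vf[OF c] smooth_vf_const_vf[OF c], of "const_vf A c a p" b b'] by simp
  qed
  then have "?F = (\<lambda>a. g_rep c x (\<Gamma> c x a b) b' + g_rep c x b (\<Gamma> c x a b'))" by blast
  with d show ?thesis by (simp only:)
qed

lemma g_rep_apply_has_derivative:
  assumes c: "c \<in> A" and x: "x \<in> snd c ` fst c" and y: "(y has_derivative y') (at x)"
  shows "((\<lambda>x. g_rep c x b (y x)) has_derivative
     (\<lambda>a. g_rep c x (\<Gamma> c x a b) (y x) + g_rep c x b (\<Gamma> c x a (y x)) + g_rep c x b (y' a))) (at x)"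
  using has_derivative_apply_linear[of "snd c ` fst c" "\<lambda>x. x" x "\<lambda>x. g_rep c x b", OF open_range[OF c] x linear_g_rep2[OF c]
      g_rep_has_derivative[OF c x] has_derivative_ident y]
  by simp

text \<open>Parallelism of \<open>d\<theta>\<close>: both ingredients of
  \<open>- g(\<cdot>, J \<cdot>)\<close> are parallel, and the terms in which
  \<open>\<Gamma>\<close> acts on \<open>J b'\<close> cancel.\<close>

lemma \<omega>_rep_has_derivative:
  assumes c: "c \<in> A" and x: "x \<in> snd c ` fst c"
  shows "((\<lambda>x. \<omega>_rep c x b b') has_derivative (\<lambda>a. \<omega>_rep c x (\<Gamma> c x a b) b' + \<omega>_rep c x b (\<Gamma> c x a b'))) (at x)"
proof -
  have "((\<lambda>x. - g_rep c x b (J_rep c x b')) has_derivative (\<lambda>a. - (g_rep c x (\<Gamma> c x a b) (J_rep c x b') +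
      g_rep c x b (\<Gamma> c x a (J_rep c x b')) + g_rep c x b (J_rep c x (\<Gamma> c x a b') - \<Gamma> c x a (J_rep c x b'))))) (at x)"
    by (intro has_derivative_minus g_rep_apply_has_derivative[OF c x J_rep_has_derivative[OF c x]])
  moreover have "(\<lambda>a. - (g_rep c x (\<Gamma> c x a b) (J_rep c x b') + g_rep c x b (\<Gamma> c x a (J_rep c x b'))
      + g_rep c x b (J_rep c x (\<Gamma> c x a b') - \<Gamma> c x a (J_rep c x b')))) =
    (\<lambda>a. \<omega>_rep c x (\<Gamma> c x a b) b' + \<omega>_rep c x b (\<Gamma> c x a b'))"
    by (simp add: fun_eq_iff \<omega>_rep_eq_g_rep[OF c x] linear_diff[OF linear_g_rep2[OF c x]])
  ultimately have "((\<lambda>x. - g_rep c x b (J_rep c x b')) has_derivative (\<lambda>a. \<omega>_rep c x (\<Gamma> c x a b) b' + \<omega>_rep c x b (\<Gamma> c x a b'))) (at x)"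
    by simp
  then show ?thesis
    by (rule has_derivative_transform_within_open[OF _ open_range[OF c] x]) (simp add: \<omega>_rep_eq_g_rep[OF c])
qed

text \<open>The cyclic identity \<open>d(d\<theta>) = 0\<close>, rewritten through the parallelism of \<open>d\<theta>\<close>.\<close>

lemma \<omega>_torsion_cyclic:
  "\<omega> p (torsion A D p u v) w + \<omega> p (torsion A D p v w) u + \<omega> p (torsion A D p w u) v = 0"
proof -
  let ?c = "chart_at A p"
  let ?x = "snd ?c p" and ?S = "snd ?c ` fst ?c"
  note c = chart_at(1)[of p]
  have x: "?x \<in> ?S" using chart_at by blast
  let ?G = "\<Gamma> ?c ?x"
  let ?t = "\<lambda>b y. \<theta>_rep ?c y b"
  have Dth: "frechet_derivative (?t b) (at y) a = \<theta>_rep ?c y (\<Gamma> ?c y a b)" if "y \<in> ?S" for y a b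
    using frechet_derivative_at[OF \<theta>_rep_has_derivative[OF c that], of b] by metis
  define DD where "DD a b h = frechet_derivative (\<lambda>y. frechet_derivative (?t b) (at y) a) (at ?x) h" for a b h
  have DD: "((\<lambda>y. frechet_derivative (?t b) (at y) a) has_derivative DD a b) (at ?x)" for a b
    unfolding DD_def by (rule smooth_on_has_derivative[OF smooth_on_frechet_derivative[OF smooth_\<theta>_rep[OF c]] x])
  have DD_sym: "DD a b h = DD h b a" for a b h
    unfolding DD_def by (rule frechet_derivative_commute_real[OF smooth_on_CkD[OF smooth_\<theta>_rep[OF c]] open_range[OF c] x])
  \<comment> \<open>The derivative of \<open>d\<theta>(a, b)\<close> along \<open>h\<close> in two
    ways: from parallelism, and as second derivatives of the components of \<open>\<theta>\<close>.
    Symmetry of the latter is what makes \<open>d(d\<theta>)\<close> vanish.\<close>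
  have om: "\<omega>_rep ?c ?x (?G h a) b + \<omega>_rep ?c ?x a (?G h b) = (DD a b h - DD b a h) / 2" for h a b
  proof -
    have "((\<lambda>y. (1/2) *\<^sub>R (frechet_derivative (?t b) (at y) a - frechet_derivative (?t a) (at y) b)) has_derivative
        (\<lambda>h. (1/2) *\<^sub>R (DD a b h - DD b a h))) (at ?x)"
      by (intro has_derivative_scaleR_right has_derivative_diff DD)
    then have "((\<lambda>y. \<omega>_rep ?c y a b) has_derivative (\<lambda>h. (1/2) *\<^sub>R (DD a b h - DD b a h))) (at ?x)"
      by (rule has_derivative_transform_within_open[OF _ open_range[OF c] x]) (simp add: \<omega>_rep_eq[OF c] Dth)
    from has_derivative_unique[OF \<omega>_rep_has_derivative[OF c x] this] show ?thesis by (simp add: fun_eq_iff)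
  qed
  have om': "\<omega> p (?G h a) b + \<omega> p a (?G h b) = (DD a b h - DD b a h) / 2" for h a b
    using om[of h a b] \<omega>_rep_comps[OF chart_at] by simp
  have "\<omega> p (?G u v) w + \<omega> p v (?G u w) + (\<omega> p (?G v w) u + \<omega> p w (?G v u)) + (\<omega> p (?G w u) v + \<omega> p u (?G w v)) = 0"
    unfolding om' using DD_sym[of v w u] DD_sym[of w v u] DD_sym[of w u v] by (simp add: diff_divide_distrib)
  then show ?thesis
    using \<omega>_antisym[of p v "?G u w"] \<omega>_antisym[of p w "?G v u"] \<omega>_antisym[of p u "?G w v"]
    by (simp add: torsion_chart_at linear_diff[OF linear_\<omega>1])
qed

text \<open>With \<open>T\<close> in one slot of the cyclic identity, the term having
  \<open>T\<close> as an argument of \<open>\<omega>\<close> drops out and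
  \<open>\<omega>(\<tau> a, b) = \<omega>(\<tau> b, a)\<close> remains. Passing to \<open>g\<close>
  inserts a \<open>J\<close>, which anticommutes with \<open>\<tau>\<close>.\<close>

lemma \<tau>_symmetric: "g p (\<tau> p v) w = g p v (\<tau> p w)"
proof -
  have *: "\<omega> p (\<tau> p a) b = \<omega> p (\<tau> p b) a" for a b
    using \<omega>_torsion_cyclic[of p "T p" a b] torsion_antisym[of p b "T p"]
    by (simp add: pseudohermitian_torsion_def linear_neg[OF linear_\<omega>1])
  have "g p (\<tau> p v) w = \<omega> p (\<tau> p v) (J p w)" using \<tau>_in_H[of p v] by (simp add: g_eq H_iff)
  also have "\<dots> = \<omega> p v (J p (\<tau> p w))"
    by (simp add: *[of v] \<tau>_J linear_neg[OF linear_\<omega>1] \<omega>_antisym[of p v])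
  also have "\<dots> = g p v (\<tau> p w)" using \<tau>_in_H[of p w] by (simp add: g_eq H_iff)
  finally show ?thesis .
qed

text \<open>Polarisation of the symmetric form \<open>g(\<tau> \<cdot>, \<cdot>)\<close> on
  \<open>H\<close>. Since \<open>\<tau> T = 0\<close>, only horizontal arguments matter, and
  \<open>\<tau> v\<close>, being horizontal, may be paired with itself.\<close>

lemma \<tau>_eq_0I:
  assumes "\<And>v. v \<in> H p \<Longrightarrow> g p (\<tau> p v) v = 0" shows "\<tau> p v = 0"
proof -
  have pol: "g p (\<tau> p a) b = 0" if "a \<in> H p" "b \<in> H p" for a b
  proof -
    have "a + b \<in> H p" using that by (simp add: H_iff linear_add[OF linear_\<theta>])
    from assms[OF this] have "g p (\<tau> p a) b + g p (\<tau> p b) a = 0"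
      using assms[OF that(1)] assms[OF that(2)]
      by (simp add: linear_add[OF linear_\<tau>] linear_add[OF linear_g1] linear_add[OF linear_g2])
    then show ?thesis using \<tau>_symmetric[of p a b] g_sym[of p a "\<tau> p b"] by simp
  qed
  have "\<tau> p v = \<tau> p (Levi_proj \<theta> T p v)"
    by (simp add: Levi_proj_def linear_diff[OF linear_\<tau>] linear_cmul[OF linear_\<tau>] \<tau>_T)
  then have "g p (\<tau> p v) (\<tau> p v) = 0" using pol[OF proj_in_H[of p v] \<tau>_in_H[of p v]] by simp
  then show ?thesis using g_pos[of "\<tau> p v" p] by force
qed

section \<open>Hamilton's equations\<close>

abbreviation "G \<equiv> G_form A T10 \<theta>"

lemma sharp_eqI:
  assumes w: "w \<in> H p" and G: "\<And>v. v \<in> H p \<Longrightarrow> G p v w = \<xi> v" shows "sharp H G p \<xi> = w"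
  unfolding sharp_def
proof (rule the_equality)
  show "w \<in> H p \<and> (\<forall>v\<in>H p. G p v w = \<xi> v)" using w G by blast
  fix u assume u: "u \<in> H p \<and> (\<forall>v\<in>H p. G p v u = \<xi> v)"
  have d: "u - w \<in> H p" using u w by (simp add: H_iff linear_diff[OF linear_\<theta>])
  have "g p (u - w) u = g p (u - w) w"
    using u G[OF d] d by (simp add: G_eq_g[OF d, symmetric] w)
  then have "g p (u - w) (u - w) = 0" by (simp add: linear_diff[OF linear_g2])
  then show "u = w" using g_pos[of "u - w" p] by force
qed

text \<open>Representing \<open>\<xi>\<close> composed with the projection by the metric on the
  whole tangent space avoids linear algebra on the varying subspace \<open>H\<close>; testing
  against \<open>T\<close> shows that the representing vector is horizontal.\<close>

lemma sharp:
  assumes "linear \<xi>"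
  shows "sharp H G p \<xi> \<in> H p" and "g p v (sharp H G p \<xi>) = \<xi> (Levi_proj \<theta> T p v)"
proof -
  define L where "L w = (\<chi> i. g p (axis i 1) w)" for w
  have lin: "linear L"
    by (rule linearI) (simp_all add: L_def vec_eq_iff linear_add[OF linear_g2] linear_cmul[OF linear_g2])
  have gL: "g p v w = (\<Sum>i\<in>UNIV. v $ i * L w $ i)" for v w
    using linear_expand_axis[OF linear_g1[of p w], of v] by (simp add: L_def)
  have "inj L"
    unfolding linear_injective_0[OF lin]
  proof (intro allI impI)
    fix w assume "L w = 0"
    then have "g p w w = 0" by (simp add: gL)
    then show "w = 0" using g_pos[of w p] by force
  qed
  then have "surj L" using lin linear_injective_imp_surjective by (metis dim_UNIV)
  then obtain w where w: "L w = (\<chi> i. \<xi> (Levi_proj \<theta> T p (axis i 1)))" by (metis surj_def)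
  have lin\<xi>: "linear (\<lambda>v. \<xi> (Levi_proj \<theta> T p v))"
    using linear_compose[OF linear_proj assms] by (simp add: o_def)
  have gw: "g p v w = \<xi> (Levi_proj \<theta> T p v)" for v
    using linear_expand_axis[OF lin\<xi>, of v] by (simp add: gL w)
  have "\<theta> p w = 0" using gw[of "T p"] g_T[of p w] g_sym[of p w "T p"] linear_0[OF assms] by simp
  then have wH: "w \<in> H p" by (simp add: H_iff)
  have "sharp H G p \<xi> = w"
    by (rule sharp_eqI[OF wH]) (simp add: G_eq_g wH gw proj_H)
  then show "sharp H G p \<xi> \<in> H p" "g p v (sharp H G p \<xi>) = \<xi> (Levi_proj \<theta> T p v)"
    using wH gw by simp_all
qed

text \<open>A row of the cometric as a vector, the components of \<open>g dx^i\<close>: in this form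
  it can be solved for and differentiated as a whole.\<close>

definition sharp_rep :: "('m, 'd) chart \<Rightarrow> 'd \<Rightarrow> real ^ 'd \<Rightarrow> real ^ 'd" where
  "sharp_rep c i x = (\<chi> j. cometric A H G c i j x)"

lemma sharp_rep_eq: "sharp_rep c i x = comps A c (pt c x) (sharp H G (pt c x) (\<lambda>v. comps A c (pt c x) v $ i))"
  by (simp add: sharp_rep_def cometric_def Let_def vec_eq_iff)

lemma linear_comps_nth: "c \<in> A \<Longrightarrow> p \<in> fst c \<Longrightarrow> linear (\<lambda>v. comps A c p v $ i)"
  using linear_compose[OF linear_comps bounded_linear.linear[OF bounded_linear_vec_nth], of c p i] by (simp add: o_def)

lemma \<theta>_rep_sharp_rep: assumes c: "c \<in> A" and x: "x \<in> snd c ` fst c" shows "\<theta>_rep c x (sharp_rep c i x) = 0"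
proof -
  obtain p where p: "p \<in> fst c" "x = snd c p" using x by auto
  show ?thesis
    using sharp(1)[OF linear_comps_nth[OF c p(1)], of p i] \<theta>_rep_comps[OF c p(1)] c p by (simp add: sharp_rep_eq H_iff)
qed

text \<open>A nonsingular linear equation that determines the row of the cometric; smoothness and
  derivative of the row are read off from it. The right-hand side is \<open>dx^i\<close> on the
  horizontal part of \<open>a\<close>.\<close>

lemma g_rep_sharp_rep:
  assumes c: "c \<in> A" and x: "x \<in> snd c ` fst c"
  shows "g_rep c x a (sharp_rep c i x) = a $ i - \<theta>_rep c x a * vf_rep A c T x $ i"
proof -
  obtain p where p: "p \<in> fst c" "x = snd c p" using x by auto
  let ?v = "const_vf A c a p"
  have "g_rep c x a (sharp_rep c i x) = g p ?v (sharp H G p (\<lambda>v. comps A c p v $ i))"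
    using g_rep_comps[OF c p(1), of ?v "sharp H G p (\<lambda>v. comps A c p v $ i)"] c p by (simp add: sharp_rep_eq)
  also have "\<dots> = comps A c p (Levi_proj \<theta> T p ?v) $ i" by (rule sharp(2)[OF linear_comps_nth[OF c p(1)]])
  also have "\<dots> = a $ i - \<theta>_rep c x a * vf_rep A c T x $ i"
    using \<theta>_rep_comps[OF c p(1), of ?v] c p
    by (simp add: Levi_proj_def linear_diff[OF linear_comps] linear_cmul[OF linear_comps])
  finally show ?thesis .
qed

lemma g_rep_T: assumes c: "c \<in> A" and x: "x \<in> snd c ` fst c" shows "g_rep c x a (vf_rep A c T x) = \<theta>_rep c x a"
proof -
  obtain p where p: "p \<in> fst c" "x = snd c p" using x by auto
  show ?thesis
    using g_rep_comps[OF c p(1), of "const_vf A c a p" "T p"] \<theta>_rep_comps[OF c p(1), of "const_vf A c a p"] c p by (simp add: g_T)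
qed

lemma cometric_sym:
  assumes c: "c \<in> A" and x: "x \<in> snd c ` fst c" shows "sharp_rep c i x $ j = sharp_rep c j x $ i"
  using g_rep_sharp_rep[OF c x, of "sharp_rep c i x" j] g_rep_sharp_rep[OF c x, of "sharp_rep c j x" i] g_rep_sym[of c x "sharp_rep c i x" "sharp_rep c j x"]
  by (simp add: \<theta>_rep_sharp_rep[OF c x])

lemma smooth_sharp_rep: assumes c: "c \<in> A" shows "smooth_on (snd c ` fst c) (sharp_rep c i)"
proof -
  let ?S = "snd c ` fst c"
  note S = open_range[OF c]
  let ?L = "\<lambda>x w. (\<chi> k. g_rep c x (axis k 1) w) :: real ^ 'd"
  have T': "smooth_on ?S (\<lambda>x. vf_rep A c T x $ i)"
    using smooth_vfD[OF smooth_vf_subset[OF smooth_T] c order_refl] smooth_on_vec[OF S] by blast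
  show ?thesis
  proof (rule smooth_on_linear_equation[OF S, of ?L])
    fix x assume x: "x \<in> ?S"
    show lin: "linear (?L x)"
      by (rule linearI) (simp_all add: vec_eq_iff linear_add[OF linear_g_rep2[OF c x]] linear_cmul[OF linear_g_rep2[OF c x]])
    show "inj (?L x)"
      unfolding linear_injective_0[OF lin]
    proof (intro allI impI)
      fix w assume "?L x w = 0"
      then have "g_rep c x w w = 0"
        using linear_expand_axis[OF linear_g_rep1[OF c x, of w], of w] by (simp add: vec_eq_iff)
      then show "w = 0" using g_rep_pos[OF c x, of w] by force
    qed
    show "?L x (sharp_rep c i x) = (\<chi> k. axis k 1 $ i - \<theta>_rep c x (axis k 1) * vf_rep A c T x $ i)"
      by (simp add: vec_eq_iff g_rep_sharp_rep[OF c x])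
  next
    show "smooth_on ?S (\<lambda>x. ?L x b)" for b
      unfolding smooth_on_vec[OF S] by (simp add: smooth_g_rep[OF c])
    show "smooth_on ?S (\<lambda>x. (\<chi> k. axis k 1 $ i - \<theta>_rep c x (axis k 1) * vf_rep A c T x $ i) :: real ^ 'd)"
      unfolding smooth_on_vec[OF S]
      using smooth_on_diff[OF S smooth_on_const smooth_on_mult[OF S smooth_\<theta>_rep[OF c] T']] by simp
  qed
qed

text \<open>The cometric is parallel: differentiate the equation \<open>g_rep_sharp_rep\<close> that defines it.\<close>

lemma g_rep_sharp_rep_derivative:
  assumes c: "c \<in> A" and x: "x \<in> snd c ` fst c"
  shows "g_rep c x v (frechet_derivative (sharp_rep c i) (at x) a + \<Gamma> c x a (sharp_rep c i x)) =
     \<theta>_rep c x v * \<Gamma> c x a (vf_rep A c T x) $ i - \<Gamma> c x a v $ i"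
proof -
  let ?s' = "frechet_derivative (sharp_rep c i) (at x)" and ?T = "vf_rep A c T x"
  have T': "((\<lambda>x. vf_rep A c T x $ i) has_derivative (\<lambda>a. (- \<Gamma> c x a ?T) $ i)) (at x)"
    by (rule bounded_linear.has_derivative[OF bounded_linear_vec_nth T_has_derivative[OF c x]])
  have "((\<lambda>x. g_rep c x v (sharp_rep c i x)) has_derivative
     (\<lambda>a. g_rep c x (\<Gamma> c x a v) (sharp_rep c i x) + g_rep c x v (\<Gamma> c x a (sharp_rep c i x)) + g_rep c x v (?s' a))) (at x)"
    by (rule g_rep_apply_has_derivative[OF c x smooth_on_has_derivative[OF smooth_sharp_rep[OF c] x]])
  moreover have "((\<lambda>x. g_rep c x v (sharp_rep c i x)) has_derivative
     (\<lambda>a. 0 - (\<theta>_rep c x v * (- \<Gamma> c x a ?T) $ i + \<theta>_rep c x (\<Gamma> c x a v) * ?T $ i))) (at x)"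
  proof (rule has_derivative_transform_within_open[OF _ open_range[OF c] x])
    show "((\<lambda>x. v $ i - \<theta>_rep c x v * vf_rep A c T x $ i) has_derivative
      (\<lambda>a. 0 - (\<theta>_rep c x v * (- \<Gamma> c x a ?T) $ i + \<theta>_rep c x (\<Gamma> c x a v) * ?T $ i))) (at x)"
      by (intro has_derivative_diff has_derivative_const has_derivative_mult \<theta>_rep_has_derivative[OF c x] T')
  qed (simp add: g_rep_sharp_rep[OF c])
  ultimately have "g_rep c x (\<Gamma> c x a v) (sharp_rep c i x) + g_rep c x v (\<Gamma> c x a (sharp_rep c i x)) + g_rep c x v (?s' a) =
     0 - (\<theta>_rep c x v * (- \<Gamma> c x a ?T) $ i + \<theta>_rep c x (\<Gamma> c x a v) * ?T $ i)"
    using has_derivative_unique by (metis (no_types, lifting))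
  then show ?thesis
    by (simp add: g_rep_sharp_rep[OF c x] linear_add[OF linear_g_rep2[OF c x]])
qed

text \<open>A parallel cometric turns its own partial derivative into two \<open>\<Gamma>\<close>
  terms, which contribute equally by symmetry of \<open>g^ij\<close>; this absorbs the factor
  \<open>1/2\<close>. The number \<open>b\<close> is arbitrary because the rows of the cometric are
  horizontal, so a multiple of \<open>\<theta>\<close> does not change the velocity.\<close>

lemma hamilton_eqs:
  assumes c: "c \<in> A" and x: "x \<in> snd c ` fst c" and y: "\<theta>_rep c x y = 0"
    and \<xi>: "\<And>a. \<xi> a = g_rep c x a y + b * \<theta>_rep c x a"
  shows "(\<Sum>j\<in>UNIV. cometric A H G c i j x * \<xi> (axis j 1)) = y $ i"
    and "- 1/2 * (\<Sum>i\<in>UNIV. \<Sum>j\<in>UNIV. frechet_derivative (cometric A H G c i j) (at x) a * \<xi> (axis i 1) * \<xi> (axis j 1))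
      = \<xi> (\<Gamma> c x a y)"
proof -
  have lin: "linear \<xi>"
    by (rule linearI) (simp_all add: \<xi> linear_add[OF linear_g_rep1[OF c x]] linear_cmul[OF linear_g_rep1[OF c x]]
        linear_add[OF linear_\<theta>_rep[OF c x]] linear_cmul[OF linear_\<theta>_rep[OF c x]] algebra_simps)
  have expand: "\<xi> u = (\<Sum>j\<in>UNIV. u $ j * \<xi> (axis j 1))" for u
    using linear_expand_axis[OF lin, of u] by simp
  have \<xi>_sharp_rep: "\<xi> (sharp_rep c i x) = y $ i" for i
    using g_rep_sharp_rep[OF c x, of y i] g_rep_sym[of c x y "sharp_rep c i x"] by (simp add: \<xi> \<theta>_rep_sharp_rep[OF c x] y)
  then show "(\<Sum>j\<in>UNIV. cometric A H G c i j x * \<xi> (axis j 1)) = y $ i"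
    using expand[of "sharp_rep c i x"] by (simp add: sharp_rep_def)
  have sum_sharp_rep: "(\<Sum>i\<in>UNIV. \<xi> (axis i 1) *\<^sub>R sharp_rep c i x) = y"
    unfolding vec_eq_iff
  proof
    fix k
    have "(\<Sum>i\<in>UNIV. \<xi> (axis i 1) *\<^sub>R sharp_rep c i x) $ k = (\<Sum>i\<in>UNIV. sharp_rep c k x $ i * \<xi> (axis i 1))"
      using cometric_sym[OF c x] by (simp add: mult.commute)
    then show "(\<Sum>i\<in>UNIV. \<xi> (axis i 1) *\<^sub>R sharp_rep c i x) $ k = y $ k"
      using \<xi>_sharp_rep[of k] expand[of "sharp_rep c k x"] by simp
  qed
  let ?s' = "\<lambda>i. frechet_derivative (sharp_rep c i) (at x) a" and ?T = "vf_rep A c T x"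
  have d: "frechet_derivative (cometric A H G c i j) (at x) a = ?s' i $ j" for i j
  proof -
    have "((\<lambda>x. sharp_rep c i x $ j) has_derivative (\<lambda>a. frechet_derivative (sharp_rep c i) (at x) a $ j)) (at x)"
      by (rule bounded_linear.has_derivative[OF bounded_linear_vec_nth smooth_on_has_derivative[OF smooth_sharp_rep[OF c] x]])
    moreover have "(\<lambda>x. sharp_rep c i x $ j) = cometric A H G c i j" by (simp add: sharp_rep_def fun_eq_iff)
    ultimately show ?thesis using frechet_derivative_at by metis
  qed
  have thT: "\<theta>_rep c x ?T = 1"
    using x \<theta>_rep_comps[OF c] c by auto
  \<comment> \<open>\<open>\<xi>\<close> sees a vector only through its products with
    \<open>y\<close> and with \<open>T\<close>, so the derivative equation of the cometric is tested
    on just these two.\<close>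
  have s': "\<xi> (?s' i) = - \<Gamma> c x a y $ i - \<xi> (\<Gamma> c x a (sharp_rep c i x))" for i
  proof -
    let ?e = "?s' i + \<Gamma> c x a (sharp_rep c i x)"
    have "g_rep c x ?e y = - \<Gamma> c x a y $ i"
      using g_rep_sharp_rep_derivative[OF c x, of y i a] g_rep_sym[of c x y ?e] by (simp add: y)
    moreover have "\<theta>_rep c x ?e = 0"
      using g_rep_sharp_rep_derivative[OF c x, of ?T i a] g_rep_T[OF c x, of ?e] g_rep_sym[of c x ?T ?e] by (simp add: thT)
    ultimately have "\<xi> ?e = - \<Gamma> c x a y $ i" by (simp add: \<xi>)
    then show ?thesis by (simp add: linear_add[OF lin])
  qed
  have "(\<Sum>i\<in>UNIV. \<Sum>j\<in>UNIV. frechet_derivative (cometric A H G c i j) (at x) a * \<xi> (axis i 1) * \<xi> (axis j 1))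
     = (\<Sum>i\<in>UNIV. \<xi> (axis i 1) * \<xi> (?s' i))"
    unfolding d expand[of "?s' _"] by (simp add: sum_distrib_left mult_ac)
  also have "\<dots> = - (\<Sum>i\<in>UNIV. \<Gamma> c x a y $ i * \<xi> (axis i 1)) - (\<Sum>i\<in>UNIV. \<xi> (axis i 1) * \<xi> (\<Gamma> c x a (sharp_rep c i x)))"
    by (simp add: s' algebra_simps sum_subtractf sum_negf)
  also have "(\<Sum>i\<in>UNIV. \<xi> (axis i 1) * \<xi> (\<Gamma> c x a (sharp_rep c i x))) = \<xi> (\<Gamma> c x a (\<Sum>i\<in>UNIV. \<xi> (axis i 1) *\<^sub>R sharp_rep c i x))"
    by (simp add: linear_sum[OF linear_Gamma2[OF c x]] linear_cmul[OF linear_Gamma2[OF c x]] linear_sum[OF lin] linear_cmul[OF lin])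
  finally show "- 1/2 * (\<Sum>i\<in>UNIV. \<Sum>j\<in>UNIV. frechet_derivative (cometric A H G c i j) (at x) a * \<xi> (axis i 1) * \<xi> (axis j 1))
      = \<xi> (\<Gamma> c x a y)"
    unfolding sum_sharp_rep expand[of "\<Gamma> c x a y", symmetric] by simp
qed

section \<open>Lengthy geodesics\<close>

text \<open>Split \<open>w\<close> into its horizontal part and \<open>\<theta>(w) T\<close>. The
  torsion of two horizontal vectors is a multiple of \<open>T\<close>, hence orthogonal to
  \<open>v\<close>, and only the second part contributes.\<close>

lemma g_torsion:
  assumes v: "v \<in> H p" shows "g p (torsion A D p v w) v = - \<theta> p w * g p (\<tau> p v) v"
proof -
  have "torsion A D p v (Levi_proj \<theta> T p w) = (2 * \<omega> p v w) *\<^sub>R T p"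
    using torsion_H[OF v proj_in_H[of p w]] by (simp add: \<omega>_proj2)
  then have "torsion A D p v w = (2 * \<omega> p v w) *\<^sub>R T p - \<theta> p w *\<^sub>R \<tau> p v"
    using torsion_antisym[of p v "T p"]
    by (simp add: Levi_proj_def linear_diff[OF linear_torsion2] linear_cmul[OF linear_torsion2]
        pseudohermitian_torsion_def algebra_simps)
  moreover have "g p (T p) v = 0" using v g_T[of p v] g_sym[of p v "T p"] by (simp add: H_iff)
  ultimately show ?thesis by (simp add: linear_diff[OF linear_g1] linear_cmul[OF linear_g1])
qed

lemma curve_chart:
  assumes \<gamma>: "Ck_curve A 2 I \<gamma>" and c: "c \<in> A" and t: "t \<in> I" "\<gamma> t \<in> fst c"
  shows "(snd c \<circ> \<gamma> has_vector_derivative comps A c (\<gamma> t) (velocity A \<gamma> t)) (at t)"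
    and "((\<lambda>s. comps A c (\<gamma> s) (velocity A \<gamma> s)) has_vector_derivative
          vector_derivative (\<lambda>s. vector_derivative (snd c \<circ> \<gamma>) (at s)) (at t)) (at t)"
proof -
  let ?I = "{s \<in> I. \<gamma> s \<in> fst c}" and ?dx = "\<lambda>s. vector_derivative (snd c \<circ> \<gamma>) (at s)"
  have \<gamma>': "Ck_curve A (Suc (Suc 0)) I \<gamma>" using \<gamma> by (simp only: numeral_2_eq_2)
  have I: "open ?I" and tI: "t \<in> ?I" using open_curve_preimage[OF \<gamma> c] t by auto
  have x: "(snd c \<circ> \<gamma> has_vector_derivative comps A c (\<gamma> s) (velocity A \<gamma> s)) (at s)" if "s \<in> ?I" for s
    using curve_has_vector_derivative[OF \<gamma>' c] that by simp
  then show "(snd c \<circ> \<gamma> has_vector_derivative comps A c (\<gamma> t) (velocity A \<gamma> t)) (at t)" using tI by blast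
  have "Ck_on (Suc (Suc 0)) ?I (snd c \<circ> \<gamma>)" using \<gamma>' c unfolding Ck_curve_def by blast
  then have "Ck_on (Suc 0) ?I ?dx" by (rule Ck_on_real_SucD(2)[OF I])
  from Ck_on_real_SucD(1)[OF I this tI]
  have "(?dx has_vector_derivative vector_derivative ?dx (at t)) (at t)" .
  then show "((\<lambda>s. comps A c (\<gamma> s) (velocity A \<gamma> s)) has_vector_derivative vector_derivative ?dx (at t)) (at t)"
    by (rule has_vector_derivative_transform_within_open[OF _ I tI]) (rule vector_derivative_at[OF x])
qed

text \<open>Since the metric is parallel, differentiation puts \<open>\<Gamma>\<close> on both
  arguments; the term on the velocity cancels against the acceleration.\<close>

lemma geodesic_dual_derivative:
  assumes geo: "geodesic A D I \<gamma>" and c: "c \<in> A" and t: "t \<in> I" "\<gamma> t \<in> fst c"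
  defines "x \<equiv> snd c \<circ> \<gamma>" and "y \<equiv> \<lambda>s. comps A c (\<gamma> s) (velocity A \<gamma> s)"
  shows "((\<lambda>s. g_rep c (x s) a (y s)) has_vector_derivative g_rep c (x t) (\<Gamma> c (x t) (y t) a) (y t)) (at t)"
proof -
  have \<gamma>: "Ck_curve A 2 I \<gamma>" using geo geodesic_iff by blast
  have xt: "x t \<in> snd c ` fst c" using t by (simp add: x_def)
  have x': "(x has_vector_derivative y t) (at t)" unfolding x_def y_def by (rule curve_chart(1)[OF \<gamma> c t])
  have dx: "vector_derivative (snd c \<circ> \<gamma>) (at t) = y t" using x' by (simp add: x_def vector_derivative_at)
  have "vector_derivative (\<lambda>s. vector_derivative (snd c \<circ> \<gamma>) (at s)) (at t) + \<Gamma> c (x t) (y t) (y t) = 0"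
    using geo[unfolded geodesic_iff, THEN conjunct2, rule_format, OF c t] by (simp only: dx) (simp add: x_def)
  then have "vector_derivative (\<lambda>s. vector_derivative (snd c \<circ> \<gamma>) (at s)) (at t) = - \<Gamma> c (x t) (y t) (y t)"
    by (simp add: eq_neg_iff_add_eq_0)
  then have y': "(y has_vector_derivative - \<Gamma> c (x t) (y t) (y t)) (at t)"
    using curve_chart(2)[OF \<gamma> c t] by (simp add: y_def)
  have "((\<lambda>s. g_rep c (x s) a (y s)) has_vector_derivative
      (g_rep c (x t) (\<Gamma> c (x t) (y t) a) (y t) + g_rep c (x t) a (\<Gamma> c (x t) (y t) (y t))) + g_rep c (x t) a (- \<Gamma> c (x t) (y t) (y t))) (at t)"
    by (rule has_vector_derivative_apply_linear[OF open_range[OF c] xt linear_g_rep2[OF c] g_rep_has_derivative[OF c xt] x' y'])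
  then show ?thesis by (simp add: linear_neg[OF linear_g_rep2[OF c xt]])
qed

lemma g_rep_torsion:
  assumes c: "c \<in> A" "p \<in> fst c" and v: "v \<in> H p"
  shows "g_rep c (snd c p) (\<Gamma> c (snd c p) (comps A c p v) a - \<Gamma> c (snd c p) a (comps A c p v)) (comps A c p v)
    = - \<theta>_rep c (snd c p) a * g p (\<tau> p v) v"
proof -
  let ?w = "const_vf A c a p"
  have "\<Gamma> c (snd c p) (comps A c p v) a - \<Gamma> c (snd c p) a (comps A c p v) = comps A c p (torsion A D p v ?w)"
    using torsion_chart[OF c, of v ?w] c by simp
  then show ?thesis
    using g_rep_comps[OF c, of "torsion A D p v ?w" v] g_torsion[OF v, of ?w] \<theta>_rep_comps[OF c, of ?w] c by simp
qed

theorem sub_Riemannian_if_torsion_zero: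
  assumes \<tau>: "\<And>p v. \<tau> p v = 0" and geo: "geodesic A D I \<gamma>" and len: "lengthy A H I \<gamma>"
  shows "sub_Riemannian_geodesic A H G I \<gamma>"
proof -
  have \<gamma>: "Ck_curve A 2 I \<gamma>" using geo geodesic_iff by blast
  have v: "velocity A \<gamma> t \<in> H (\<gamma> t)" if "t \<in> I" for t using len that by (simp add: lengthy_def)
  define \<xi> where "\<xi> s u = g (\<gamma> s) u (velocity A \<gamma> s)" for s u
  have lift: "cotangent_lift A H G I \<gamma> \<xi>"
    unfolding cotangent_lift_def
  proof (intro ballI conjI)
    fix t assume t: "t \<in> I"
    show "linear (\<xi> t)" unfolding \<xi>_def[abs_def] by (rule linear_g1)
    show "sharp H G (\<gamma> t) (\<xi> t) = velocity A \<gamma> t"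
      by (rule sharp_eqI[OF v[OF t]]) (simp add: \<xi>_def G_eq_g v[OF t])
  qed
  have eqs: "((\<lambda>s. (snd c \<circ> \<gamma>) s $ i) has_real_derivative
        (\<Sum>j\<in>UNIV. cometric A H G c i j ((snd c \<circ> \<gamma>) t) * \<xi> t (coord_vf A c j (\<gamma> t)))) (at t)"
      "((\<lambda>s. \<xi> s (coord_vf A c k (\<gamma> s))) has_real_derivative
         - 1/2 * (\<Sum>i\<in>UNIV. \<Sum>j\<in>UNIV. frechet_derivative (cometric A H G c i j) (at ((snd c \<circ> \<gamma>) t)) (axis k 1) *
           \<xi> t (coord_vf A c i (\<gamma> t)) * \<xi> t (coord_vf A c j (\<gamma> t)))) (at t)"
    if c: "c \<in> A" and t: "t \<in> I" "\<gamma> t \<in> fst c" for c t i k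
  proof -
    let ?x = "snd c \<circ> \<gamma>" and ?y = "\<lambda>s. comps A c (\<gamma> s) (velocity A \<gamma> s)"
    have xt: "?x t \<in> snd c ` fst c" using t by simp
    have \<xi>c: "\<xi> s (const_vf A c a (\<gamma> s)) = g_rep c (?x s) a (?y s)" if "\<gamma> s \<in> fst c" for s a
      using g_rep_comps[OF c that, of "const_vf A c a (\<gamma> s)" "velocity A \<gamma> s"] c that by (simp add: \<xi>_def)
    have thy: "\<theta>_rep c (?x t) (?y t) = 0" using \<theta>_rep_comps[OF c t(2)] v[OF t(1)] by (simp add: H_iff)
    define \<xi>t where "\<xi>t a = \<xi> t (const_vf A c a (\<gamma> t))" for a
    have \<xi>t: "\<xi>t a = g_rep c (?x t) a (?y t) + 0 * \<theta>_rep c (?x t) a" for a by (simp add: \<xi>t_def \<xi>c[OF t(2), simplified])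
    note ham = hamilton_eqs[where b = 0, OF c xt thy \<xi>t]
    have "((\<lambda>s. ?x s $ i) has_vector_derivative ?y t $ i) (at t)"
      by (rule bounded_linear.has_vector_derivative[OF bounded_linear_vec_nth curve_chart(1)[OF \<gamma> c t]])
    then show "((\<lambda>s. ?x s $ i) has_real_derivative (\<Sum>j\<in>UNIV. cometric A H G c i j (?x t) * \<xi> t (coord_vf A c j (\<gamma> t)))) (at t)"
      using ham(1)[of i] by (simp add: \<xi>t_def coord_vf_def has_real_derivative_iff_has_vector_derivative)
    let ?I = "{s \<in> I. \<gamma> s \<in> fst c}"
    have "((\<lambda>s. g_rep c (?x s) (axis k 1) (?y s)) has_vector_derivative g_rep c (?x t) (\<Gamma> c (?x t) (?y t) (axis k 1)) (?y t)) (at t)"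
      by (rule geodesic_dual_derivative[OF geo c t])
    moreover have "g_rep c (?x t) (\<Gamma> c (?x t) (?y t) (axis k 1)) (?y t) = \<xi>t (\<Gamma> c (?x t) (axis k 1) (?y t))"
      using g_rep_torsion[OF c t(2) v[OF t(1)], of "axis k 1"] linear_diff[OF linear_g_rep1[OF c xt]]
      by (simp add: \<tau> \<xi>t linear_0[OF linear_g1])
    ultimately have "((\<lambda>s. g_rep c (?x s) (axis k 1) (?y s)) has_vector_derivative \<xi>t (\<Gamma> c (?x t) (axis k 1) (?y t))) (at t)"
      by simp
    then have "((\<lambda>s. \<xi> s (coord_vf A c k (\<gamma> s))) has_vector_derivative \<xi>t (\<Gamma> c (?x t) (axis k 1) (?y t))) (at t)"
      by (rule has_vector_derivative_transform_within_open[OF _ open_curve_preimage[OF \<gamma> c]])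
        (use t \<xi>c in \<open>auto simp: coord_vf_def\<close>)
    then show "((\<lambda>s. \<xi> s (coord_vf A c k (\<gamma> s))) has_real_derivative
         - 1/2 * (\<Sum>i\<in>UNIV. \<Sum>j\<in>UNIV. frechet_derivative (cometric A H G c i j) (at (?x t)) (axis k 1) *
           \<xi> t (coord_vf A c i (\<gamma> t)) * \<xi> t (coord_vf A c j (\<gamma> t)))) (at t)"
      using ham(2)[of "axis k 1"] by (simp add: \<xi>t_def coord_vf_def has_real_derivative_iff_has_vector_derivative)
  qed
  show ?thesis
    unfolding sub_Riemannian_geodesic_def Let_def
    using \<gamma> lift eqs by (intro conjI exI[of _ \<xi>] ballI impI allI)
qed

text \<open>The multiplier \<open>b = \<xi>(T)\<close> of a sub-Riemannian lift \<open>\<xi> = g(\<cdot>, \<gamma>') + b \<theta>\<close> of a geodesic.\<close>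

lemma multiplier_derivative:
  assumes geo: "geodesic A D I \<gamma>" and len: "lengthy A H I \<gamma>"
    and lift: "cotangent_lift A H G I \<gamma> \<xi>"
    and ham: "\<forall>c\<in>A. \<forall>t\<in>I. \<gamma> t \<in> fst c \<longrightarrow> (\<forall>k.
      ((\<lambda>s. \<xi> s (coord_vf A c k (\<gamma> s))) has_real_derivative
         - 1/2 * (\<Sum>i\<in>UNIV. \<Sum>j\<in>UNIV. frechet_derivative (cometric A H G c i j) (at (snd c (\<gamma> t))) (axis k 1) *
           \<xi> t (coord_vf A c i (\<gamma> t)) * \<xi> t (coord_vf A c j (\<gamma> t)))) (at t))"
    and t: "t \<in> I"
  defines "b \<equiv> \<lambda>s. \<xi> s (T (\<gamma> s))" and "v \<equiv> velocity A \<gamma> t"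
  obtains b' where "(b has_real_derivative b') (at t)"
    "\<And>u. b' * \<theta> (\<gamma> t) u + 2 * b t * \<omega> (\<gamma> t) v u = \<theta> (\<gamma> t) u * g (\<gamma> t) (\<tau> (\<gamma> t) v) v"
proof -
  let ?p = "\<gamma> t"
  define c where "c = chart_at A ?p"
  have c: "c \<in> A" "?p \<in> fst c" using chart_at by (auto simp: c_def)
  let ?x = "snd c \<circ> \<gamma>" and ?y = "\<lambda>s. comps A c (\<gamma> s) (velocity A \<gamma> s)" and ?I = "{s \<in> I. \<gamma> s \<in> fst c}"
  have \<gamma>: "Ck_curve A 2 I \<gamma>" using geo geodesic_iff by blast
  have I: "open ?I" "t \<in> ?I" using open_curve_preimage[OF \<gamma> c(1)] t c by auto
  have vH: "velocity A \<gamma> s \<in> H (\<gamma> s)" if "s \<in> I" for s using len that by (simp add: lengthy_def)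
  have xt: "?x t \<in> snd c ` fst c" and xt': "snd c ?p \<in> snd c ` fst c" using c by simp_all
  have lin: "linear (\<xi> s)" if "s \<in> I" for s using lift that by (simp add: cotangent_lift_def)
  \<comment> \<open>The equation for the velocity determines \<open>\<xi>\<close> on
    \<open>H\<close> only; its value on \<open>T\<close> survives as the multiplier.\<close>
  have \<xi>: "\<xi> s u = g (\<gamma> s) u (velocity A \<gamma> s) + b s * \<theta> (\<gamma> s) u" if s: "s \<in> I" for s u
  proof -
    have "g (\<gamma> s) u (velocity A \<gamma> s) = \<xi> s (Levi_proj \<theta> T (\<gamma> s) u)"
      using sharp(2)[OF lin[OF s], of "\<gamma> s" u] lift s by (simp add: cotangent_lift_def)
    then show ?thesis by (simp add: Levi_proj_def linear_diff[OF lin[OF s]] linear_cmul[OF lin[OF s]] b_def)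
  qed
  have \<xi>c: "\<xi> s (const_vf A c a (\<gamma> s)) = g_rep c (?x s) a (?y s) + b s * \<theta>_rep c (?x s) a" if s: "s \<in> ?I" for s a
    using s c(1) g_rep_comps[OF c(1), of "\<gamma> s" "const_vf A c a (\<gamma> s)" "velocity A \<gamma> s"]
      \<theta>_rep_comps[OF c(1), of "\<gamma> s" "const_vf A c a (\<gamma> s)"] by (simp add: \<xi>)
  have x': "(?x has_vector_derivative ?y t) (at t)" by (rule curve_chart(1)[OF \<gamma> c(1) t c(2)])
  define \<xi>t where "\<xi>t a = \<xi> t (const_vf A c a ?p)" for a
  have \<xi>t: "\<xi>t a = g_rep c (?x t) a (?y t) + b t * \<theta>_rep c (?x t) a" for a using \<xi>c[OF I(2)] by (simp add: \<xi>t_def)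
  have thy: "\<theta>_rep c (?x t) (?y t) = 0" using \<theta>_rep_comps[OF c] vH[OF t] by (simp add: H_iff)
  have \<xi>k: "((\<lambda>s. \<xi> s (coord_vf A c k (\<gamma> s))) has_real_derivative \<xi>t (\<Gamma> c (?x t) (axis k 1) (?y t))) (at t)" for k
    using ham[rule_format, OF c(1) t c(2), of k] hamilton_eqs(2)[OF c(1) xt thy \<xi>t, of "axis k 1"] by (simp add: \<xi>t_def coord_vf_def)
  let ?T = "vf_rep A c T"
  \<comment> \<open>A lift is not assumed differentiable. Hamilton's equations make its chart
    components so, and pairing these with the components of \<open>T\<close> makes \<open>b\<close>
    differentiable.\<close>
  have b_eq: "(\<Sum>k\<in>UNIV. ?T (?x s) $ k * \<xi> s (coord_vf A c k (\<gamma> s))) = b s" if s: "s \<in> ?I" for s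
  proof -
    have "linear (\<lambda>a. \<xi> s (const_vf A c a (\<gamma> s)))"
      using linear_compose[OF linear_const_vf lin] s c(1) by (simp add: o_def)
    from linear_expand_axis[OF this, of "?T (?x s)"] show ?thesis
      using s c(1) by (simp add: b_def coord_vf_def)
  qed
  have "(?T \<circ> ?x has_vector_derivative - \<Gamma> c (?x t) (?y t) (?T (?x t))) (at t)"
    by (rule vector_derivative_diff_chain_within[OF x' has_derivative_at_withinI[OF T_has_derivative[OF c(1) xt]]])
  then have T': "((\<lambda>s. ?T (?x s) $ k) has_real_derivative (- \<Gamma> c (?x t) (?y t) (?T (?x t))) $ k) (at t)" for k
    using bounded_linear.has_vector_derivative[OF bounded_linear_vec_nth]
    by (fastforce simp: has_real_derivative_iff_has_vector_derivative o_def)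
  define b' where "b' = (\<Sum>k\<in>UNIV. (- \<Gamma> c (?x t) (?y t) (?T (?x t))) $ k * \<xi> t (coord_vf A c k (\<gamma> t)) +
      \<xi>t (\<Gamma> c (?x t) (axis k 1) (?y t)) * ?T (?x t) $ k)"
  have "((\<lambda>s. \<Sum>k\<in>UNIV. ?T (?x s) $ k * \<xi> s (coord_vf A c k (\<gamma> s))) has_real_derivative b') (at t)"
    unfolding b'_def by (intro DERIV_sum DERIV_mult T' \<xi>k)
  then have b': "(b has_real_derivative b') (at t)"
    unfolding has_real_derivative_iff_has_vector_derivative
    by (rule has_vector_derivative_transform_within_open[OF _ I]) (rule b_eq)
  have k: "b' * \<theta>_rep c (?x t) (axis k 1) + 2 * b t * \<omega>_rep c (?x t) (?y t) (axis k 1) = \<theta>_rep c (?x t) (axis k 1) * g ?p (\<tau> ?p v) v" for k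
  proof -
    let ?e = "axis k 1 :: real ^ 'd" and ?G = "\<Gamma> c (?x t)"
    have W': "((\<lambda>s. g_rep c (?x s) ?e (?y s)) has_real_derivative g_rep c (?x t) (?G (?y t) ?e) (?y t)) (at t)"
      unfolding has_real_derivative_iff_has_vector_derivative by (rule geodesic_dual_derivative[OF geo c(1) t c(2)])
    have th': "((\<lambda>s. \<theta>_rep c (?x s) ?e) has_real_derivative \<theta>_rep c (?x t) (?G (?y t) ?e)) (at t)"
      unfolding has_real_derivative_iff_has_vector_derivative
      using vector_derivative_diff_chain_within[OF x' has_derivative_at_withinI[OF \<theta>_rep_has_derivative[OF c(1) xt, of ?e]]]
      by (simp add: o_def)
    have "((\<lambda>s. g_rep c (?x s) ?e (?y s) + b s * \<theta>_rep c (?x s) ?e) has_real_derivative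
       g_rep c (?x t) (?G (?y t) ?e) (?y t) + (b' * \<theta>_rep c (?x t) ?e + \<theta>_rep c (?x t) (?G (?y t) ?e) * b t)) (at t)"
      by (intro DERIV_add DERIV_mult W' th' b')
    moreover have "((\<lambda>s. g_rep c (?x s) ?e (?y s) + b s * \<theta>_rep c (?x s) ?e) has_real_derivative \<xi>t (?G ?e (?y t))) (at t)"
      using \<xi>k[of k] unfolding has_real_derivative_iff_has_vector_derivative
      by (rule has_vector_derivative_transform_within_open[OF _ I]) (simp add: coord_vf_def \<xi>c)
    ultimately have "g_rep c (?x t) (?G (?y t) ?e) (?y t) + (b' * \<theta>_rep c (?x t) ?e + \<theta>_rep c (?x t) (?G (?y t) ?e) * b t)
        = \<xi>t (?G ?e (?y t))" by (rule DERIV_unique)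
    \<comment> \<open>The two \<open>\<theta>\<close> terms antisymmetrise \<open>\<Gamma>\<close>;
      by the factor \<open>1/2\<close> in the convention for \<open>d\<theta>\<close> they combine
      to \<open>2 * b\<close> times \<open>d\<theta>\<close>.\<close>
    then have "g_rep c (?x t) (?G (?y t) ?e - ?G ?e (?y t)) (?y t) + b' * \<theta>_rep c (?x t) ?e + 2 * b t * \<omega>_rep c (?x t) (?y t) ?e = 0"
      by (simp add: \<xi>t \<omega>_rep_eq[OF c(1) xt'] linear_diff[OF linear_g_rep1[OF c(1) xt']] field_simps)
    then show ?thesis using g_rep_torsion[OF c vH[OF t], of ?e] by (simp add: v_def)
  qed
  have "b' * \<theta> ?p u + 2 * b t * \<omega> ?p v u = \<theta> ?p u * g ?p (\<tau> ?p v) v" for u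
  proof -
    define L where "L a = b' * \<theta>_rep c (?x t) a + 2 * b t * \<omega>_rep c (?x t) (?y t) a - \<theta>_rep c (?x t) a * g ?p (\<tau> ?p v) v" for a
    have linom: "linear (\<omega>_rep c (snd c ?p) (?y t))"
      using linear_compose[OF linear_const_vf[OF c] linear_\<omega>2, of "?p" "const_vf A c (?y t) ?p"] c
      by (simp add: \<omega>_rep_def[abs_def] o_def)
    have linL: "linear L"
      by (rule linearI) (simp_all add: L_def linear_add[OF linom] linear_cmul[OF linom]
          linear_add[OF linear_\<theta>_rep[OF c(1) xt']] linear_cmul[OF linear_\<theta>_rep[OF c(1) xt']] algebra_simps)
    have "L (axis k 1) = 0" for k using k[of k] by (simp add: L_def)
    then have "L (comps A c ?p u) = 0" using linear_expand_axis[OF linL, of "comps A c ?p u"] by simp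
    then show ?thesis using \<theta>_rep_comps[OF c] \<omega>_rep_comps[OF c] by (simp add: L_def v_def)
  qed
  with b' show ?thesis by (rule that)
qed

text \<open>A zero of the multiplier at the single time \<open>t\<close> would not control its
  derivative. It has to vanish on a neighbourhood, which continuity of the velocity provides once
  the trivial case of zero velocity is split off.\<close>

lemma torsion_zero_along_geodesic:
  assumes geo: "geodesic A D I \<gamma>" and len: "lengthy A H I \<gamma>"
    and sub: "sub_Riemannian_geodesic A H G I \<gamma>" and t: "t \<in> I"
  shows "g (\<gamma> t) (\<tau> (\<gamma> t) (velocity A \<gamma> t)) (velocity A \<gamma> t) = 0"
proof (cases "velocity A \<gamma> t = 0")
  case True
  then show ?thesis by (simp add: linear_0[OF linear_g2])
next
  case False
  obtain \<xi> where lift: "cotangent_lift A H G I \<gamma> \<xi>" and ham: "\<forall>c\<in>A. \<forall>t\<in>I. \<gamma> t \<in> fst c \<longrightarrow> (\<forall>k.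
      ((\<lambda>s. \<xi> s (coord_vf A c k (\<gamma> s))) has_real_derivative
         - 1/2 * (\<Sum>i\<in>UNIV. \<Sum>j\<in>UNIV. frechet_derivative (cometric A H G c i j) (at (snd c (\<gamma> t))) (axis k 1) *
           \<xi> t (coord_vf A c i (\<gamma> t)) * \<xi> t (coord_vf A c j (\<gamma> t)))) (at t))"
    using sub unfolding sub_Riemannian_geodesic_def Let_def o_def by blast
  have \<gamma>: "Ck_curve A 2 I \<gamma>" using geo geodesic_iff by blast
  note mult = multiplier_derivative[OF geo len lift ham]
  let ?b = "\<lambda>s. \<xi> s (T (\<gamma> s))"
  have b0: "?b s = 0" if s: "s \<in> I" and v: "velocity A \<gamma> s \<noteq> 0" for s
  proof -
    let ?v = "velocity A \<gamma> s"
    obtain b' where "\<And>u. b' * \<theta> (\<gamma> s) u + 2 * ?b s * \<omega> (\<gamma> s) ?v u = \<theta> (\<gamma> s) u * g (\<gamma> s) (\<tau> (\<gamma> s) ?v) ?v"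
      by (rule mult[OF s]) (rule that)
    from this[of "J (\<gamma> s) ?v"] have "b' * \<theta> (\<gamma> s) (J (\<gamma> s) ?v) + 2 * ?b s * \<omega> (\<gamma> s) ?v (J (\<gamma> s) ?v) =
        \<theta> (\<gamma> s) (J (\<gamma> s) ?v) * g (\<gamma> s) (\<tau> (\<gamma> s) ?v) ?v" .
    moreover have "\<theta> (\<gamma> s) (J (\<gamma> s) ?v) = 0" using J_in_H by (simp add: H_iff)
    moreover have "\<theta> (\<gamma> s) ?v = 0" using len s by (simp add: lengthy_def H_iff)
    ultimately have "?b s * g (\<gamma> s) ?v ?v = 0" by (simp add: g_eq)
    then show ?thesis using g_pos[OF v, of "\<gamma> s"] by simp
  qed
  define c where "c = chart_at A (\<gamma> t)"
  have c: "c \<in> A" "\<gamma> t \<in> fst c" using chart_at by (auto simp: c_def)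
  let ?y = "\<lambda>s. comps A c (\<gamma> s) (velocity A \<gamma> s)"
  have "isCont ?y t" using curve_chart(2)[OF \<gamma> c(1) t c(2)] has_vector_derivative_continuous by blast
  moreover have "?y t \<noteq> 0" using False by (simp add: c_def)
  ultimately obtain U where U: "open U" "t \<in> U" "\<And>s. s \<in> U \<Longrightarrow> ?y s \<in> - {0}"
    unfolding continuous_at_open by (metis ComplI open_Compl closed_singleton singletonD)
  let ?V = "U \<inter> {s \<in> I. \<gamma> s \<in> fst c}"
  have V: "open ?V" "t \<in> ?V" using U open_curve_preimage[OF \<gamma> c(1)] t c by auto
  have b0V: "?b s = 0" if "s \<in> ?V" for s
    using b0[of s] U(3)[of s] that linear_0[OF linear_comps[OF c(1), of "\<gamma> s"]] by force
  obtain b' where b': "(?b has_real_derivative b') (at t)"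
    "\<And>u. b' * \<theta> (\<gamma> t) u + 2 * ?b t * \<omega> (\<gamma> t) (velocity A \<gamma> t) u =
      \<theta> (\<gamma> t) u * g (\<gamma> t) (\<tau> (\<gamma> t) (velocity A \<gamma> t)) (velocity A \<gamma> t)"
    by (rule mult[OF t]) (rule that)
  have "((\<lambda>s. 0) has_real_derivative b') (at t)"
    using b'(1) unfolding has_real_derivative_iff_has_vector_derivative
    by (rule has_vector_derivative_transform_within_open[OF _ V]) (rule b0V)
  then have "b' = 0" using DERIV_unique DERIV_const by blast
  then show ?thesis using b'(2)[of "T (\<gamma> t)"] by simp
qed

section \<open>Existence of lengthy geodesics\<close>

lemma smooth_geodesic_field:
  assumes c: "c \<in> A"
  shows "smooth_on ((snd c ` fst c) \<times> UNIV) (\<lambda>z. \<Gamma> c (fst z) (snd z) (snd z))"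
proof -
  let ?S = "(snd c ` fst c) \<times> (UNIV :: (real ^ 'd) set)"
  have S: "open ?S" using open_range[OF c] by (intro open_Times) auto
  have f: "smooth_on ?S fst" and s: "smooth_on ?S snd"
    by (simp_all add: smooth_on_def Ck_on_linear bounded_linear_fst bounded_linear_snd)
  have 1: "smooth_on ?S (\<lambda>z. \<Gamma> c (fst z) a b)" for a b
    by (rule smooth_on_compose[OF S open_range[OF c] _ smooth_Gamma[OF c] f]) auto
  have 2: "smooth_on ?S (\<lambda>z. \<Gamma> c (fst z) a (snd z))" for a
    by (rule smooth_on_apply_linear[OF S _ 1 s]) (auto intro: linear_Gamma2[OF c])
  show ?thesis
    by (rule smooth_on_apply_linear[where L="\<lambda>z a. \<Gamma> c (fst z) a (snd z)", OF S _ 2 s]) (auto intro: linear_Gamma1[OF c])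
qed

text \<open>The geodesic equation is solved in one chart as a first-order system for position and
  velocity. Because \<open>\<theta>\<close> is parallel, its value on the velocity is constant along
  the solution, so a horizontal start keeps the curve lengthy.\<close>

lemma lengthy_geodesic_exists:
  assumes v: "v \<in> H p"
  obtains I \<gamma> where "0 \<in> I" "geodesic A D I \<gamma>" "lengthy A H I \<gamma>" "\<gamma> 0 = p" "velocity A \<gamma> 0 = v"
proof -
  define c where "c = chart_at A p"
  have c: "c \<in> A" "p \<in> fst c" using chart_at by (auto simp: c_def)
  let ?V = "snd c ` fst c"
  let ?S = "?V \<times> (UNIV :: (real ^ 'd) set)"
  let ?f = "\<lambda>z. (snd z, - \<Gamma> c (fst z) (snd z) (snd z))"
  have S: "open ?S" "(snd c p, v) \<in> ?S" using open_range[OF c(1)] c by (auto intro: open_Times)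
  have f: "Ck_on 1 ?S ?f"
    by (rule Ck_on_Pair[OF S(1) Ck_on_linear[OF bounded_linear_snd]
          Ck_on_minus[OF S(1) smooth_on_CkD[OF smooth_geodesic_field[OF c(1)]]]])
  obtain e u where e: "e > 0" and u0: "u 0 = (snd c p, v)"
    and u: "\<And>t. t \<in> {-e<..<e} \<Longrightarrow> u t \<in> ?S \<and> (u has_vector_derivative ?f (u t)) (at t)"
    by (rule ode_local_solution[OF S f]) (rule that)
  let ?I = "{-e<..<e}"
  define x where "x t = fst (u t)" for t
  define y where "y t = snd (u t)" for t
  have xV: "x t \<in> ?V" if "t \<in> ?I" for t using u[OF that] by (auto simp: x_def mem_Times_iff)
  have x': "(x has_vector_derivative y t) (at t)" if "t \<in> ?I" for t
    using bounded_linear.has_vector_derivative[OF bounded_linear_fst, of u "?f (u t)" "at t"] u[OF that]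
    by (simp add: x_def[abs_def] y_def)
  have y': "(y has_vector_derivative - \<Gamma> c (x t) (y t) (y t)) (at t)" if "t \<in> ?I" for t
    using bounded_linear.has_vector_derivative[OF bounded_linear_snd, of u "?f (u t)" "at t"] u[OF that]
    by (simp add: x_def y_def[abs_def])
  have u_cont: "continuous_on ?I u"
    using u has_vector_derivative_continuous continuous_at_imp_continuous_on by blast
  have "continuous_on ?S ?f" using Ck_on_mono[OF f, of 0] by (simp only: Ck_on.simps(1))
  then have "continuous_on ?I (\<lambda>t. ?f (u t))"
    by (rule continuous_on_compose2[OF _ u_cont]) (use u in blast)
  from continuous_on_snd[OF this] have "continuous_on ?I (\<lambda>t. - \<Gamma> c (x t) (y t) (y t))" by (simp add: x_def y_def)
  then have "Ck_on 0 ?I (\<lambda>t. - \<Gamma> c (x t) (y t) (y t))" by (simp only: Ck_on.simps(1))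
  \<comment> \<open>The solution is only known to be differentiable; \<open>x' = y\<close> together
    with a continuous \<open>y'\<close> raises \<open>x\<close> to class \<open>C^2\<close>, as the
    definition of geodesics requires.\<close>
  from Ck_on_real_SucI[OF open_greaterThanLessThan x' Ck_on_real_SucI[OF open_greaterThanLessThan y' this]]
  have Ck: "Ck_on 2 ?I x" by (simp only: numeral_2_eq_2)
  let ?\<gamma> = "pt c \<circ> x"
  have geo: "geodesic A D ?I ?\<gamma>"
    by (rule geodesic_chartI[OF c(1) _ _ _ xV x' y' Ck]) (use e in auto)
  have \<gamma>: "Ck_curve A 2 ?I ?\<gamma>" using geo geodesic_iff by blast
  have vel: "comps A c (?\<gamma> t) (velocity A ?\<gamma> t) = y t" "?\<gamma> t \<in> fst c" "snd c (?\<gamma> t) = x t" if t: "t \<in> ?I" for t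
  proof -
    show \<gamma>t: "?\<gamma> t \<in> fst c" "snd c (?\<gamma> t) = x t" using pt_in[OF xV[OF t]] snd_pt[OF xV[OF t]] by simp_all
    have "(snd c \<circ> ?\<gamma> has_vector_derivative y t) (at t)"
      by (rule has_vector_derivative_transform_within_open[OF x'[OF t] open_greaterThanLessThan t])
        (use snd_pt[OF xV] in simp)
    then show "comps A c (?\<gamma> t) (velocity A ?\<gamma> t) = y t"
      using curve_chart(1)[OF \<gamma> c(1) t \<gamma>t(1)] vector_derivative_unique_at by blast
  qed
  have th': "((\<lambda>t. \<theta>_rep c (x t) (y t)) has_field_derivative 0) (at t within ?I)" if t: "t \<in> ?I" for t
  proof -
    have "((\<lambda>t. \<theta>_rep c (x t) (y t)) has_vector_derivative
        \<theta>_rep c (x t) (\<Gamma> c (x t) (y t) (y t)) + \<theta>_rep c (x t) (- \<Gamma> c (x t) (y t) (y t))) (at t)"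
      by (rule has_vector_derivative_apply_linear[OF open_range[OF c(1)] xV[OF t] linear_\<theta>_rep[OF c(1)]
            \<theta>_rep_has_derivative[OF c(1) xV[OF t]] x'[OF t] y'[OF t]])
    then show ?thesis
      by (simp add: linear_neg[OF linear_\<theta>_rep[OF c(1) xV[OF t]]] has_field_derivative_at_within
          flip: has_real_derivative_iff_has_vector_derivative)
  qed
  obtain k where k: "\<And>t. t \<in> ?I \<Longrightarrow> \<theta>_rep c (x t) (y t) = k"
    using has_field_derivative_zero_constant[OF convex_real_interval(8) th'] by blast
  have zero: "0 \<in> ?I" using e by simp
  have xy0: "x 0 = snd c p" "y 0 = v" using u0 by (simp_all add: x_def y_def)
  have vc: "comps A c p v = v" by (simp add: c_def)
  have "k = 0" using k[OF zero] \<theta>_rep_comps[OF c, of v] v by (simp add: xy0 vc H_iff)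
  then have len: "lengthy A H ?I ?\<gamma>"
    unfolding lengthy_def H_iff using k \<theta>_rep_comps[OF c(1) vel(2)] vel by metis
  have p: "?\<gamma> 0 = p" using c by (simp add: xy0)
  have "velocity A ?\<gamma> 0 = v" using vel(1)[OF zero] unfolding p by (simp add: xy0 c_def)
  with zero geo len p show ?thesis by (rule that)
qed

theorem torsion_zero_if_sub_Riemannian:
  assumes "\<And>I \<gamma>. geodesic A D I \<gamma> \<Longrightarrow> lengthy A H I \<gamma> \<Longrightarrow> sub_Riemannian_geodesic A H G I \<gamma>"
  shows "\<tau> p v = 0"
proof (rule \<tau>_eq_0I)
  fix v assume "v \<in> H p"
  then obtain I \<gamma> where \<gamma>: "0 \<in> I" "geodesic A D I \<gamma>" "lengthy A H I \<gamma>" "\<gamma> 0 = p" "velocity A \<gamma> 0 = v"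
    by (rule lengthy_geodesic_exists)
  show "g p (\<tau> p v) v = 0"
    using torsion_zero_along_geodesic[OF \<gamma>(2,3) assms[OF \<gamma>(2,3)] \<gamma>(1)] \<gamma>(4,5) by simp
qed

end

theorem corollary1:
  fixes A :: "('m::{t2_space, second_countable_topology}, 'd::finite) chart set"
    and n :: nat
    and T10 :: "'m \<Rightarrow> (complex ^ 'd) set"
    and \<theta> :: "'m \<Rightarrow> real ^ 'd \<Rightarrow> real"
    and T :: "'m \<Rightarrow> real ^ 'd"
    and D :: "('m, 'd) connection"
  assumes dim: "CARD('d) = 2 * n + 1"
    and manifold: "smooth_atlas A" "orientable A"
    and CR: "CR_structure A n T10"
    and contact: "pseudohermitian_form A T10 \<theta>"
    and strictly_pseudoconvex: "positive_definite_on (Levi_distr T10) (G_form A T10 \<theta>)"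
    and T: "characteristic_direction A \<theta> T"
    and D: "Tanaka_Webster A T10 \<theta> T D"
  shows "((\<forall>p v. pseudohermitian_torsion A T D p v = 0) \<longrightarrow>
            (\<forall>I \<gamma>. geodesic A D I \<gamma> \<and> lengthy A (Levi_distr T10) I \<gamma> \<longrightarrow>
               sub_Riemannian_geodesic A (Levi_distr T10) (G_form A T10 \<theta>) I \<gamma>)) \<and>
         ((\<forall>I \<gamma>. geodesic A D I \<gamma> \<and> lengthy A (Levi_distr T10) I \<gamma> \<longrightarrow>
               sub_Riemannian_geodesic A (Levi_distr T10) (G_form A T10 \<theta>) I \<gamma>) \<longrightarrow>
            (\<forall>p v. pseudohermitian_torsion A T D p v = 0))"
proof -
  interpret pseudohermitian A n T10 \<theta> T D
    using dim manifold(1) CR contact strictly_pseudoconvex T D by unfold_locales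
  show ?thesis
    using sub_Riemannian_if_torsion_zero torsion_zero_if_sub_Riemannian by blast
qed

end
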